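(* Let $\Theta=(\theta_{jk})$ be a strongly totally irrational real skew-symmetric $n\times n$ matrix, $n\ge2$. Let projections $P_I\in\mathcal{A}_\Theta$ and integers $k_{I_J},k_{I_0}$ be fixed as described in the context, and let $R_I$ be defined from them as in the context. There exists $\delta>0$ such that for any unital $C^*$-algebra $\mathcal{A}$ with $T(\mathcal{A})\ne\emptyset$ and any unitaries $u_1,\dots,u_n$ and $\tilde u_1,\dots,\tilde u_n$ in $\mathcal{A}$ satisfying (1) $\|u_ku_j-e^{2\pi i\theta_{jk}}u_ju_k\|<2$ for $j,k=1,\dots,n$, (2) $\tilde u_k\tilde u_j=e^{2\pi i\theta_{jk}}\tilde u_j\tilde u_k$ for $j,k=1,\dots,n$, (3) $\|\tilde u_j-u_j\|<\delta$ for $j=1,\dots,n$, one has $$\tau(R_I(u_1,\dots,u_n))=\mathrm{pf}(M_I^\Theta)+\sum_{0<|J|<l}\mathrm{pf}(M_J^\Theta)k_{I_J}+k_{I_0}$$ for all $I=(i_1,\dots,i_l)$ with $1\le i_1<\dots<i_l\le n$, $l=2m$, $m\in\{1,\dots,\lfloor n/2\rfloor\}$, and all tracial states $\tau$ on $\mathcal{A}$, where the sum is over $J=(i_1,\dots,i_s)$, $s=2,4,\dots,l-2$.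
   Context: **Noncommutative torus.** $\mathcal{A}_\Theta$ is the universal $C^*$-algebra generated by unitaries $\mathfrak{u}_1,\dots,\mathfrak{u}_n$ with $\mathfrak{u}_k\mathfrak{u}_j=e^{2\pi i\theta_{jk}}\mathfrak{u}_j\mathfrak{u}_k$. Its canonical tracial state $\tau_\Theta$ satisfies $\tau_\Theta(1)=1$ and vanishes on $\mathfrak{u}_1^{k_1}\cdots\mathfrak{u}_n^{k_n}$ for $(k_1,\dots,k_n)\ne0$. $T(\mathcal{A})$ is the set of tracial states of $\mathcal{A}$. **Pfaffians.** $\mathrm{pf}(A)$ is the pfaffian of an even-size skew-symmetric matrix (normalized to be $1$ on the block diagonal matrix with blocks $\begin{pmatrix}0&1\\-1&0\end{pmatrix}$). For $I=(i_1<\dots<i_{2p})$, $|I|=2p$ and $M_I^\Theta$ is the submatrix of $\Theta$ with rows and columns indexed by $I$. **The map $F$.** For an even-size skew-symmetric matrix $B=\begin{pmatrix}B_{11}&B_{12}\\ B_{21}&B_{22}\end{pmatrix}$ of size $>2$ with $B_{11}$ an invertible $2\times2$ block, $F(B)=B_{22}-B_{21}B_{11}^{-1}B_{12}$. $F^0(B)=B$ and $F^j$ is the $j$-fold iterate; $F^j(B)_{11}$ denotes the upper left $2\times2$ block. **Irrationality.** $\Theta$ is totally irrational if $1$ and the numbers $\mathrm{pf}(M_I^\Theta)$, over all $I$ of even length with $0<|I|\le n$, are linearly independent over $\mathbb{Q}$. It is strongly totally irrational if it is totally irrational and, when $n\ge4$, $\mathrm{pf}(F^j(M_I^\Theta)_{11})\in(0,1)$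 for all $I$ with $4\le|I|=2m\le2\lfloor n/2\rfloor$ and all $j=0,\dots,m-2$. **Projections $P_I$.** For strongly totally irrational $\Theta$, for each $I=(i_1,\dots,i_l)$, $1\le i_1<\dots<i_l\le n$, $l=2m$, $1\le m\le\lfloor n/2\rfloor$, there is a projection $P_I\in\mathcal{A}_\Theta$ and integers $k_{I_J},k_{I_0}$ such that $$\tau_\Theta(P_I)=\mathrm{pf}(M_I^\Theta)+\sum_{0<|J|<l}\mathrm{pf}(M_J^\Theta)k_{I_J}+k_{I_0},$$ $J=(i_1,\dots,i_s)$, $s=2,4,\dots,l-2$. Each $P_I$ lies in the $C^*$-subalgebra generated by $\mathfrak{u}_{i_1},\dots,\mathfrak{u}_{i_l}$ and has a norm-convergent expansion $P_I=\sum_{k_1,\dots,k_l\in\mathbb{Z}}a_{I,k_1,\dots,k_l}\mathfrak{u}_{i_1}^{k_1}\cdots\mathfrak{u}_{i_l}^{k_l}$ with $a_{I,k_1,\dots,k_l}\in\mathbb{C}$. Such $P_I$, with their integers and expansions, are fixed once and for all. **Elements $e_I$ and $R_I$.** For unitaries $u_1,\dots,u_n$ in a unital $C^*$-algebra and a positive integer $N$ put $$e_I(u_1,\dots,u_n)=\tfrac12\left(S_I+S_I^*\right),\quad S_I=\sum_{k_1=-N}^{N}\cdots\sum_{k_l=-N}^{N}a_{I,k_1,\dots,k_l}u_{i_1}^{k_1}\cdots u_{i_l}^{k_l}.$$ Fix $0<\delta'<\frac18$ such that for all self-adjoint $a,b$ in any unital $C^*$-algebra with spectra in $[-\frac18,\frac18]\cup[\frac78,\frac98]$,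 $\|a-b\|<\delta'$ implies $\|\chi_{(1/2,\infty)}(a)-\chi_{(1/2,\infty)}(b)\|<1$. Fix $N$ so large that $\|P_I-e_I(\mathfrak{u}_1,\dots,\mathfrak{u}_n)\|<\delta'$ for all $I$. There is $\delta_0>0$ such that whenever $\|u_ku_j-e^{2\pi i\theta_{jk}}u_ju_k\|<\delta_0$ for all $j,k$, one has $\|e_I^2-e_I\|<\frac14$, so $\frac12\notin\mathrm{spec}(e_I)$; then $R_I(u_1,\dots,u_n)=\chi_{(1/2,\infty)}(e_I(u_1,\dots,u_n))$, a projection defined by continuous functional calculus. In the proposition $\delta$ is understood to be small enough that (2) and (3) ensure that $R_I(u_1,\dots,u_n)$ is defined. *)

theory Defs
  imports
    "HOL-Analysis.Analysis"
    "HOL-Algebra.Ring"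
    "HOL-Combinatorics.Permutations"
    "HOL-Computational_Algebra.Polynomial"
    "Jordan_Normal_Form.Gauss_Jordan_Elimination"
begin

section \<open>Unital C*-algebras\<close>

text \<open>
  C*-algebras are records with an explicit carrier, so that one can quantify over them inside
  a formula. No algebraic structure on the ambient type \<open>'a\<close> is ever used.
\<close>

record 'a cstar_algebra = "'a ring" +
  scl :: "complex \<Rightarrow> 'a \<Rightarrow> 'a"
  adj :: "'a \<Rightarrow> 'a"
  cnorm :: "'a \<Rightarrow> real"

locale unital_cstar_algebra = ring A for A :: "('a, 'm) cstar_algebra_scheme" (structure) +
  assumes scl_closed: "x \<in> carrier A \<Longrightarrow> scl A c x \<in> carrier A"
    and scl_add_right: "\<lbrakk>x \<in> carrier A; y \<in> carrier A\<rbrakk>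
          \<Longrightarrow> scl A c (x \<oplus> y) = scl A c x \<oplus> scl A c y"
    and scl_add_left: "x \<in> carrier A \<Longrightarrow> scl A (c + d) x = scl A c x \<oplus> scl A d x"
    and scl_scl: "x \<in> carrier A \<Longrightarrow> scl A c (scl A d x) = scl A (c * d) x"
    and scl_one: "x \<in> carrier A \<Longrightarrow> scl A 1 x = x"
    and scl_mult_left: "\<lbrakk>x \<in> carrier A; y \<in> carrier A\<rbrakk>
          \<Longrightarrow> scl A c x \<otimes> y = scl A c (x \<otimes> y)"
    and scl_mult_right: "\<lbrakk>x \<in> carrier A; y \<in> carrier A\<rbrakk>
          \<Longrightarrow> x \<otimes> scl A c y = scl A c (x \<otimes> y)"
    and adj_closed: "x \<in> carrier A \<Longrightarrow> adj A x \<in> carrier A"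
    and adj_adj: "x \<in> carrier A \<Longrightarrow> adj A (adj A x) = x"
    and adj_add: "\<lbrakk>x \<in> carrier A; y \<in> carrier A\<rbrakk>
          \<Longrightarrow> adj A (x \<oplus> y) = adj A x \<oplus> adj A y"
    and adj_scl: "x \<in> carrier A \<Longrightarrow> adj A (scl A c x) = scl A (cnj c) (adj A x)"
    and adj_mult: "\<lbrakk>x \<in> carrier A; y \<in> carrier A\<rbrakk>
          \<Longrightarrow> adj A (x \<otimes> y) = adj A y \<otimes> adj A x"
    and cnorm_nonneg: "x \<in> carrier A \<Longrightarrow> 0 \<le> cnorm A x"
    and cnorm_eq_zero: "x \<in> carrier A \<Longrightarrow> cnorm A x = 0 \<longleftrightarrow> x = \<zero>"
    and cnorm_triangle: "\<lbrakk>x \<in> carrier A; y \<in> carrier A\<rbrakk>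
          \<Longrightarrow> cnorm A (x \<oplus> y) \<le> cnorm A x + cnorm A y"
    and cnorm_scl: "x \<in> carrier A \<Longrightarrow> cnorm A (scl A c x) = cmod c * cnorm A x"
    and cnorm_mult: "\<lbrakk>x \<in> carrier A; y \<in> carrier A\<rbrakk>
          \<Longrightarrow> cnorm A (x \<otimes> y) \<le> cnorm A x * cnorm A y"
    and cnorm_cstar: "x \<in> carrier A \<Longrightarrow> cnorm A (adj A x \<otimes> x) = (cnorm A x)\<^sup>2"
    and cnorm_complete: "\<lbrakk>\<And>i. X i \<in> carrier A;
            \<And>e. e > 0 \<Longrightarrow> \<exists>M. \<forall>i\<ge>M. \<forall>j\<ge>M. cnorm A (X i \<ominus> X j) < e\<rbrakk>
          \<Longrightarrow> \<exists>x\<in>carrier A. (\<lambda>i. cnorm A (X i \<ominus> x)) \<longlonglongrightarrow> 0"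

definition unitary_elem :: "('a, 'm) cstar_algebra_scheme \<Rightarrow> 'a \<Rightarrow> bool" where
  "unitary_elem A u \<longleftrightarrow> u \<in> carrier A \<and>
     adj A u \<otimes>\<^bsub>A\<^esub> u = \<one>\<^bsub>A\<^esub> \<and> u \<otimes>\<^bsub>A\<^esub> adj A u = \<one>\<^bsub>A\<^esub>"

definition selfadjoint :: "('a, 'm) cstar_algebra_scheme \<Rightarrow> 'a \<Rightarrow> bool" where
  "selfadjoint A x \<longleftrightarrow> x \<in> carrier A \<and> adj A x = x"

definition is_projection :: "('a, 'm) cstar_algebra_scheme \<Rightarrow> 'a \<Rightarrow> bool" where
  "is_projection A p \<longleftrightarrow> selfadjoint A p \<and> p \<otimes>\<^bsub>A\<^esub> p = p"

definition tracial_state :: "('a, 'm) cstar_algebra_scheme \<Rightarrow> ('a \<Rightarrow> complex) \<Rightarrow> bool" where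
  "tracial_state A \<tau> \<longleftrightarrow>
     (\<forall>x\<in>carrier A. \<forall>y\<in>carrier A. \<tau> (x \<oplus>\<^bsub>A\<^esub> y) = \<tau> x + \<tau> y) \<and>
     (\<forall>c. \<forall>x\<in>carrier A. \<tau> (scl A c x) = c * \<tau> x) \<and>
     (\<forall>x\<in>carrier A. \<tau> (adj A x \<otimes>\<^bsub>A\<^esub> x) \<in> \<real> \<and> 0 \<le> Re (\<tau> (adj A x \<otimes>\<^bsub>A\<^esub> x))) \<and>
     \<tau> \<one>\<^bsub>A\<^esub> = 1 \<and>
     (\<forall>x\<in>carrier A. \<forall>y\<in>carrier A. \<tau> (x \<otimes>\<^bsub>A\<^esub> y) = \<tau> (y \<otimes>\<^bsub>A\<^esub> x))"

definition cstar_hom :: "('a, 'm) cstar_algebra_scheme \<Rightarrow> ('b, 'k) cstar_algebra_scheme \<Rightarrow> ('a \<Rightarrow> 'b) \<Rightarrow> bool" where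
  "cstar_hom A B \<phi> \<longleftrightarrow> \<phi> \<in> ring_hom A B \<and>
     (\<forall>c. \<forall>x\<in>carrier A. \<phi> (scl A c x) = scl B c (\<phi> x)) \<and>
     (\<forall>x\<in>carrier A. \<phi> (adj A x) = adj B (\<phi> x))"

definition cstar_subalgebra :: "('a, 'm) cstar_algebra_scheme \<Rightarrow> 'a set \<Rightarrow> bool" where
  "cstar_subalgebra A B \<longleftrightarrow> B \<subseteq> carrier A \<and> \<zero>\<^bsub>A\<^esub> \<in> B \<and>
     (\<forall>x\<in>B. \<forall>y\<in>B. x \<oplus>\<^bsub>A\<^esub> y \<in> B \<and> x \<otimes>\<^bsub>A\<^esub> y \<in> B) \<and>
     (\<forall>c. \<forall>x\<in>B. scl A c x \<in> B) \<and>
     (\<forall>x\<in>B. adj A x \<in> B) \<and>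
     (\<forall>X x. (\<forall>i. X i \<in> B) \<and> x \<in> carrier A \<and> (\<lambda>i::nat. cnorm A (X i \<ominus>\<^bsub>A\<^esub> x)) \<longlonglongrightarrow> 0
        \<longrightarrow> x \<in> B)"

definition cstar_generated :: "('a, 'm) cstar_algebra_scheme \<Rightarrow> 'a set \<Rightarrow> 'a set" where
  "cstar_generated A S = \<Inter>{B. cstar_subalgebra A B \<and> S \<subseteq> B}"

subsection \<open>Spectrum and continuous functional calculus\<close>

definition alg_spectrum :: "('a, 'm) cstar_algebra_scheme \<Rightarrow> 'a \<Rightarrow> complex set" where
  "alg_spectrum A x = {z. scl A z \<one>\<^bsub>A\<^esub> \<ominus>\<^bsub>A\<^esub> x \<notin> Units A}"

definition alg_poly :: "('a, 'm) cstar_algebra_scheme \<Rightarrow> complex poly \<Rightarrow> 'a \<Rightarrow> 'a" where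
  "alg_poly A p x = (\<Oplus>\<^bsub>A\<^esub>i\<in>{..degree p}. scl A (coeff p i) (x [^]\<^bsub>A\<^esub> i))"

text \<open>
  For self-adjoint \<open>x\<close> and \<open>f\<close> continuous on the spectrum, \<open>f(x)\<close> is the norm limit of \<open>p\<^sub>k(x)\<close> for
  any polynomials \<open>p\<^sub>k\<close> converging to \<open>f\<close> uniformly on the spectrum; by Weierstrass such polynomials
  exist. For other \<open>x\<close> or \<open>f\<close> the value is unspecified.
\<close>

definition cfc :: "('a, 'm) cstar_algebra_scheme \<Rightarrow> (complex \<Rightarrow> complex) \<Rightarrow> 'a \<Rightarrow> 'a" where
  "cfc A f x = (THE y. y \<in> carrier A \<and>
     (\<forall>p :: nat \<Rightarrow> complex poly.
        uniform_limit (alg_spectrum A x) (\<lambda>k. poly (p k)) f sequentially \<longrightarrow>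
        (\<lambda>k. cnorm A (alg_poly A (p k) x \<ominus>\<^bsub>A\<^esub> y)) \<longlonglongrightarrow> 0))"

text \<open>\<open>\<chi>\<^bsub>(1/2,\<infinity>)\<^esub>(x)\<close> for self-adjoint \<open>x\<close> with \<open>1/2\<close> not in the spectrum.\<close>

definition chi_half :: "('a, 'm) cstar_algebra_scheme \<Rightarrow> 'a \<Rightarrow> 'a" where
  "chi_half A x = cfc A (\<lambda>z. if Re z > 1/2 then 1 else 0) x"

section \<open>Pfaffians and irrationality\<close>

definition pf :: "real mat \<Rightarrow> real" where
  "pf B = (let m = dim_row B div 2 in
     (\<Sum>\<sigma> | \<sigma> permutes {..<2 * m}.
        of_int (sign \<sigma>) * (\<Prod>i<m. B $$ (\<sigma> (2 * i), \<sigma> (2 * i + 1)))) / (2 ^ m * fact m))"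

text \<open>
  Following the matrix library, indices start at \<open>0\<close>. A multi-index \<open>I = (i\<^sub>1 < \<dots> < i\<^sub>l)\<close> with
  \<open>l\<close> even, \<open>0 < l\<close>, is a strictly increasing list; its initial segments are \<open>take s I\<close>.
\<close>

definition even_tuples :: "nat \<Rightarrow> nat list set" where
  "even_tuples n = {I. sorted_wrt (<) I \<and> set I \<subseteq> {..<n} \<and> even (length I) \<and> 0 < length I}"

definition minor_mat :: "real mat \<Rightarrow> nat list \<Rightarrow> real mat" where
  "minor_mat \<Theta> I = mat (length I) (length I) (\<lambda>(r, s). \<Theta> $$ (I ! r, I ! s))"

definition block11 :: "real mat \<Rightarrow> real mat" where
  "block11 B = fst (split_block B 2 2)"

text \<open>Meaningful only if the upper left \<open>2 \<times> 2\<close> block is invertible.\<close>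

definition schurF :: "real mat \<Rightarrow> real mat" where
  "schurF B = (case split_block B 2 2 of (B11, B12, B21, B22) \<Rightarrow>
     B22 - B21 * the (mat_inverse B11) * B12)"

definition totally_irrational :: "nat \<Rightarrow> real mat \<Rightarrow> bool" where
  "totally_irrational n \<Theta> \<longleftrightarrow>
     (\<forall>(c0 :: rat) (c :: nat list \<Rightarrow> rat).
        of_rat c0 + (\<Sum>I\<in>even_tuples n. of_rat (c I) * pf (minor_mat \<Theta> I)) = 0 \<longrightarrow>
        c0 = 0 \<and> (\<forall>I\<in>even_tuples n. c I = 0))"

text \<open>The condition for smaller \<open>j\<close> makes the block inverted by the next application of
  \<^const>\<open>schurF\<close> invertible.\<close>

definition strongly_totally_irrational :: "nat \<Rightarrow> real mat \<Rightarrow> bool" where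
  "strongly_totally_irrational n \<Theta> \<longleftrightarrow> totally_irrational n \<Theta> \<and>
     (n \<ge> 4 \<longrightarrow>
       (\<forall>I\<in>even_tuples n. \<forall>m. length I = 2 * m \<and> 4 \<le> 2 * m \<longrightarrow>
          (\<forall>j\<le>m - 2. pf (block11 ((schurF ^^ j) (minor_mat \<Theta> I))) \<in> {0<..<1})))"

section \<open>Noncommutative tori\<close>

definition twist :: "real mat \<Rightarrow> nat \<Rightarrow> nat \<Rightarrow> complex" where
  "twist \<Theta> j k = exp (2 * of_real pi * \<i> * of_real (\<Theta> $$ (j, k)))"

definition commutation_defect ::
    "('a, 'm) cstar_algebra_scheme \<Rightarrow> real mat \<Rightarrow> (nat \<Rightarrow> 'a) \<Rightarrow> nat \<Rightarrow> nat \<Rightarrow> real" where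
  "commutation_defect A \<Theta> u j k =
     cnorm A (u k \<otimes>\<^bsub>A\<^esub> u j \<ominus>\<^bsub>A\<^esub> scl A (twist \<Theta> j k) (u j \<otimes>\<^bsub>A\<^esub> u k))"

definition nc_torus_relations ::
    "nat \<Rightarrow> real mat \<Rightarrow> ('a, 'm) cstar_algebra_scheme \<Rightarrow> (nat \<Rightarrow> 'a) \<Rightarrow> bool" where
  "nc_torus_relations n \<Theta> A u \<longleftrightarrow> (\<forall>j<n. unitary_elem A (u j)) \<and>
     (\<forall>j<n. \<forall>k<n. u k \<otimes>\<^bsub>A\<^esub> u j = scl A (twist \<Theta> j k) (u j \<otimes>\<^bsub>A\<^esub> u k))"

text \<open>
  Quantification over all types is not available inside a formula, so a property of ``every
  C*-algebra'' is stated for the C*-algebras whose carrier is a set of elements of the type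
  \<^typ>\<open>real\<close>. The reals serve here only as a set of the cardinality of the continuum (their
  arithmetic plays no role). Every separable C*-algebra is isomorphic to such an algebra, and the
  properties below only concern the C*-subalgebra generated by finitely many elements. Hence
  they hold for all C*-algebras as soon as they hold for these ones.
\<close>

definition is_nc_torus ::
    "nat \<Rightarrow> real mat \<Rightarrow> ('t, 'm) cstar_algebra_scheme \<Rightarrow> (nat \<Rightarrow> 't) \<Rightarrow> bool" where
  "is_nc_torus n \<Theta> T U \<longleftrightarrow> unital_cstar_algebra T \<and> nc_torus_relations n \<Theta> T U \<and>
     cstar_generated T (U ` {..<n}) = carrier T \<and>
     (\<forall>(B :: real cstar_algebra) v. unital_cstar_algebra B \<and> nc_torus_relations n \<Theta> B v \<longrightarrow>
        (\<exists>\<phi>. cstar_hom T B \<phi> \<and> (\<forall>j<n. \<phi> (U j) = v j)))"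

definition monomial :: "('a, 'm) cstar_algebra_scheme \<Rightarrow> (nat \<Rightarrow> 'a) \<Rightarrow> nat list \<Rightarrow> int list \<Rightarrow> 'a" where
  "monomial A u I ks = foldr (mult A) (map2 (\<lambda>i k. u i [^]\<^bsub>A\<^esub> k) I ks) \<one>\<^bsub>A\<^esub>"

definition canonical_trace ::
    "nat \<Rightarrow> ('t, 'm) cstar_algebra_scheme \<Rightarrow> (nat \<Rightarrow> 't) \<Rightarrow> ('t \<Rightarrow> complex) \<Rightarrow> bool" where
  "canonical_trace n T U \<tau> \<longleftrightarrow> tracial_state T \<tau> \<and>
     (\<forall>ks. length ks = n \<and> (\<exists>k\<in>set ks. k \<noteq> 0) \<longrightarrow> \<tau> (monomial T U [0..<n] ks) = 0)"

section \<open>The elements \<open>e\<^sub>I\<close> and the projections \<open>R\<^sub>I\<close>\<close>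

text \<open>\<open>a I [k\<^sub>1,\<dots>,k\<^sub>l]\<close> is the coefficient \<open>a\<^bsub>I,k\<^sub>1,\<dots>,k\<^sub>l\<^esub>\<close>.\<close>

definition S_elem :: "('a, 'm) cstar_algebra_scheme \<Rightarrow> (nat list \<Rightarrow> int list \<Rightarrow> complex) \<Rightarrow> nat \<Rightarrow>
    nat list \<Rightarrow> (nat \<Rightarrow> 'a) \<Rightarrow> 'a" where
  "S_elem A a N I u =
     (\<Oplus>\<^bsub>A\<^esub>ks\<in>{ks. length ks = length I \<and> set ks \<subseteq> {- int N..int N}}. scl A (a I ks) (monomial A u I ks))"

definition e_elem :: "('a, 'm) cstar_algebra_scheme \<Rightarrow> (nat list \<Rightarrow> int list \<Rightarrow> complex) \<Rightarrow> nat \<Rightarrow>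
    nat list \<Rightarrow> (nat \<Rightarrow> 'a) \<Rightarrow> 'a" where
  "e_elem A a N I u = scl A (1/2) (S_elem A a N I u \<oplus>\<^bsub>A\<^esub> adj A (S_elem A a N I u))"

definition R_elem :: "('a, 'm) cstar_algebra_scheme \<Rightarrow> (nat list \<Rightarrow> int list \<Rightarrow> complex) \<Rightarrow> nat \<Rightarrow>
    nat list \<Rightarrow> (nat \<Rightarrow> 'a) \<Rightarrow> 'a" where
  "R_elem A a N I u = chi_half A (e_elem A a N I u)"

definition R_defined :: "('a, 'm) cstar_algebra_scheme \<Rightarrow> (nat list \<Rightarrow> int list \<Rightarrow> complex) \<Rightarrow> nat \<Rightarrow>
    nat list \<Rightarrow> (nat \<Rightarrow> 'a) \<Rightarrow> bool" where
  "R_defined A a N I u \<longleftrightarrow>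
     (let e = e_elem A a N I u in
        cnorm A (e \<otimes>\<^bsub>A\<^esub> e \<ominus>\<^bsub>A\<^esub> e) < 1/4 \<and> 1/2 \<notin> alg_spectrum A e)"

text \<open>\<open>k I J\<close> and \<open>k0 I\<close> are the integers \<open>k\<^bsub>I\<^sub>J\<^esub>\<close> and \<open>k\<^bsub>I\<^sub>0\<^esub>\<close>.\<close>

definition trace_value :: "real mat \<Rightarrow> (nat list \<Rightarrow> nat list \<Rightarrow> int) \<Rightarrow> (nat list \<Rightarrow> int) \<Rightarrow> nat list \<Rightarrow> real" where
  "trace_value \<Theta> k k0 I = pf (minor_mat \<Theta> I) +
     (\<Sum>s | even s \<and> 0 < s \<and> s < length I. pf (minor_mat \<Theta> (take s I)) * of_int (k I (take s I))) +
     of_int (k0 I)"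

text \<open>The requirement on \<open>\<delta>'\<close>, cf. the remark on \<^typ>\<open>real\<close> above.\<close>

definition chi_close :: "real \<Rightarrow> bool" where
  "chi_close d \<longleftrightarrow> (\<forall>(A :: real cstar_algebra) x y.
     unital_cstar_algebra A \<and> selfadjoint A x \<and> selfadjoint A y \<and>
     alg_spectrum A x \<subseteq> complex_of_real ` ({-1/8..1/8} \<union> {7/8..9/8}) \<and>
     alg_spectrum A y \<subseteq> complex_of_real ` ({-1/8..1/8} \<union> {7/8..9/8}) \<and>
     cnorm A (x \<ominus>\<^bsub>A\<^esub> y) < d \<longrightarrow>
     cnorm A (chi_half A x \<ominus>\<^bsub>A\<^esub> chi_half A y) < 1)"

text \<open>
  \<open>\<delta>\<close> works for all unital C*-algebras with carrier in the type \<open>'a\<close>: the relations below ensure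
  that every \<open>R\<^sub>I(u\<^sub>1,\<dots>,u\<^sub>n)\<close> is defined and has the prescribed value under every tracial state.
\<close>

definition delta_works :: "'a itself \<Rightarrow> nat \<Rightarrow> real mat \<Rightarrow> (nat list \<Rightarrow> int list \<Rightarrow> complex) \<Rightarrow> nat \<Rightarrow>
    (nat list \<Rightarrow> nat list \<Rightarrow> int) \<Rightarrow> (nat list \<Rightarrow> int) \<Rightarrow> real \<Rightarrow> bool" where
  "delta_works (_ :: 'a itself) n \<Theta> a N k k0 \<delta> \<longleftrightarrow>
     (\<forall>(A :: 'a cstar_algebra) u v.
        unital_cstar_algebra A \<and> (\<exists>\<tau>. tracial_state A \<tau>) \<and>
        (\<forall>j<n. unitary_elem A (u j)) \<and>
        (\<forall>j<n. unitary_elem A (v j)) \<and>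
        (\<forall>j<n. \<forall>k<n. commutation_defect A \<Theta> u j k < 2) \<and>
        (\<forall>j<n. \<forall>k<n. v k \<otimes>\<^bsub>A\<^esub> v j = scl A (twist \<Theta> j k) (v j \<otimes>\<^bsub>A\<^esub> v k)) \<and>
        (\<forall>j<n. cnorm A (v j \<ominus>\<^bsub>A\<^esub> u j) < \<delta>) \<longrightarrow>
        (\<forall>I\<in>even_tuples n. R_defined A a N I u \<and>
           (\<forall>\<tau>. tracial_state A \<tau> \<longrightarrow> \<tau> (R_elem A a N I u) = of_real (trace_value \<Theta> k k0 I))))"

end

theory Submission
  imports Defs "HOL-Computational_Algebra.Fundamental_Theorem_Algebra"
begin

text \<open>
  Universality gives a homomorphism \<open>\<phi>\<close> sending the generators to the exact solution \<open>v\<^sub>j\<close> close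
  to \<open>u\<^sub>j\<close>, so \<open>p = \<phi>(P\<^sub>I)\<close> is a projection at distance less than \<open>1/8\<close> from \<open>e\<^sub>I(u\<^sub>1,\<dots>,u\<^sub>n)\<close>: homomorphisms are contractive, and
  \<open>e\<^sub>I\<close> is Lipschitz in the unitaries with a constant independent of the algebra, so that \<open>\<delta>\<close> only has
  to beat the margin left by \<open>\<parallel>P\<^sub>I - e\<^sub>I\<parallel> < \<delta>' < 1/8\<close>. Then \<open>R\<^sub>I\<close> is a projection at distance
  at most \<open>1/2\<close> from \<open>e\<^sub>I\<close>, hence at distance less than \<open>1\<close> from \<open>p\<close>, and close projections have the
  same trace. Finally \<open>\<tau> \<circ> \<phi>\<close> and the canonical trace are both tracial, and
  irrationality of \<open>\<Theta>\<close> forces a tracial state to kill all nontrivial monomials, so both have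
  at \<open>P\<^sub>I\<close> the value \<open>a\<^bsub>I,0,\<dots>,0\<^esub>\<close>.

  For the transfer to other carrier types, the subalgebra generated by finitely many elements has at
  most the cardinality of the continuum and can be copied onto a set of reals.
\<close>

section \<open>Norm and limits\<close>

text \<open>Every quantitative step hangs on one fact: the spectrum of a self-adjoint element
  contains a point whose modulus is the norm. It turns inclusions of spectra into norm estimates,
  hence yields contractivity of homomorphisms and a functional calculus by norm limits of
  polynomials. It is reached through powers of two only, where the C*-identity makes the norm of a
  self-adjoint element multiplicative. The constant 1/8 leaves slack twice: at distance r < 1/8 from
  a projection, \<parallel>e^2 - e\<parallel> \<le> r + r^2 < 1/4, and 1/2 + r < 1. A tracial state
  kills a monomial because some generator commutes with it up to a phase different from 1; the phase
  is exp(2 pi i s) with s an integer combination of entries of \<Theta>. Universality provides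
  homomorphisms only into algebras carried by reals, which forces the detour through copies. The
  detour has to preserve only norms, the polynomial calculus and the pullback of tracial
  states.\<close>

context unital_cstar_algebra
begin

lemmas cstar_closed [simp, intro] = scl_closed adj_closed

lemma scl_zero_left [simp]: "x \<in> carrier A \<Longrightarrow> scl A 0 x = \<zero>"
  using scl_add_left[of x 0 0] by (simp add: local.add.l_cancel_one')

lemma scl_zero_right [simp]: "scl A c \<zero> = \<zero>"
  using scl_add_right[of \<zero> \<zero> c] by (simp add: local.add.l_cancel_one')

lemma scl_minus_left: "x \<in> carrier A \<Longrightarrow> scl A (- c) x = \<ominus> scl A c x"
  by (rule minus_equality[symmetric]) (simp_all flip: scl_add_left)

lemma scl_minus_one: "x \<in> carrier A \<Longrightarrow> \<ominus> x = scl A (-1) x"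
  by (simp add: scl_minus_left scl_one)

lemma scl_minus_right: "x \<in> carrier A \<Longrightarrow> scl A c (\<ominus> x) = \<ominus> scl A c x"
  by (simp add: scl_minus_one scl_scl mult.commute)

lemma scl_diff_right:
  "\<lbrakk>x \<in> carrier A; y \<in> carrier A\<rbrakk> \<Longrightarrow> scl A c (x \<ominus> y) = scl A c x \<ominus> scl A c y"
  by (simp add: a_minus_def scl_add_right scl_minus_right)

lemma scl_diff_left:
  "x \<in> carrier A \<Longrightarrow> scl A (c - d) x = scl A c x \<ominus> scl A d x"
  using scl_add_left[of x c "- d"] by (simp add: a_minus_def scl_minus_left)

lemma adj_one [simp]: "adj A \<one> = \<one>"
  by (metis adj_adj adj_closed adj_mult l_one one_closed r_one)

lemma adj_zero [simp]: "adj A \<zero> = \<zero>"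
  using adj_scl[of \<zero> 0] by simp

lemma adj_minus: "x \<in> carrier A \<Longrightarrow> adj A (\<ominus> x) = \<ominus> adj A x"
  by (simp add: scl_minus_one adj_scl)

lemma adj_diff:
  "\<lbrakk>x \<in> carrier A; y \<in> carrier A\<rbrakk> \<Longrightarrow> adj A (x \<ominus> y) = adj A x \<ominus> adj A y"
  by (simp add: a_minus_def adj_add adj_minus)

lemma cnorm_zero [simp]: "cnorm A \<zero> = 0"
  by (simp add: cnorm_eq_zero)

lemma cnorm_minus [simp]: "x \<in> carrier A \<Longrightarrow> cnorm A (\<ominus> x) = cnorm A x"
  by (simp add: scl_minus_one cnorm_scl)

lemma diff_add_diff:
  "\<lbrakk>x \<in> carrier A; y \<in> carrier A; z \<in> carrier A\<rbrakk> \<Longrightarrow> (x \<ominus> y) \<oplus> (y \<ominus> z) = x \<ominus> z"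
  by algebra

lemma add_diff_add_left:
  "\<lbrakk>x \<in> carrier A; y \<in> carrier A; z \<in> carrier A\<rbrakk> \<Longrightarrow> (x \<oplus> y) \<ominus> (x \<oplus> z) = y \<ominus> z"
  by algebra

lemma diff_diff_diff_left:
  assumes "x \<in> carrier A" "y \<in> carrier A" "z \<in> carrier A"
  shows "(x \<ominus> y) \<ominus> (x \<ominus> z) = z \<ominus> y"
  using add_diff_add_left[of x "\<ominus> y" "\<ominus> z"] assms by (simp add: a_minus_def a_comm)

lemma l_diff:
  "\<lbrakk>x \<in> carrier A; y \<in> carrier A; z \<in> carrier A\<rbrakk> \<Longrightarrow> (x \<ominus> y) \<otimes> z = x \<otimes> z \<ominus> y \<otimes> z"
  by (simp add: a_minus_def l_distr l_minus)

lemma r_diff: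
  "\<lbrakk>x \<in> carrier A; y \<in> carrier A; z \<in> carrier A\<rbrakk> \<Longrightarrow> z \<otimes> (x \<ominus> y) = z \<otimes> x \<ominus> z \<otimes> y"
  by (simp add: a_minus_def r_distr r_minus)

lemma diff_eq_zero_iff: "\<lbrakk>x \<in> carrier A; y \<in> carrier A\<rbrakk> \<Longrightarrow> x \<ominus> y = \<zero> \<longleftrightarrow> x = y"
  by (metis add.inv_closed add.inv_inv a_minus_def minus_equality r_neg)

lemma cnorm_diff_commute:
  assumes "x \<in> carrier A" "y \<in> carrier A" shows "cnorm A (x \<ominus> y) = cnorm A (y \<ominus> x)"
proof -
  have "x \<ominus> y = \<ominus> (y \<ominus> x)" using assms by algebra
  then show ?thesis using assms by simp
qed

lemma cnorm_triangle_diff: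
  "\<lbrakk>x \<in> carrier A; y \<in> carrier A\<rbrakk> \<Longrightarrow> cnorm A (x \<ominus> y) \<le> cnorm A x + cnorm A y"
  using cnorm_triangle[of x "\<ominus> y"] by (simp add: a_minus_def)

lemma cnorm_dist_triangle:
  assumes "x \<in> carrier A" "y \<in> carrier A" "z \<in> carrier A"
  shows "cnorm A (x \<ominus> z) \<le> cnorm A (x \<ominus> y) + cnorm A (y \<ominus> z)"
  using cnorm_triangle[of "x \<ominus> y" "y \<ominus> z"] assms by (simp add: diff_add_diff)

lemma cnorm_triangle_diff':
  assumes "x \<in> carrier A" "y \<in> carrier A"
  shows "\<bar>cnorm A x - cnorm A y\<bar> \<le> cnorm A (x \<ominus> y)"
proof -
  have "cnorm A x \<le> cnorm A (x \<ominus> y) + cnorm A y" "cnorm A y \<le> cnorm A (y \<ominus> x) + cnorm A x"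
    using cnorm_dist_triangle[of x y \<zero>] cnorm_dist_triangle[of y x \<zero>] assms
    by (simp_all add: a_minus_def)
  then show ?thesis using cnorm_diff_commute[OF assms] by linarith
qed

lemma cnorm_dist_eq_zero: "\<lbrakk>x \<in> carrier A; y \<in> carrier A\<rbrakk> \<Longrightarrow> cnorm A (x \<ominus> y) = 0 \<longleftrightarrow> x = y"
  by (simp add: cnorm_eq_zero diff_eq_zero_iff)

text \<open>The C*-identity and submultiplicativity give \<parallel>y\<parallel>^2 \<le>
  \<parallel>adj y\<parallel> \<parallel>y\<parallel>; this is applied to x and to its
  adjoint.\<close>

lemma cnorm_adj [simp]:
  assumes "x \<in> carrier A" shows "cnorm A (adj A x) = cnorm A x"
proof -
  have *: "cnorm A y \<le> cnorm A (adj A y)" if "y \<in> carrier A" for y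
  proof (cases "cnorm A y = 0")
    case False
    have "(cnorm A y)\<^sup>2 \<le> cnorm A (adj A y) * cnorm A y"
      using cnorm_cstar[OF that] cnorm_mult[of "adj A y" y] that by simp
    then show ?thesis using False cnorm_nonneg[OF that] by (simp add: power2_eq_square)
  qed (simp add: cnorm_nonneg that)
  show ?thesis using *[of x] *[of "adj A x"] assms by (simp add: adj_adj)
qed

text \<open>Equality can fail: the zero ring satisfies all axioms, and there the unit has norm
  0.\<close>

lemma cnorm_one_le: "cnorm A \<one> \<le> 1"
proof (cases "cnorm A \<one> = 0")
  case False
  have "(cnorm A \<one>)\<^sup>2 = cnorm A \<one>" using cnorm_cstar[of \<one>] by simp
  then show ?thesis using False by (simp add: power2_eq_square)
qed simp

lemma unitary_closed: "unitary_elem A u \<Longrightarrow> u \<in> carrier A"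
  by (simp add: unitary_elem_def)

lemma cnorm_unitary: "unitary_elem A u \<Longrightarrow> cnorm A u \<le> 1"
  using cnorm_cstar[of u] cnorm_one_le cnorm_nonneg[of u]
  by (auto simp: unitary_elem_def intro: power2_le_imp_le)

lemma cnorm_selfadjoint_sq: "selfadjoint A x \<Longrightarrow> cnorm A (x \<otimes> x) = (cnorm A x)\<^sup>2"
  using cnorm_cstar[of x] by (simp add: selfadjoint_def)

text \<open>The carrier type has no topology, so convergence is expressed throughout by real norm
  distances tending to 0.\<close>

lemma lim_unique:
  assumes "\<And>i. X i \<in> carrier A" "x \<in> carrier A" "y \<in> carrier A"
    "(\<lambda>i. cnorm A (X i \<ominus> x)) \<longlonglongrightarrow> 0" "(\<lambda>i. cnorm A (X i \<ominus> y)) \<longlonglongrightarrow> 0"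
  shows "x = y"
proof -
  have "(\<lambda>i. cnorm A (X i \<ominus> x) + cnorm A (X i \<ominus> y)) \<longlonglongrightarrow> 0 + 0"
    using assms by (intro tendsto_add)
  moreover have "cnorm A (x \<ominus> y) \<le> cnorm A (X i \<ominus> x) + cnorm A (X i \<ominus> y)" for i
    using cnorm_dist_triangle[OF assms(2) assms(1) assms(3), of i]
      cnorm_diff_commute[OF assms(2) assms(1), of i] by linarith
  ultimately have "cnorm A (x \<ominus> y) \<le> 0 + 0"
    by (intro LIMSEQ_le_const) auto
  then show ?thesis using assms cnorm_nonneg[of "x \<ominus> y"] cnorm_dist_eq_zero[of x y] by auto
qed

lemma lim_comparison:
  assumes "\<And>i. X i \<in> carrier A" "x \<in> carrier A" "\<And>i. cnorm A (X i \<ominus> x) \<le> f i" "f \<longlonglongrightarrow> 0"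
  shows "(\<lambda>i. cnorm A (X i \<ominus> x)) \<longlonglongrightarrow> 0"
  by (rule tendsto_sandwich[of "\<lambda>_. 0" _ _ f]) (use assms cnorm_nonneg in auto)

lemma lim_const: "x \<in> carrier A \<Longrightarrow> (\<lambda>i. cnorm A (x \<ominus> x)) \<longlonglongrightarrow> 0"
  by (simp add: r_neg a_minus_def)

lemma lim_add:
  assumes "\<And>i. X i \<in> carrier A" "\<And>i. Y i \<in> carrier A" "x \<in> carrier A" "y \<in> carrier A"
    "(\<lambda>i. cnorm A (X i \<ominus> x)) \<longlonglongrightarrow> 0" "(\<lambda>i. cnorm A (Y i \<ominus> y)) \<longlonglongrightarrow> 0"
  shows "(\<lambda>i. cnorm A ((X i \<oplus> Y i) \<ominus> (x \<oplus> y))) \<longlonglongrightarrow> 0"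
proof (rule lim_comparison)
  have "(X i \<oplus> Y i) \<ominus> (x \<oplus> y) = (X i \<ominus> x) \<oplus> (Y i \<ominus> y)" for i
    using assms(1)[of i] assms(2)[of i] assms(3,4) by algebra
  then show "cnorm A ((X i \<oplus> Y i) \<ominus> (x \<oplus> y)) \<le> cnorm A (X i \<ominus> x) + cnorm A (Y i \<ominus> y)" for i
    using assms by (simp add: cnorm_triangle)
  show "(\<lambda>i. cnorm A (X i \<ominus> x) + cnorm A (Y i \<ominus> y)) \<longlonglongrightarrow> 0"
    using tendsto_add[OF assms(5,6)] by simp
qed (use assms in auto)

lemma cnorm_lim:
  assumes "\<And>i. X i \<in> carrier A" "x \<in> carrier A" "(\<lambda>i. cnorm A (X i \<ominus> x)) \<longlonglongrightarrow> 0"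
  shows "(\<lambda>i. cnorm A (X i)) \<longlonglongrightarrow> cnorm A x"
proof -
  have "(\<lambda>i. cnorm A (X i) - cnorm A x) \<longlonglongrightarrow> 0"
    by (rule Lim_null_comparison[OF _ assms(3)])
      (intro always_eventually allI, use cnorm_triangle_diff'[OF assms(1,2)] in \<open>simp only: real_norm_def\<close>)
  then show ?thesis by (rule LIM_zero_cancel)
qed

lemma cnorm_mult_diff:
  assumes "x \<in> carrier A" "y \<in> carrier A" "x' \<in> carrier A" "y' \<in> carrier A"
  shows "cnorm A (x \<otimes> y \<ominus> x' \<otimes> y') \<le> cnorm A (x \<ominus> x') * cnorm A y + cnorm A x' * cnorm A (y \<ominus> y')"
proof -
  have "x \<otimes> y \<ominus> x' \<otimes> y' = (x \<ominus> x') \<otimes> y \<oplus> x' \<otimes> (y \<ominus> y')"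
    using assms by (simp add: l_diff r_diff diff_add_diff)
  then show ?thesis
    using cnorm_triangle[of "(x \<ominus> x') \<otimes> y" "x' \<otimes> (y \<ominus> y')"] cnorm_mult[of "x \<ominus> x'" y]
      cnorm_mult[of x' "y \<ominus> y'"] assms by simp
qed

lemma lim_mult:
  assumes "\<And>i. X i \<in> carrier A" "\<And>i. Y i \<in> carrier A" "x \<in> carrier A" "y \<in> carrier A"
    "(\<lambda>i. cnorm A (X i \<ominus> x)) \<longlonglongrightarrow> 0" "(\<lambda>i. cnorm A (Y i \<ominus> y)) \<longlonglongrightarrow> 0"
  shows "(\<lambda>i. cnorm A (X i \<otimes> Y i \<ominus> x \<otimes> y)) \<longlonglongrightarrow> 0"
proof (rule lim_comparison)
  show "cnorm A (X i \<otimes> Y i \<ominus> x \<otimes> y) \<le> cnorm A (X i \<ominus> x) * cnorm A (Y i) + cnorm A x * cnorm A (Y i \<ominus> y)" for i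
    using assms by (simp add: cnorm_mult_diff)
  show "(\<lambda>i. cnorm A (X i \<ominus> x) * cnorm A (Y i) + cnorm A x * cnorm A (Y i \<ominus> y)) \<longlonglongrightarrow> 0"
    using tendsto_add[OF tendsto_mult[OF assms(5) cnorm_lim[OF assms(2,4,6)]]
      tendsto_mult[OF tendsto_const[of "cnorm A x"] assms(6)]] by simp
qed (use assms in auto)

lemma lim_scl:
  assumes "\<And>i. X i \<in> carrier A" "x \<in> carrier A" "c \<longlonglongrightarrow> d"
    "(\<lambda>i. cnorm A (X i \<ominus> x)) \<longlonglongrightarrow> 0"
  shows "(\<lambda>i. cnorm A (scl A (c i) (X i) \<ominus> scl A d x)) \<longlonglongrightarrow> 0"
proof (rule lim_comparison)
  have "scl A (c i) (X i) \<ominus> scl A d x = scl A (c i) (X i \<ominus> x) \<oplus> scl A (c i - d) x" for i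
    using assms by (simp add: scl_diff_left scl_diff_right diff_add_diff)
  then show "cnorm A (scl A (c i) (X i) \<ominus> scl A d x) \<le> cmod (c i) * cnorm A (X i \<ominus> x) + cmod (c i - d) * cnorm A x" for i
    using cnorm_triangle[of "scl A (c i) (X i \<ominus> x)" "scl A (c i - d) x"] assms by (simp add: cnorm_scl)
  have "(\<lambda>i. cmod (c i - d)) \<longlonglongrightarrow> 0" using assms(3) by (simp add: LIM_zero tendsto_norm_zero)
  from tendsto_add[OF tendsto_mult[OF tendsto_norm[OF assms(3)] assms(4)] tendsto_mult[OF this tendsto_const[of "cnorm A x"]]]
  show "(\<lambda>i. cmod (c i) * cnorm A (X i \<ominus> x) + cmod (c i - d) * cnorm A x) \<longlonglongrightarrow> 0" by simp
qed (use assms in auto)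

lemma lim_adj:
  assumes "\<And>i. X i \<in> carrier A" "x \<in> carrier A" "(\<lambda>i. cnorm A (X i \<ominus> x)) \<longlonglongrightarrow> 0"
  shows "(\<lambda>i. cnorm A (adj A (X i) \<ominus> adj A x)) \<longlonglongrightarrow> 0"
  using assms by (simp flip: adj_diff)

subsection \<open>Invertibility and spectral radius\<close>

text \<open>The partial sums of the geometric series are the iterates of t -> 1 + x t from 0.
  Shifting both indices of a difference by one multiplies it by x, which gives the Cauchy estimate
  by induction. Commutation of x with every partial sum passes to the limit, so the limit is a
  two-sided inverse.\<close>

lemma neumann:
  assumes x: "x \<in> carrier A" and n: "cnorm A x < 1"
  shows "\<one> \<ominus> x \<in> Units A"
proof -
  define s where "s n = ((\<lambda>t. \<one> \<oplus> x \<otimes> t) ^^ n) \<zero>" for n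
  define r where "r = cnorm A x"
  \<comment> \<open>The sum of the scalar geometric series: the fixed point of t -> 1 + r t, hence a
    bound for all iterates started at 0.\<close>
  define C where "C = 1 / (1 - r)"
  have r: "0 \<le> r" "r < 1" using n x by (simp_all add: r_def cnorm_nonneg)
  have C: "0 \<le> C" "1 + r * C = C" using r by (simp_all add: C_def field_simps)
  have s0: "s 0 = \<zero>" and sS: "s (Suc n) = \<one> \<oplus> x \<otimes> s n" for n by (simp_all add: s_def)
  have sc: "s n \<in> carrier A" for n by (induction n) (simp_all add: s0 sS x)
  have sb: "cnorm A (s n) \<le> C" for n
  proof (induction n)
    case (Suc n)
    have "cnorm A (s (Suc n)) \<le> 1 + r * cnorm A (s n)"
      using cnorm_triangle[of \<one> "x \<otimes> s n"] cnorm_mult[of x "s n"] cnorm_one_le sc[of n] x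
      by (simp add: sS r_def)
    also have "\<dots> \<le> 1 + r * C" using Suc r by (simp add: mult_left_mono)
    finally show ?case using C by simp
  qed (simp add: s0 C)
  have comm: "x \<otimes> s n = s n \<otimes> x" for n
    by (induction n) (simp_all add: s0 sS x sc r_distr l_distr flip: m_assoc)
  have d: "cnorm A (s (n + m) \<ominus> s n) \<le> r ^ n * C" for n m
  proof (induction n)
    case 0 show ?case using sb[of m] sc[of m] by (simp add: s0 a_minus_def)
  next
    case (Suc n)
    have "s (Suc n + m) \<ominus> s (Suc n) = x \<otimes> (s (n + m) \<ominus> s n)"
      using sc[of n] sc[of "n + m"] x by (simp add: sS add_diff_add_left r_diff)
    then have "cnorm A (s (Suc n + m) \<ominus> s (Suc n)) \<le> r * cnorm A (s (n + m) \<ominus> s n)"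
      using cnorm_mult[of x "s (n + m) \<ominus> s n"] x sc by (simp add: r_def)
    also have "\<dots> \<le> r * (r ^ n * C)" using Suc r by (intro mult_left_mono) auto
    finally show ?case by simp
  qed
  have lim0: "(\<lambda>n. r ^ n * C) \<longlonglongrightarrow> 0"
    using tendsto_mult[OF LIMSEQ_power_zero[of r] tendsto_const[of C]] r by simp
  have "\<exists>y\<in>carrier A. (\<lambda>i. cnorm A (s i \<ominus> y)) \<longlonglongrightarrow> 0"
  proof (rule cnorm_complete[OF sc])
    fix e :: real assume "e > 0"
    then have "eventually (\<lambda>n. r ^ n * C < e) sequentially" using lim0 order_tendstoD(2) by blast
    then obtain M where M: "\<And>n. n \<ge> M \<Longrightarrow> r ^ n * C < e" by (auto simp: eventually_sequentially)
    have *: "cnorm A (s i \<ominus> s j) < e" if "i \<ge> j" "j \<ge> M" for i j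
      using d[of j "i - j"] M[of j] that by simp
    have "cnorm A (s i \<ominus> s j) < e" if "i \<ge> M" "j \<ge> M" for i j
      using *[of i j] *[of j i] cnorm_diff_commute[OF sc sc, of i j] that by (cases "i \<ge> j") auto
    then show "\<exists>M. \<forall>i\<ge>M. \<forall>j\<ge>M. cnorm A (s i \<ominus> s j) < e" by blast
  qed
  then obtain y where y: "y \<in> carrier A" "(\<lambda>i. cnorm A (s i \<ominus> y)) \<longlonglongrightarrow> 0" by blast
  have xs: "(\<lambda>i. cnorm A (x \<otimes> s i \<ominus> x \<otimes> y)) \<longlonglongrightarrow> 0"
    by (rule lim_mult) (use x y sc lim_const in auto)
  have sx: "(\<lambda>i. cnorm A (s i \<otimes> x \<ominus> y \<otimes> x)) \<longlonglongrightarrow> 0"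
    by (rule lim_mult) (use x y sc lim_const in auto)
  have xy: "x \<otimes> y = y \<otimes> x"
    by (rule lim_unique[of "\<lambda>i. x \<otimes> s i"]) (use x y sc xs sx comm in auto)
  \<comment> \<open>The shifted sequence \<open>s (Suc i)\<close> converges to both sides of the
    fixed-point equation.\<close>
  have "(\<lambda>i. cnorm A (\<one> \<oplus> x \<otimes> s i \<ominus> (\<one> \<oplus> x \<otimes> y))) \<longlonglongrightarrow> 0"
    by (rule lim_add) (use x y sc xs lim_const in auto)
  moreover have "(\<lambda>i. cnorm A (\<one> \<oplus> x \<otimes> s i \<ominus> y)) \<longlonglongrightarrow> 0"
    using LIMSEQ_Suc[OF y(2)] by (simp add: sS)
  ultimately have eq: "y = \<one> \<oplus> x \<otimes> y"
    by (intro lim_unique[of "\<lambda>i. \<one> \<oplus> x \<otimes> s i"]) (use x y sc in auto)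
  have "y \<ominus> x \<otimes> y = \<one>"
    using arg_cong[OF eq, of "\<lambda>t. t \<ominus> x \<otimes> y"] x y(1) by (simp add: a_minus_def a_assoc r_neg)
  then have "(\<one> \<ominus> x) \<otimes> y = \<one>" "y \<otimes> (\<one> \<ominus> x) = \<one>"
    using x y(1) by (simp_all add: l_diff r_diff xy)
  then show ?thesis using x y(1) by (auto simp: Units_def)
qed

lemma Units_scl:
  assumes "x \<in> Units A" "c \<noteq> 0" shows "scl A c x \<in> Units A"
proof -
  have x: "x \<in> carrier A" "inv x \<in> carrier A" using assms by auto
  have "scl A (1/c) (inv x) \<otimes> scl A c x = \<one>" "scl A c x \<otimes> scl A (1/c) (inv x) = \<one>"
    using x assms by (simp_all add: scl_mult_left scl_mult_right scl_scl scl_one)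
  then show ?thesis using x by (auto simp: Units_def)
qed

lemma Units_scl_iff: "x \<in> carrier A \<Longrightarrow> c \<noteq> 0 \<Longrightarrow> scl A c x \<in> Units A \<longleftrightarrow> x \<in> Units A"
  using Units_scl[of x c] Units_scl[of "scl A c x" "1/c"] by (auto simp: scl_scl scl_one)

lemma cnorm_spectrum_le:
  assumes x: "x \<in> carrier A" and z: "z \<in> alg_spectrum A x" shows "cmod z \<le> cnorm A x"
proof (rule ccontr)
  assume *: "\<not> cmod z \<le> cnorm A x"
  then have z0: "z \<noteq> 0" using cnorm_nonneg[OF x] by auto
  have "cnorm A (scl A (1/z) x) < 1" using * x z0 by (simp add: cnorm_scl norm_divide field_simps)
  then have "scl A z (\<one> \<ominus> scl A (1/z) x) \<in> Units A" using neumann Units_scl z0 x by auto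
  then show False using z z0 x by (simp add: alg_spectrum_def scl_diff_right scl_scl scl_one)
qed

text \<open>The partial fraction 1/(1 - a^2) = (1/(1 - a) + 1/(1 + a))/2. It expresses the resolvent
  of a square through two resolvents of the element itself.\<close>

lemma Units_diff_square:
  assumes a: "a \<in> carrier A" and "\<one> \<ominus> a \<in> Units A" "\<one> \<oplus> a \<in> Units A"
  shows "\<one> \<ominus> a \<otimes> a \<in> Units A"
    and "inv (\<one> \<ominus> a \<otimes> a) = scl A (1/2) (inv (\<one> \<ominus> a) \<oplus> inv (\<one> \<oplus> a))"
proof -
  define p q where "p = inv (\<one> \<ominus> a)" and "q = inv (\<one> \<oplus> a)"
  have pq: "p \<in> carrier A" "q \<in> carrier A" using assms by (simp_all add: p_def q_def)
  have "(\<one> \<ominus> a) \<otimes> (\<one> \<oplus> a) = (\<one> \<ominus> a) \<oplus> (a \<ominus> a \<otimes> a)"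
    using a by (simp only: r_distr l_diff r_one l_one one_closed minus_closed)
  moreover have "(\<one> \<oplus> a) \<otimes> (\<one> \<ominus> a) = (\<one> \<oplus> a) \<ominus> (a \<oplus> a \<otimes> a)"
    using a by (simp only: r_diff l_distr r_one l_one one_closed a_closed)
  moreover have "\<one> \<oplus> a = a \<oplus> \<one>" using a by (rule a_comm[OF one_closed])
  ultimately have e: "\<one> \<ominus> a \<otimes> a = (\<one> \<ominus> a) \<otimes> (\<one> \<oplus> a)" "\<one> \<ominus> a \<otimes> a = (\<one> \<oplus> a) \<otimes> (\<one> \<ominus> a)"
    using a by (simp_all only: diff_add_diff add_diff_add_left one_closed m_closed)
  show u: "\<one> \<ominus> a \<otimes> a \<in> Units A" using assms by (simp add: e)
  have "(\<one> \<ominus> a \<otimes> a) \<otimes> p = \<one> \<oplus> a" unfolding e(2) p_def using assms by (simp add: m_assoc)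
  moreover have "(\<one> \<ominus> a \<otimes> a) \<otimes> q = \<one> \<ominus> a" unfolding e(1) q_def using assms by (simp add: m_assoc)
  ultimately have "(\<one> \<ominus> a \<otimes> a) \<otimes> (p \<oplus> q) = (\<one> \<oplus> a) \<oplus> (\<one> \<ominus> a)"
    using a pq by (simp add: r_distr)
  also have "\<dots> = \<one> \<oplus> \<one>"
    using a by (simp add: a_minus_def a_assoc a_comm[of \<one> "\<ominus> a"] r_neg2)
  also have "\<dots> = scl A 2 \<one>" using scl_add_left[of \<one> 1 1] by (simp add: scl_one)
  finally have "(\<one> \<ominus> a \<otimes> a) \<otimes> scl A (1/2) (p \<oplus> q) = \<one>"
    using a pq by (simp add: scl_mult_right scl_scl scl_one)
  then show "inv (\<one> \<ominus> a \<otimes> a) = scl A (1/2) (p \<oplus> q)"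
    by (rule inv_unique[OF Units_l_inv[OF u]]) (simp_all add: u pq a Units_closed)
qed

lemma adj_pow: "x \<in> carrier A \<Longrightarrow> adj A (x [^] (n::nat)) = adj A x [^] n"
  proof (induction n)
  case (Suc n)
  then show ?case using nat_pow_Suc2[of "adj A x" n] by (simp add: adj_mult)
qed simp

text \<open>Each doubling of the exponent squares a self-adjoint element, to which the C*-identity
  applies.\<close>

lemma cnorm_selfadjoint_pow2:
  assumes "selfadjoint A x" shows "cnorm A (x [^] ((2::nat) ^ k)) = cnorm A x ^ (2 ^ k)"
proof (induction k)
  case (Suc k)
  have x: "x \<in> carrier A" using assms by (simp add: selfadjoint_def)
  have "x [^] ((2::nat) ^ Suc k) = x [^] ((2::nat) ^ k) \<otimes> x [^] ((2::nat) ^ k)"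
    using x by (simp add: nat_pow_mult mult_2)
  moreover have "selfadjoint A (x [^] ((2::nat) ^ k))"
    using assms by (simp add: selfadjoint_def adj_pow)
  ultimately show ?case using Suc
    by (simp add: cnorm_selfadjoint_sq power_even_eq)
qed (use assms in \<open>simp add: selfadjoint_def\<close>)

lemma inv_diff_inv:
  assumes "a \<in> Units A" "b \<in> Units A"
  shows "inv a \<ominus> inv b = inv a \<otimes> (b \<ominus> a) \<otimes> inv b"
proof -
  have c: "a \<in> carrier A" "b \<in> carrier A" "inv a \<in> carrier A" "inv b \<in> carrier A"
    using assms by auto
  have "inv a \<otimes> (b \<ominus> a) \<otimes> inv b = inv a \<otimes> b \<otimes> inv b \<ominus> inv a \<otimes> a \<otimes> inv b"
    using c by (simp only: l_diff r_diff m_closed)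
  also have "\<dots> = inv a \<ominus> inv b" using c assms by (simp add: m_assoc[of "inv a" b "inv b"])
  finally show ?thesis by simp
qed

text \<open>The reciprocal of the norm of the resolvent is Lipschitz with constant
  \<parallel>y\<parallel>: the factors \<parallel>F z\<parallel> and \<parallel>F w\<parallel> from
  the resolvent identity cancel against the common denominator. So continuity needs no prior bound,
  and the positive minimum on the compact disc is the reciprocal of the wanted bound.\<close>

lemma bounded_resolvent:
  assumes y: "y \<in> carrier A" and one: "\<one> \<noteq> \<zero>"
    and U: "\<And>z. cmod z \<le> 1 \<Longrightarrow> \<one> \<ominus> scl A z y \<in> Units A"
  shows "\<exists>M>0. \<forall>z. cmod z \<le> 1 \<longrightarrow> cnorm A (inv (\<one> \<ominus> scl A z y)) \<le> M"
proof -
  define F where "F z = inv (\<one> \<ominus> scl A z y)" for z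
  define g where "g z = 1 / cnorm A (F z)" for z
  have Fc: "F z \<in> carrier A" if "cmod z \<le> 1" for z using U[OF that] by (simp add: F_def)
  have Fpos: "cnorm A (F z) > 0" if "cmod z \<le> 1" for z
  proof -
    have "F z \<noteq> \<zero>"
      using Units_l_inv[OF U[OF that]] one y by (auto simp: F_def)
    then show ?thesis using Fc[OF that] cnorm_nonneg cnorm_eq_zero by (simp add: order_less_le)
  qed
  have diff: "F z \<ominus> F w = scl A (z - w) (F z \<otimes> y \<otimes> F w)" if "cmod z \<le> 1" "cmod w \<le> 1" for z w
  proof -
    have "(\<one> \<ominus> scl A w y) \<ominus> (\<one> \<ominus> scl A z y) = scl A z y \<ominus> scl A w y"
      using y by (simp add: diff_diff_diff_left)
    also have "\<dots> = scl A (z - w) y" using y by (simp add: scl_diff_left)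
    finally show ?thesis
      unfolding F_def using U that y
      by (simp add: inv_diff_inv scl_mult_left scl_mult_right)
  qed
  have lip: "\<bar>g z - g w\<bar> \<le> cnorm A y * cmod (z - w)" if "cmod z \<le> 1" "cmod w \<le> 1" for z w
  proof -
    have "\<bar>cnorm A (F w) - cnorm A (F z)\<bar> \<le> cnorm A (F z \<ominus> F w)"
      using cnorm_triangle_diff'[of "F z" "F w"] Fc that by (simp add: abs_minus_commute)
    also have "\<dots> = cmod (z - w) * cnorm A (F z \<otimes> y \<otimes> F w)"
      using that Fc y by (simp add: diff cnorm_scl)
    also have "\<dots> \<le> cmod (z - w) * (cnorm A (F z) * cnorm A y * cnorm A (F w))"
    proof (rule mult_left_mono)
      have "cnorm A (F z \<otimes> y \<otimes> F w) \<le> cnorm A (F z \<otimes> y) * cnorm A (F w)"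
        using cnorm_mult Fc y that by simp
      also have "\<dots> \<le> cnorm A (F z) * cnorm A y * cnorm A (F w)"
        using cnorm_mult Fc y that by (intro mult_right_mono cnorm_nonneg) auto
      finally show "cnorm A (F z \<otimes> y \<otimes> F w) \<le> cnorm A (F z) * cnorm A y * cnorm A (F w)" .
    qed simp
    finally have *: "\<bar>cnorm A (F w) - cnorm A (F z)\<bar> \<le> cnorm A y * cmod (z - w) * (cnorm A (F z) * cnorm A (F w))"
      by (simp add: mult_ac)
    have "g z - g w = (cnorm A (F w) - cnorm A (F z)) / (cnorm A (F z) * cnorm A (F w))"
      using Fpos[OF that(1)] Fpos[OF that(2)] by (simp add: g_def field_simps)
    then show ?thesis using * Fpos[OF that(1)] Fpos[OF that(2)]
      by (simp add: abs_mult pos_divide_le_eq)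
  qed
  have "continuous_on (cball 0 1) g"
    by (rule lipschitz_on_continuous_on[where L = "cnorm A y"])
      (use lip cnorm_nonneg[OF y] in \<open>auto simp: lipschitz_on_def dist_norm\<close>)
  then obtain w where w: "cmod w \<le> 1" "\<And>z. cmod z \<le> 1 \<Longrightarrow> g w \<le> g z"
    using continuous_attains_inf[of "cball 0 1" g] by (force simp: dist_norm)
  have "cnorm A (F z) \<le> cnorm A (F w)" if "cmod z \<le> 1" for z
    using w(2)[OF that] Fpos[OF that] Fpos[OF w(1)] by (simp add: g_def field_simps)
  then show ?thesis using Fpos[OF w(1)] unfolding F_def by blast
qed

lemma scl_minus_eq_scl_uminus: "x \<in> carrier A \<Longrightarrow> a \<in> carrier A \<Longrightarrow> a \<ominus> scl A (- z) x = a \<oplus> scl A z x"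
  by (simp add: scl_minus_left a_minus_def)

lemma pow2_Suc:
  "x \<in> carrier A \<Longrightarrow> x [^] ((2::nat) ^ Suc k) = x [^] ((2::nat) ^ k) \<otimes> x [^] ((2::nat) ^ k)"
  by (simp add: nat_pow_mult mult_2)

text \<open>Doubling averages the resolvent over the two square roots, so a Lipschitz constant in the
  radial direction for \<open>z \<mapsto> (1 - z y)\<^sup>-\<^sup>1\<close> survives the passage to \<open>z \<mapsto> (1 - (z y)\<^sup>2)\<^sup>-\<^sup>1\<close>.\<close>

lemma resolvent_pow2_lipschitz:
  assumes y: "y \<in> carrier A" and "0 \<le> L"
    and U: "\<And>z. cmod z \<le> 1 \<Longrightarrow> \<one> \<ominus> scl A z y \<in> Units A"
    and L: "\<And>z r. cmod z \<le> 1 \<Longrightarrow> 0 \<le> r \<Longrightarrow> r \<le> 1 \<Longrightarrow>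
      cnorm A (inv (\<one> \<ominus> scl A z y) \<ominus> inv (\<one> \<ominus> scl A (of_real r * z) y)) \<le> L * (1 - r)"
    and "cmod z \<le> 1" "0 \<le> r" "r \<le> 1"
  shows "\<one> \<ominus> scl A (z ^ 2 ^ k) (y [^] ((2::nat) ^ k)) \<in> Units A \<and>
    cnorm A (inv (\<one> \<ominus> scl A (z ^ 2 ^ k) (y [^] ((2::nat) ^ k))) \<ominus>
      inv (\<one> \<ominus> scl A ((of_real r * z) ^ 2 ^ k) (y [^] ((2::nat) ^ k)))) \<le> L * (1 - r)"
  using assms(5-)
proof (induction k arbitrary: z)
  case 0
  then show ?case using U L y by simp
next
  case (Suc k)
  define Y where "Y = y [^] ((2::nat) ^ k)"
  define G where "G w = inv (\<one> \<ominus> scl A (w ^ 2 ^ k) Y)" for w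
  \<comment> \<open>A root of -1 of order 2^k: replacing w by \<open>\<zeta> * w\<close> keeps the
    modulus and flips the sign of w^(2^k), so both resolvents of the partial fraction are values of
    \<open>G\<close>.\<close>
  define \<zeta> where "\<zeta> = cis (pi / 2 ^ k)"
  have Y: "Y \<in> carrier A" using y by (simp add: Y_def)
  have \<zeta>: "cmod \<zeta> = 1" "\<zeta> ^ 2 ^ k = -1" using Complex.DeMoivre[of "pi / 2 ^ k" "2 ^ k"] by (simp_all add: \<zeta>_def)
  have IH: "\<one> \<ominus> scl A (w ^ 2 ^ k) Y \<in> Units A"
    "cnorm A (G w \<ominus> G (of_real r * w)) \<le> L * (1 - r)" if "cmod w \<le> 1" for w
    using Suc.IH[OF that Suc.prems(2,3)] by (simp_all add: G_def Y_def)
  have Gc: "G w \<in> carrier A" if "cmod w \<le> 1" for w using IH(1)[OF that] by (simp add: G_def)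
  have step: "\<one> \<ominus> scl A (w ^ 2 ^ Suc k) (y [^] ((2::nat) ^ Suc k)) \<in> Units A"
    "inv (\<one> \<ominus> scl A (w ^ 2 ^ Suc k) (y [^] ((2::nat) ^ Suc k))) = scl A (1/2) (G w \<oplus> G (\<zeta> * w))"
    if w: "cmod w \<le> 1" for w
  proof -
    define a where "a = scl A (w ^ 2 ^ k) Y"
    have a: "a \<in> carrier A" using Y by (simp add: a_def)
    have aa: "a \<otimes> a = scl A (w ^ 2 ^ Suc k) (y [^] ((2::nat) ^ Suc k))"
      unfolding pow2_Suc[OF y] a_def Y_def[symmetric] using Y
      by (simp add: scl_mult_left scl_mult_right scl_scl power_even_eq power2_eq_square)
    have "(\<zeta> * w) ^ 2 ^ k = - (w ^ 2 ^ k)" by (simp add: power_mult_distrib \<zeta>)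
    then have "\<one> \<ominus> scl A ((\<zeta> * w) ^ 2 ^ k) Y = \<one> \<oplus> a"
      using Y by (simp add: scl_minus_eq_scl_uminus a_def)
    moreover have "\<one> \<ominus> scl A ((\<zeta> * w) ^ 2 ^ k) Y \<in> Units A"
      by (rule IH) (use w in \<open>simp add: norm_mult \<zeta>\<close>)
    ultimately have u: "\<one> \<oplus> a \<in> Units A" "G (\<zeta> * w) = inv (\<one> \<oplus> a)" by (simp_all add: G_def)
    have u': "\<one> \<ominus> a \<in> Units A" "G w = inv (\<one> \<ominus> a)" using IH(1)[OF w] by (simp_all add: G_def a_def)
    show "\<one> \<ominus> scl A (w ^ 2 ^ Suc k) (y [^] ((2::nat) ^ Suc k)) \<in> Units A"
      "inv (\<one> \<ominus> scl A (w ^ 2 ^ Suc k) (y [^] ((2::nat) ^ Suc k))) = scl A (1/2) (G w \<oplus> G (\<zeta> * w))"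
      unfolding aa[symmetric] u(2) u'(2) using Units_diff_square[OF a u'(1) u(1)] by auto
  qed
  have z: "cmod z \<le> 1" "cmod (\<zeta> * z) \<le> 1" and rz: "cmod (of_real r * z) \<le> 1" "cmod (\<zeta> * (of_real r * z)) \<le> 1"
    using Suc.prems by (simp_all add: norm_mult \<zeta> mult_le_one)
  define d1 d2 where "d1 = G z \<ominus> G (of_real r * z)" and "d2 = G (\<zeta> * z) \<ominus> G (of_real r * (\<zeta> * z))"
  have rz': "\<zeta> * (of_real r * z) = of_real r * (\<zeta> * z)" by simp
  have dc: "d1 \<in> carrier A" "d2 \<in> carrier A" using Gc z rz by (simp_all add: d1_def d2_def rz')
  have "(G z \<oplus> G (\<zeta> * z)) \<ominus> (G (of_real r * z) \<oplus> G (\<zeta> * (of_real r * z))) = d1 \<oplus> d2"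
    unfolding d1_def d2_def rz' using Gc[OF z(1)] Gc[OF z(2)] Gc[OF rz(1)] Gc[OF rz(2)]
    by (simp add: a_minus_def minus_add a_ac rz')
  then have "inv (\<one> \<ominus> scl A (z ^ 2 ^ Suc k) (y [^] ((2::nat) ^ Suc k))) \<ominus>
      inv (\<one> \<ominus> scl A ((of_real r * z) ^ 2 ^ Suc k) (y [^] ((2::nat) ^ Suc k))) = scl A (1/2) (d1 \<oplus> d2)"
    using Gc z rz by (simp only: step[OF z(1)] step[OF rz(1)] scl_diff_right[symmetric] a_closed)
  moreover have "cnorm A (scl A (1/2) (d1 \<oplus> d2)) \<le> L * (1 - r)"
    using cnorm_triangle[OF dc] IH(2)[OF z(1)] IH(2)[OF z(2)] dc
    by (simp add: cnorm_scl d1_def[symmetric] d2_def[symmetric])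
  ultimately show ?case using step(1)[OF z(1)] by simp
qed

text \<open>If the spectrum avoided the unit circle, the bound \<open>L\<close> would force \<open>(1 - y\<^sup>m)\<^sup>-\<^sup>1 \<rightarrow> 1\<close>
  along \<open>m = 2\<^sup>k\<close>, whereas \<open>\<parallel>y\<^sup>m\<parallel> = 1\<close>. (This is Rickart's proof of the spectral radius formula.)\<close>

lemma spectrum_unit_norm:
  assumes sa: "selfadjoint A y" and n1: "cnorm A y = 1"
  shows "\<exists>z. cmod z = 1 \<and> z \<in> alg_spectrum A y"
proof -
  have y: "y \<in> carrier A" using sa by (simp add: selfadjoint_def)
  have one: "\<one> \<noteq> \<zero>"
  proof
    assume "\<one> = \<zero>"
    then have "y = \<zero>" using y l_null l_one by metis
    then show False using n1 by simp
  qed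
  have "\<exists>z. cmod z \<le> 1 \<and> \<one> \<ominus> scl A z y \<notin> Units A"
  proof (rule ccontr)
    assume "\<not> ?thesis"
    then have U: "\<And>z. cmod z \<le> 1 \<Longrightarrow> \<one> \<ominus> scl A z y \<in> Units A" by blast
    obtain M where M: "M > 0" "\<And>z. cmod z \<le> 1 \<Longrightarrow> cnorm A (inv (\<one> \<ominus> scl A z y)) \<le> M"
      using bounded_resolvent[OF y one U] by blast
    \<comment> \<open>In the resolvent identity both outer factors are at most M, and the middle one
      is at most 1 - r because \<parallel>y\<parallel> = 1.\<close>
    define L where "L = M * M"
    have Lpos: "L > 0" using M by (simp add: L_def)
    have L: "cnorm A (inv (\<one> \<ominus> scl A z y) \<ominus> inv (\<one> \<ominus> scl A (of_real r * z) y)) \<le> L * (1 - r)"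
      if z: "cmod z \<le> 1" and r: "0 \<le> r" "r \<le> 1" for z r
    proof -
      let ?w = "of_real r * z"
      have w: "cmod ?w \<le> 1" using z r by (simp add: norm_mult mult_le_one)
      define p q where "p = inv (\<one> \<ominus> scl A z y)" and "q = inv (\<one> \<ominus> scl A ?w y)"
      have pq: "p \<in> carrier A" "q \<in> carrier A" using U z w by (simp_all add: p_def q_def)
      have "(\<one> \<ominus> scl A ?w y) \<ominus> (\<one> \<ominus> scl A z y) = scl A z y \<ominus> scl A ?w y"
        using y by (simp add: diff_diff_diff_left)
      also have "\<dots> = scl A (z - ?w) y" using y by (simp add: scl_diff_left)
      finally have "p \<ominus> q = p \<otimes> scl A (z - ?w) y \<otimes> q"
        unfolding p_def q_def using U z w by (simp add: inv_diff_inv)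
      then have "cnorm A (p \<ominus> q) \<le> cnorm A p * cnorm A (scl A (z - ?w) y) * cnorm A q"
        using cnorm_mult[of "p \<otimes> scl A (z - ?w) y" q] cnorm_mult[of p "scl A (z - ?w) y"] pq y
          mult_right_mono[OF cnorm_mult[of p "scl A (z - ?w) y"] cnorm_nonneg[of q]] by simp
      also have "\<dots> \<le> M * (1 - r) * M"
      proof (intro mult_mono)
        have "z - ?w = of_real (1 - r) * z" by (simp add: algebra_simps)
        then have "cmod (z - ?w) = (1 - r) * cmod z"
          using r by (simp add: norm_mult del: of_real_diff)
        also have "\<dots> \<le> 1 - r" using z r by (simp add: mult_left_le)
        finally show "cnorm A (scl A (z - ?w) y) \<le> 1 - r" using y n1 by (simp add: cnorm_scl)
      qed (use M r z w pq y cnorm_nonneg in \<open>auto simp: p_def q_def intro!: mult_nonneg_nonneg\<close>)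
      finally show ?thesis by (simp add: p_def q_def L_def mult_ac)
    qed
    \<comment> \<open>At a radius below 1 the powers die out, at the cost of an error L (1 - r) that
      is uniform in the power. The 1/8 here and the 1/9 below put \<open>h\<close> within 1/8 and
      then \<open>g\<close> within 1/4 of the unit, which would bound \<parallel>b\<parallel> = 1 by
      1/2.\<close>
    define r where "r = max 0 (1 - 1 / (8 * L))"
    have r: "0 \<le> r" "r < 1" "L * (1 - r) \<le> 1/8" using Lpos by (auto simp: r_def max_def field_simps)
    have "(\<lambda>m. r ^ m) \<longlonglongrightarrow> 0" using r by (intro LIMSEQ_power_zero) auto
    then have "eventually (\<lambda>m. r ^ m < 1/9) sequentially" by (rule order_tendstoD) simp
    then obtain K where K: "r ^ m < 1/9" if "m \<ge> K" for m by (auto simp: eventually_sequentially)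
    have rK: "r ^ 2 ^ K < 1/9" by (rule K) (simp add: less_imp_le)
    define b where "b = y [^] ((2::nat) ^ K)"
    define c where "c = scl A (of_real r ^ 2 ^ K) b"
    have b: "b \<in> carrier A" "cnorm A b = 1"
      using y cnorm_selfadjoint_pow2[OF sa] n1 by (simp_all add: b_def)
    have c: "c \<in> carrier A" "cnorm A c \<le> 1/9" "cnorm A c \<ge> 0"
      using b rK r by (simp_all add: c_def cnorm_scl norm_power)
    define g h where "g = inv (\<one> \<ominus> b)" and "h = inv (\<one> \<ominus> c)"
    have ub: "\<one> \<ominus> b \<in> Units A" and gh: "cnorm A (g \<ominus> h) \<le> 1/8"
      using resolvent_pow2_lipschitz[of y L 1 r K] U L y Lpos r
      by (auto simp: b_def c_def scl_one g_def h_def intro: order_trans)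
    have uc: "\<one> \<ominus> c \<in> Units A" using c by (intro neumann) auto
    have ghc: "g \<in> carrier A" "h \<in> carrier A" using ub uc by (simp_all add: g_def h_def)
    \<comment> \<open>With v = t - 1 the equation (1 - s) t = 1 reads v = s + s v. Estimating v
      shows that t is near the unit when s is small; solving for s gives the converse.\<close>
    have fix_le: "cnorm A (t \<ominus> \<one>) \<le> cnorm A s * (1 + cnorm A (t \<ominus> \<one>))" "cnorm A s \<le> cnorm A (t \<ominus> \<one>) * (1 + cnorm A s)"
      if s: "s \<in> carrier A" "\<one> \<ominus> s \<in> Units A" "t = inv (\<one> \<ominus> s)" for s t
    proof -
      have t: "t \<in> carrier A" using s by simp
      define v where "v = t \<ominus> \<one>"
      have v: "v \<in> carrier A" using t by (simp add: v_def)
      have tv: "t = \<one> \<oplus> v" using t by (simp add: v_def a_minus_def a_lcomm[of \<one> t] r_neg)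
      have "(\<one> \<ominus> s) \<otimes> t = \<one>" using s by simp
      then have "t \<ominus> s \<otimes> t = \<one>" using s(1) t by (simp only: l_diff l_one one_closed)
      moreover have "t = (t \<ominus> s \<otimes> t) \<oplus> s \<otimes> t" using s t by (simp add: a_minus_def a_assoc l_neg)
      ultimately have "t = \<one> \<oplus> s \<otimes> t" by simp
      then have "v = s \<otimes> t" using add_diff_add_left[of \<one> "s \<otimes> t" \<zero>] t s(1) by (simp add: v_def a_minus_def)
      also have "\<dots> = s \<oplus> s \<otimes> v" unfolding tv using s(1) v by (simp add: r_distr)
      finally have e: "v = s \<oplus> s \<otimes> v" .
      have sv: "s \<otimes> v \<in> carrier A" "cnorm A (s \<otimes> v) \<le> cnorm A s * cnorm A v"
        using s v cnorm_mult by auto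
      have "cnorm A v \<le> cnorm A s + cnorm A (s \<otimes> v)" using e cnorm_triangle[OF s(1) sv(1)] by simp
      then show "cnorm A (t \<ominus> \<one>) \<le> cnorm A s * (1 + cnorm A (t \<ominus> \<one>))"
        using sv by (simp add: v_def[symmetric] algebra_simps)
      have "s = v \<ominus> s \<otimes> v" using s v sv(1) e by (metis a_assoc a_minus_def a_inv_closed r_neg r_zero)
      then have "cnorm A s \<le> cnorm A v + cnorm A (s \<otimes> v)" using cnorm_triangle_diff[OF v sv(1)] by simp
      then show "cnorm A s \<le> cnorm A (t \<ominus> \<one>) * (1 + cnorm A s)"
        using sv by (simp add: v_def[symmetric] algebra_simps)
    qed
    define H where "H = cnorm A (h \<ominus> \<one>)"
    have "H \<le> cnorm A c * (1 + H)" using fix_le(1)[OF c(1) uc h_def] by (simp add: H_def)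
    also have "\<dots> \<le> 1/9 * (1 + H)" using c ghc by (intro mult_right_mono) (auto simp: H_def cnorm_nonneg)
    finally have "H \<le> 1/8" by simp
    moreover have "cnorm A (g \<ominus> \<one>) \<le> cnorm A (g \<ominus> h) + H"
      using cnorm_dist_triangle[of g h \<one>] ghc by (simp add: H_def)
    ultimately have "cnorm A (g \<ominus> \<one>) \<le> 1/4" using gh by simp
    then show False using fix_le(2)[OF b(1) ub g_def] b(2) by simp
  qed
  then obtain z where z: "cmod z \<le> 1" "\<one> \<ominus> scl A z y \<notin> Units A" by blast
  \<comment> \<open>If \<parallel>z y\<parallel> < 1, the Neumann series gives invertibility; so the
    failure occurs on the circle, and 1/z is the spectral point.\<close>
  have "\<not> cnorm A (scl A z y) < 1" using z neumann[of "scl A z y"] y by auto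
  then have z1: "cmod z = 1" using z y n1 by (simp add: cnorm_scl)
  then have z0: "z \<noteq> 0" by auto
  have "scl A (1/z) \<one> \<ominus> y = scl A (1/z) (\<one> \<ominus> scl A z y)"
    using y z0 by (simp add: scl_diff_right scl_scl scl_one)
  then have "1/z \<in> alg_spectrum A y" using z z0 y by (simp add: alg_spectrum_def Units_scl_iff)
  then show ?thesis using z1 by (intro exI[of _ "1/z"]) (simp add: norm_divide)
qed

lemma spectrum_scl:
  assumes "x \<in> carrier A" "c \<noteq> 0" "z \<in> alg_spectrum A (scl A c x)"
  shows "z / c \<in> alg_spectrum A x"
proof -
  have "scl A z \<one> \<ominus> scl A c x = scl A c (scl A (z / c) \<one> \<ominus> x)"
    using assms by (simp add: scl_diff_right scl_scl)
  then show ?thesis using assms by (simp add: alg_spectrum_def Units_scl_iff)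
qed

text \<open>Normalization reduces this to norm 1. It is the form in which the spectral radius
  formula enters everything below.\<close>

lemma spectrum_attains_norm:
  assumes sa: "selfadjoint A y" and one: "y \<noteq> \<zero>"
  shows "\<exists>z\<in>alg_spectrum A y. cmod z = cnorm A y"
proof -
  have y: "y \<in> carrier A" using sa by (simp add: selfadjoint_def)
  define c where "c = 1 / cnorm A y"
  have n: "cnorm A y > 0" using y one cnorm_nonneg cnorm_eq_zero by (simp add: order_less_le)
  then have c: "c > 0" by (simp add: c_def)
  have "selfadjoint A (scl A (of_real c) y)" using sa by (simp add: selfadjoint_def adj_scl)
  moreover have "cnorm A (scl A (of_real c) y) = 1" using y n c by (simp add: cnorm_scl c_def norm_divide)
  ultimately obtain z where z: "cmod z = 1" "z \<in> alg_spectrum A (scl A (of_real c) y)"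
    using spectrum_unit_norm by blast
  then have "z / of_real c \<in> alg_spectrum A y" using spectrum_scl y c by simp
  moreover have "cmod (z / of_real c) = cnorm A y" using z n by (simp add: c_def norm_divide norm_mult)
  ultimately show ?thesis by blast
qed

subsection \<open>Polynomial calculus\<close>

text \<open>Allows a common upper bound for two degrees, so that polynomials can be added
  coefficientwise.\<close>

lemma alg_poly_atMost:
  assumes x: "x \<in> carrier A" and m: "degree p \<le> m"
  shows "alg_poly A p x = (\<Oplus>i\<in>{..m}. scl A (coeff p i) (x [^] i))"
  unfolding alg_poly_def
  by (rule add.finprod_mono_neutral_cong_left) (use x m in \<open>auto simp: coeff_eq_0\<close>)

lemma alg_poly_closed [simp, intro]: "x \<in> carrier A \<Longrightarrow> alg_poly A p x \<in> carrier A"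
  by (auto simp: alg_poly_def intro!: finsum_closed)

lemma alg_poly_0 [simp]: "x \<in> carrier A \<Longrightarrow> alg_poly A 0 x = \<zero>"
  by (simp add: alg_poly_def)

lemma alg_poly_pCons:
  assumes x: "x \<in> carrier A"
  shows "alg_poly A (pCons c p) x = scl A c \<one> \<oplus> x \<otimes> alg_poly A p x"
proof -
  let ?f = "\<lambda>i. scl A (coeff (pCons c p) i) (x [^] i)"
  have "alg_poly A (pCons c p) x = (\<Oplus>i\<in>{..Suc (degree p)}. ?f i)"
    using x by (intro alg_poly_atMost) (auto simp: degree_pCons_eq_if)
  also have "\<dots> = (\<Oplus>i\<in>{..degree p}. ?f (Suc i)) \<oplus> ?f 0"
    using x by (intro finsum_Suc2) auto
  also have "(\<Oplus>i\<in>{..degree p}. ?f (Suc i)) = (\<Oplus>i\<in>{..degree p}. x \<otimes> scl A (coeff p i) (x [^] i))"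
    using x nat_pow_Suc2[of x] by (intro finsum_cong') (auto simp: scl_mult_right)
  also have "\<dots> = x \<otimes> alg_poly A p x"
    unfolding alg_poly_def using x by (intro finsum_rdistr[symmetric]) auto
  finally show ?thesis using x by (simp add: a_comm)
qed

lemma alg_poly_add:
  assumes x: "x \<in> carrier A"
  shows "alg_poly A (p + q) x = alg_poly A p x \<oplus> alg_poly A q x"
proof -
  define m where "m = max (degree p) (degree q)"
  have "alg_poly A (p + q) x = (\<Oplus>i\<in>{..m}. scl A (coeff (p + q) i) (x [^] i))"
    using x by (intro alg_poly_atMost) (auto simp: m_def degree_add_le)
  also have "\<dots> = (\<Oplus>i\<in>{..m}. scl A (coeff p i) (x [^] i) \<oplus> scl A (coeff q i) (x [^] i))"
    using x by (intro finsum_cong') (auto simp: scl_add_left)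
  also have "\<dots> = alg_poly A p x \<oplus> alg_poly A q x"
    using x alg_poly_atMost[OF x, of p m] alg_poly_atMost[OF x, of q m]
    by (subst finsum_addf) (auto simp: m_def)
  finally show ?thesis .
qed

lemma alg_poly_smult:
  assumes x: "x \<in> carrier A" shows "alg_poly A (Polynomial.smult c p) x = scl A c (alg_poly A p x)"
  by (induction p) (use x in \<open>simp_all add: alg_poly_pCons scl_add_right scl_scl scl_mult_right\<close>)

lemma alg_poly_diff:
  assumes x: "x \<in> carrier A"
  shows "alg_poly A (p - q) x = alg_poly A p x \<ominus> alg_poly A q x"
  using alg_poly_add[OF x, of p "- q"] alg_poly_smult[OF x, of "-1" q] x
  by (simp add: scl_minus_left scl_one a_minus_def)

lemma alg_poly_mult:
  assumes x: "x \<in> carrier A"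
  shows "alg_poly A (p * q) x = alg_poly A p x \<otimes> alg_poly A q x"
proof (induction p)
  case (pCons c p)
  then show ?case using x
    by (simp add: alg_poly_add alg_poly_smult alg_poly_pCons l_distr scl_mult_left m_assoc)
qed (use x in simp)

lemma alg_poly_const: "x \<in> carrier A \<Longrightarrow> alg_poly A [:c:] x = scl A c \<one>"
  by (simp add: alg_poly_pCons)

lemma alg_poly_X: "x \<in> carrier A \<Longrightarrow> alg_poly A [:0, 1:] x = x"
  by (simp add: alg_poly_pCons scl_one)

text \<open>The adjoint reverses the product with x, and the factors commute since both are
  polynomials in x.\<close>

lemma adj_alg_poly:
  assumes "selfadjoint A x"
  shows "adj A (alg_poly A p x) = alg_poly A (map_poly cnj p) x"
proof (induction p)
  case (pCons c p)
  have x: "x \<in> carrier A" "adj A x = x" using assms by (auto simp: selfadjoint_def)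
  have comm: "alg_poly A q x \<otimes> x = x \<otimes> alg_poly A q x" for q
    using alg_poly_mult[OF x(1), of "[:0,1:]" q] alg_poly_mult[OF x(1), of q "[:0,1:]"] x
    by (simp add: alg_poly_X mult.commute)
  show ?case using pCons x comm
    by (simp add: alg_poly_pCons adj_add adj_scl adj_mult map_poly_pCons)
qed (use assms in \<open>simp add: selfadjoint_def\<close>)

text \<open>The fundamental theorem of algebra splits off one root at a time, and each linear factor
  is, up to sign, some \<open>scl A z \<one> \<ominus> x\<close> with z outside the
  spectrum.\<close>

lemma alg_poly_Units:
  assumes x: "x \<in> carrier A"
  shows "q \<noteq> 0 \<Longrightarrow> (\<And>z. poly q z = 0 \<Longrightarrow> z \<notin> alg_spectrum A x) \<Longrightarrow> alg_poly A q x \<in> Units A"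
proof (induction "degree q" arbitrary: q)
  case 0
  then obtain c where "q = [:c:]" "c \<noteq> 0" by (metis degree_eq_zeroE pCons_0_0)
  then show ?case using x by (simp add: alg_poly_const Units_scl)
next
  case (Suc d)
  then have "\<not> constant (poly q)" by (simp add: constant_degree)
  then obtain z where z: "poly q z = 0" using fundamental_theorem_of_algebra by blast
  then obtain r where r: "q = [:- z, 1:] * r" by (metis poly_eq_0_iff_dvd dvdE)
  with Suc.prems have r0: "r \<noteq> 0" by auto
  have "degree q = Suc (degree r)" 
    unfolding r using r0 by (subst degree_mult_eq) simp_all
  then have "alg_poly A r x \<in> Units A" using Suc r r0 by (intro Suc.hyps(1)) auto
  moreover have "alg_poly A [:- z, 1:] x = \<ominus> (scl A z \<one> \<ominus> x)"
    using x by (simp add: alg_poly_pCons scl_minus_left a_minus_def minus_add scl_one)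
  moreover have "\<ominus> (scl A z \<one> \<ominus> x) \<in> Units A"
    using Suc.prems(2)[OF z] x Units_scl[of "scl A z \<one> \<ominus> x" "-1"]
    by (simp add: alg_spectrum_def flip: scl_minus_one)
  ultimately show ?case unfolding r alg_poly_mult[OF x] by simp
qed

lemma spectrum_selfadjoint_nonempty:
  assumes "selfadjoint A x" "\<one> \<noteq> \<zero>" shows "alg_spectrum A x \<noteq> {}"
proof (cases "x = \<zero>")
  case True
  have "\<zero> \<notin> Units A" using assms(2) by (auto simp: Units_def)
  then have "0 \<in> alg_spectrum A x" by (simp add: True alg_spectrum_def a_minus_def)
  then show ?thesis by blast
qed (use spectrum_attains_norm[OF assms(1)] in blast)

text \<open>If z - p had no root in the spectrum, its value at x would be invertible. When p is the
  constant z there is nothing to factor, and the claim rests on the spectrum being nonempty, hence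
  on \<open>\<one> \<noteq> \<zero>\<close>.\<close>

lemma spectral_mapping:
  assumes x: "selfadjoint A x" "\<one> \<noteq> \<zero>" and z: "z \<in> alg_spectrum A (alg_poly A p x)"
  shows "\<exists>w\<in>alg_spectrum A x. z = poly p w"
proof (rule ccontr)
  assume *: "\<not> ?thesis"
  have xc: "x \<in> carrier A" using x by (simp add: selfadjoint_def)
  show False
  proof (cases "[:z:] - p = 0")
    case True
    then have "poly p w = z" for w by auto
    then show False using * spectrum_selfadjoint_nonempty[OF x] by auto
  next
    case False
    then have "alg_poly A ([:z:] - p) x \<in> Units A" using * xc by (intro alg_poly_Units) auto
    then show False using z xc by (simp add: alg_poly_diff alg_poly_const alg_spectrum_def)
  qed
qed

text \<open>Adding i t to x shifts the spectrum by i t, whereas the C*-identity bounds \<parallel>x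
  + i t\<parallel>^2 by \<parallel>x\<parallel>^2 + t^2. The term 2 t Im z on the other side grows
  linearly in t and cannot be absorbed.\<close>

lemma spectrum_selfadjoint_real:
  assumes x: "selfadjoint A x" and z: "z \<in> alg_spectrum A x"
  shows "Im z = 0"
proof (rule ccontr)
  assume b: "Im z \<noteq> 0"
  have xc: "x \<in> carrier A" "adj A x = x" using x by (auto simp: selfadjoint_def)
  have bound: "(Im z + t)\<^sup>2 \<le> (cnorm A x)\<^sup>2 + t\<^sup>2" for t :: real
  proof -
    define c where "c = \<i> * of_real t"
    have c2: "- c * c = of_real (t\<^sup>2)" by (simp add: c_def complex_eq_iff power2_eq_square)
    define y where "y = x \<oplus> scl A c \<one>"
    have y: "y \<in> carrier A" using xc by (simp add: y_def)
    have "scl A (z + c) \<one> \<ominus> y = scl A z \<one> \<ominus> x"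
      using xc add_diff_add_left[of "scl A c \<one>" "scl A z \<one>" x]
      by (simp add: y_def scl_add_left a_comm)
    then have "z + c \<in> alg_spectrum A y" using z by (simp add: alg_spectrum_def)
    then have "cmod (z + c) \<le> cnorm A y" using cnorm_spectrum_le y by blast
    moreover have "(cnorm A y)\<^sup>2 \<le> (cnorm A x)\<^sup>2 + t\<^sup>2"
    proof -
      have ay: "adj A y = x \<oplus> scl A (- c) \<one>"
        using xc by (simp add: y_def adj_add adj_scl c_def)
      have "adj A y \<otimes> y = (x \<otimes> x \<oplus> scl A (- c) x) \<oplus> (scl A c x \<oplus> scl A (- c * c) \<one>)"
        unfolding ay unfolding y_def using xc
        by (simp add: l_distr r_distr scl_mult_left scl_mult_right scl_add_right scl_scl a_assoc)
      also have "\<dots> = x \<otimes> x \<oplus> scl A (t\<^sup>2) \<one>"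
        unfolding c2 using xc by (simp add: scl_minus_left a_assoc r_neg1)
      finally have "(cnorm A y)\<^sup>2 = cnorm A (x \<otimes> x \<oplus> scl A (t\<^sup>2) \<one>)" using cnorm_cstar[OF y] by simp
      also have "\<dots> \<le> cnorm A (x \<otimes> x) + cnorm A (scl A (t\<^sup>2) \<one>)"
        using xc by (intro cnorm_triangle) auto
      also have "\<dots> \<le> (cnorm A x)\<^sup>2 + t\<^sup>2"
        using xc cnorm_one_le cnorm_selfadjoint_sq[OF x] mult_left_mono[OF cnorm_one_le, of "t\<^sup>2"]
        by (simp add: cnorm_scl norm_power)
      finally show ?thesis .
    qed
    moreover have "(Im z + t)\<^sup>2 \<le> (cmod (z + c))\<^sup>2"
      using abs_Im_le_cmod[of "z + c"] by (intro power2_le_iff_abs_le[THEN iffD2]) (simp_all add: c_def)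
    moreover have "(cmod (z + c))\<^sup>2 \<le> (cnorm A y)\<^sup>2" by (rule power_mono) (use calculation in auto)
    ultimately show ?thesis by linarith
  qed
  \<comment> \<open>Makes 2 t Im z exceed \<parallel>x\<parallel>^2 by exactly 1, so that the bound
    collapses to (Im z)^2 + 1 \<le> 0.\<close>
  define t where "t = ((cnorm A x)\<^sup>2 + 1) / (2 * Im z)"
  have "2 * Im z * t = (cnorm A x)\<^sup>2 + 1" using b by (simp add: t_def)
  then have "(Im z)\<^sup>2 + 1 \<le> 0" using bound[of t] by (simp add: power2_sum)
  then show False using zero_le_power2[of "Im z"] by linarith
qed

text \<open>The self-adjoint element w is again a polynomial in x. Its norm
  \<parallel>y\<parallel>^2 is the modulus of one of its spectral values, and on the real spectrum
  of x these are values of |p|^2. In the zero algebra the spectrum is empty, and there the bound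
  rests on 0 \<le> c alone.\<close>

lemma cnorm_alg_poly_le:
  assumes x: "selfadjoint A x" and c: "0 \<le> c" "\<And>z. z \<in> alg_spectrum A x \<Longrightarrow> cmod (poly p z) \<le> c"
  shows "cnorm A (alg_poly A p x) \<le> c"
proof (cases "\<one> = \<zero>")
  case True
  have "x \<in> carrier A" using x by (simp add: selfadjoint_def)
  then have "alg_poly A p x \<in> carrier A" by simp
  then have "alg_poly A p x = \<zero>" using l_one[of "alg_poly A p x"] by (simp add: True)
  then show ?thesis using c(1) by simp
next
  case one: False
  have xc: "x \<in> carrier A" using x by (simp add: selfadjoint_def)
  define y where "y = alg_poly A p x"
  define w where "w = adj A y \<otimes> y"
  have yc: "y \<in> carrier A" using xc by (simp add: y_def)
  have w: "w = alg_poly A (map_poly cnj p * p) x"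
    using xc by (simp add: w_def y_def adj_alg_poly[OF x] alg_poly_mult)
  have wn: "cnorm A w = (cnorm A y)\<^sup>2" using cnorm_cstar[OF yc] by (simp add: w_def)
  have wsa: "selfadjoint A w" using yc by (simp add: selfadjoint_def w_def adj_mult adj_adj)
  have "(cnorm A y)\<^sup>2 \<le> c\<^sup>2"
  proof (cases "w = \<zero>")
    case False
    then obtain z where z: "z \<in> alg_spectrum A w" "cmod z = cnorm A w"
      using spectrum_attains_norm[OF wsa] by blast
    then obtain v where v: "v \<in> alg_spectrum A x" "z = poly (map_poly cnj p * p) v"
      using spectral_mapping[OF x one] w by blast
    have "cnj v = v" using spectrum_selfadjoint_real[OF x v(1)] by (simp add: complex_eq_iff)
    then have "cmod z = (cmod (poly p v))\<^sup>2" using v(2) by (simp add: norm_mult power2_eq_square)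
    also have "\<dots> \<le> c\<^sup>2" using c(2)[OF v(1)] by (intro power_mono) auto
    finally show ?thesis using z wn by simp
  qed (use wn in simp)
  then show ?thesis unfolding y_def using c(1) by (rule power2_le_imp_le)
qed

end

section \<open>Continuous functional calculus\<close>

text \<open>Weierstrass approximation on a compact real set, read along the embedding of the reals:
  spectra are sets of complex numbers, and \<open>F\<close> is constrained only on the image of
  \<open>K\<close>.\<close>

lemma real_poly_approx:
  fixes f :: "real \<Rightarrow> real"
  assumes K: "compact K" and f: "continuous_on K f" and F: "\<And>t. t \<in> K \<Longrightarrow> F (complex_of_real t) = of_real (f t)"
  shows "\<exists>p. uniform_limit (complex_of_real ` K) (\<lambda>k. poly (p k)) F sequentially"
proof -
  have "\<exists>p. \<forall>t\<in>K. dist (poly p (complex_of_real t)) (F (of_real t)) < 1 / Suc k" for k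
  proof -
    obtain g where g: "real_polynomial_function g" "\<And>t. t \<in> K \<Longrightarrow> \<bar>f t - g t\<bar> < 1 / Suc k"
      using Stone_Weierstrass_real_polynomial_function[OF K f, of "1 / Suc k"] by auto
    then obtain a n where g': "g = (\<lambda>x. \<Sum>i\<le>n. a i * x ^ i)"
      by (auto simp: real_polynomial_function_iff_sum)
    define p where "p = (\<Sum>i\<le>n. Polynomial.monom (complex_of_real (a i)) i)"
    have "poly p (complex_of_real t) = of_real (g t)" for t
      by (simp add: p_def g' poly_sum poly_monom)
    then have "dist (poly p (complex_of_real t)) (F (of_real t)) < 1 / Suc k" if "t \<in> K" for t
      using g(2)[OF that] F[OF that] by (simp add: dist_norm abs_minus_commute flip: of_real_diff)
    then show ?thesis by blast
  qed
  then obtain p where p: "\<And>k t. t \<in> K \<Longrightarrow> dist (poly (p k) (complex_of_real t)) (F (of_real t)) < 1 / Suc k"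
    by metis
  have "uniform_limit (complex_of_real ` K) (\<lambda>k. poly (p k)) F sequentially"
  proof (rule uniform_limitI)
    fix e :: real assume "e > 0"
    then have "eventually (\<lambda>k. 1 / Suc k < e) sequentially"
      using order_tendstoD(2)[OF LIMSEQ_inverse_real_of_nat, of e] by (simp add: inverse_eq_divide)
    then show "\<forall>\<^sub>F k in sequentially. \<forall>z\<in>complex_of_real ` K. dist (poly (p k) z) (F z) < e"
      by eventually_elim (use p in \<open>force intro: less_trans\<close>)
  qed
  then show ?thesis by blast
qed

context unital_cstar_algebra
begin

lemma alg_poly_uniform_close:
  assumes x: "selfadjoint A x"
    and p: "uniform_limit (alg_spectrum A x) (\<lambda>k. poly (p k)) F sequentially"
    and q: "uniform_limit (alg_spectrum A x) (\<lambda>k. poly (q k)) F sequentially"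
  shows "(\<lambda>k. cnorm A (alg_poly A (p k) x \<ominus> alg_poly A (q k) x)) \<longlonglongrightarrow> 0"
proof (rule tendstoI)
  fix e :: real assume e: "e > 0"
  have xc: "x \<in> carrier A" using x by (simp add: selfadjoint_def)
  have "\<forall>\<^sub>F k in sequentially. \<forall>z\<in>alg_spectrum A x. dist (poly (p k) z) (F z) < e/3"
    using uniform_limitD[OF p, of "e/3"] e by simp
  moreover have "\<forall>\<^sub>F k in sequentially. \<forall>z\<in>alg_spectrum A x. dist (poly (q k) z) (F z) < e/3"
    using uniform_limitD[OF q, of "e/3"] e by simp
  ultimately show "\<forall>\<^sub>F k in sequentially. dist (cnorm A (alg_poly A (p k) x \<ominus> alg_poly A (q k) x)) 0 < e"
  proof eventually_elim
    case (elim k)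
    have "cnorm A (alg_poly A (p k - q k) x) \<le> 2 * e / 3"
    proof (rule cnorm_alg_poly_le[OF x])
      fix z assume "z \<in> alg_spectrum A x"
      then show "cmod (poly (p k - q k) z) \<le> 2 * e / 3"
        using elim dist_triangle3[of "poly (p k) z" "poly (q k) z" "F z"]
        by (force simp: dist_norm norm_minus_commute)
    qed (use e in auto)
    then show ?case using e xc by (simp add: alg_poly_diff cnorm_nonneg)
  qed
qed

text \<open>Makes the definite description in \<open>cfc\<close> meaningful. The norm bound for
  polynomials gives the Cauchy property and the independence of the approximating sequence. One such
  sequence is assumed to exist because otherwise the inner implication is vacuous for every
  y.\<close>

lemma cfc_lim_ex1:
  assumes x: "selfadjoint A x"
    and p: "uniform_limit (alg_spectrum A x) (\<lambda>k. poly (p k)) F sequentially"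
  shows "\<exists>!y. y \<in> carrier A \<and>
     (\<forall>p. uniform_limit (alg_spectrum A x) (\<lambda>k. poly (p k)) F sequentially \<longrightarrow>
        (\<lambda>k. cnorm A (alg_poly A (p k) x \<ominus> y)) \<longlonglongrightarrow> 0)"
proof -
  have xc: "x \<in> carrier A" using x by (simp add: selfadjoint_def)
  define X where "X k = alg_poly A (p k) x" for k
  have X: "X k \<in> carrier A" for k using xc by (simp add: X_def)
  have "\<exists>y\<in>carrier A. (\<lambda>i. cnorm A (X i \<ominus> y)) \<longlonglongrightarrow> 0"
  proof (rule cnorm_complete[OF X])
    fix e :: real assume e: "e > 0"
    have "\<forall>\<^sub>F k in sequentially. \<forall>z\<in>alg_spectrum A x. dist (poly (p k) z) (F z) < e/3"
      using uniform_limitD[OF p, of "e/3"] e by simp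
    then obtain M where M: "\<And>k z. k \<ge> M \<Longrightarrow> z \<in> alg_spectrum A x \<Longrightarrow> dist (poly (p k) z) (F z) < e/3"
      by (auto simp: eventually_sequentially)
    have "cnorm A (X i \<ominus> X j) < e" if "i \<ge> M" "j \<ge> M" for i j
    proof -
      have "cnorm A (alg_poly A (p i - p j) x) \<le> 2 * e / 3"
      proof (rule cnorm_alg_poly_le[OF x])
        fix z assume "z \<in> alg_spectrum A x"
        then show "cmod (poly (p i - p j) z) \<le> 2 * e / 3"
          using M[OF that(1)] M[OF that(2)] dist_triangle3[of "poly (p i) z" "poly (p j) z" "F z"]
          by (force simp: dist_norm norm_minus_commute)
      qed (use e in auto)
      then show ?thesis using e xc by (simp add: alg_poly_diff X_def)
    qed
    then show "\<exists>M. \<forall>i\<ge>M. \<forall>j\<ge>M. cnorm A (X i \<ominus> X j) < e" by blast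
  qed
  then obtain y where y: "y \<in> carrier A" "(\<lambda>i. cnorm A (X i \<ominus> y)) \<longlonglongrightarrow> 0" by blast
  have lim: "(\<lambda>k. cnorm A (alg_poly A (q k) x \<ominus> y)) \<longlonglongrightarrow> 0"
    if q: "uniform_limit (alg_spectrum A x) (\<lambda>k. poly (q k)) F sequentially" for q
  proof (rule lim_comparison)
    show "cnorm A (alg_poly A (q i) x \<ominus> y) \<le> cnorm A (alg_poly A (q i) x \<ominus> X i) + cnorm A (X i \<ominus> y)" for i
      using X xc y(1) by (intro cnorm_dist_triangle) auto
    show "(\<lambda>i. cnorm A (alg_poly A (q i) x \<ominus> X i) + cnorm A (X i \<ominus> y)) \<longlonglongrightarrow> 0"
      using tendsto_add[OF alg_poly_uniform_close[OF x q p] y(2)] by (simp add: X_def)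
  qed (use xc y in auto)
  show ?thesis
  proof (rule ex1I[of _ y])
    fix y' assume y': "y' \<in> carrier A \<and>
     (\<forall>p. uniform_limit (alg_spectrum A x) (\<lambda>k. poly (p k)) F sequentially \<longrightarrow>
        (\<lambda>k. cnorm A (alg_poly A (p k) x \<ominus> y')) \<longlonglongrightarrow> 0)"
    then have "(\<lambda>k. cnorm A (X k \<ominus> y')) \<longlonglongrightarrow> 0" using p by (simp add: X_def)
    then show "y' = y" using y' y X by (blast intro: lim_unique)
  qed (use y lim in blast)
qed

lemma cfc_closed_lim:
  assumes x: "selfadjoint A x"
    and p: "uniform_limit (alg_spectrum A x) (\<lambda>k. poly (p k)) F sequentially"
  shows cfc_closed: "cfc A F x \<in> carrier A"
    and cfc_lim: "(\<lambda>k. cnorm A (alg_poly A (p k) x \<ominus> cfc A F x)) \<longlonglongrightarrow> 0"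
  using theI'[OF cfc_lim_ex1[OF x p]] p unfolding cfc_def by blast+

lemma cfc_eqI:
  assumes x: "selfadjoint A x" and y: "y \<in> carrier A"
    and p: "uniform_limit (alg_spectrum A x) (\<lambda>k. poly (p k)) F sequentially"
    and l: "(\<lambda>k. cnorm A (alg_poly A (p k) x \<ominus> y)) \<longlonglongrightarrow> 0"
  shows "cfc A F x = y"
  by (rule lim_unique[of "\<lambda>k. alg_poly A (p k) x"])
    (use x y l cfc_closed_lim[OF x p] in \<open>auto simp: selfadjoint_def\<close>)

text \<open>Spectrum and values of F are real, so conjugating all coefficients yields another
  approximating sequence, whose limit is the adjoint.\<close>

lemma cfc_selfadjoint:
  assumes x: "selfadjoint A x" and F: "\<And>z. z \<in> alg_spectrum A x \<Longrightarrow> Im (F z) = 0"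
    and p: "uniform_limit (alg_spectrum A x) (\<lambda>k. poly (p k)) F sequentially"
  shows "selfadjoint A (cfc A F x)"
proof -
  have xc: "x \<in> carrier A" using x by (simp add: selfadjoint_def)
  note c = cfc_closed_lim[OF x p]
  have "dist (poly (map_poly cnj (p k)) z) (F z) = dist (poly (p k) z) (F z)"
    if "z \<in> alg_spectrum A x" for k z
  proof -
    have "cnj z = z" "cnj (F z) = F z"
      using spectrum_selfadjoint_real[OF x that] F[OF that] by (simp_all add: complex_eq_iff)
    then have "dist (poly (map_poly cnj (p k)) z) (F z) = cmod (cnj (poly (p k) z - F z))"
      by (simp add: dist_norm)
    then show ?thesis by (simp only: complex_mod_cnj dist_norm)
  qed
  then have q: "uniform_limit (alg_spectrum A x) (\<lambda>k. poly (map_poly cnj (p k))) F sequentially"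
    using p by (simp add: uniform_limit_iff del: poly_map_poly_cnj)
  have "(\<lambda>k. cnorm A (adj A (alg_poly A (p k) x) \<ominus> adj A (cfc A F x))) \<longlonglongrightarrow> 0"
    using c xc by (intro lim_adj) auto
  then have "(\<lambda>k. cnorm A (alg_poly A (map_poly cnj (p k)) x \<ominus> adj A (cfc A F x))) \<longlonglongrightarrow> 0"
    by (simp add: adj_alg_poly[OF x])
  from cfc_eqI[OF x _ q this] show ?thesis using c by (simp add: selfadjoint_def)
qed

text \<open>Uniform convergence survives squaring because F is bounded on the spectrum.\<close>

lemma cfc_square_lim:
  assumes x: "selfadjoint A x" and F: "\<And>z. z \<in> alg_spectrum A x \<Longrightarrow> cmod (F z) \<le> C"
    and p: "uniform_limit (alg_spectrum A x) (\<lambda>k. poly (p k)) F sequentially"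
  shows "uniform_limit (alg_spectrum A x) (\<lambda>k. poly (p k * p k)) (\<lambda>z. F z * F z) sequentially"
    and "(\<lambda>k. cnorm A (alg_poly A (p k * p k) x \<ominus> cfc A F x \<otimes> cfc A F x)) \<longlonglongrightarrow> 0"
proof -
  have xc: "x \<in> carrier A" using x by (simp add: selfadjoint_def)
  have "bounded (F ` alg_spectrum A x)" using F by (auto simp: bounded_iff)
  then show "uniform_limit (alg_spectrum A x) (\<lambda>k. poly (p k * p k)) (\<lambda>z. F z * F z) sequentially"
    using uniform_lim_mult[OF p p] by (simp add: uniform_limit_iff)
  show "(\<lambda>k. cnorm A (alg_poly A (p k * p k) x \<ominus> cfc A F x \<otimes> cfc A F x)) \<longlonglongrightarrow> 0"
    unfolding alg_poly_mult[OF xc]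
    by (rule lim_mult) (use xc cfc_closed_lim[OF x p] in auto)
qed

lemma cfc_mult_self:
  assumes x: "selfadjoint A x" and F: "\<And>z. z \<in> alg_spectrum A x \<Longrightarrow> cmod (F z) \<le> C"
    and p: "uniform_limit (alg_spectrum A x) (\<lambda>k. poly (p k)) F sequentially"
  shows "cfc A F x \<otimes> cfc A F x = cfc A (\<lambda>z. F z * F z) x"
  by (rule cfc_eqI[OF x _ cfc_square_lim[OF x F p], symmetric])
    (use cfc_closed_lim[OF x p] in auto)

lemma cfc_cong:
  assumes "\<And>z. z \<in> alg_spectrum A x \<Longrightarrow> F z = G z" shows "cfc A F x = cfc A G x"
proof -
  have "uniform_limit (alg_spectrum A x) p F sequentially \<longleftrightarrow> uniform_limit (alg_spectrum A x) p G sequentially" for p :: "nat \<Rightarrow> complex \<Rightarrow> complex"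
    using assms by (simp add: uniform_limit_iff)
  then show ?thesis by (simp add: cfc_def)
qed

lemma cfc_poly:
  assumes x: "selfadjoint A x" shows "cfc A (poly q) x = alg_poly A q x"
  by (rule cfc_eqI[OF x, where p = "\<lambda>_. q"])
    (use x in \<open>auto simp: selfadjoint_def uniform_limit_iff lim_const\<close>)

text \<open>Taking for q the polynomial X compares a value of the calculus with the element
  itself.\<close>

lemma cnorm_cfc_diff_poly:
  assumes x: "selfadjoint A x" and c: "0 \<le> c" "\<And>z. z \<in> alg_spectrum A x \<Longrightarrow> cmod (F z - poly q z) \<le> c"
    and p: "uniform_limit (alg_spectrum A x) (\<lambda>k. poly (p k)) F sequentially"
  shows "cnorm A (cfc A F x \<ominus> alg_poly A q x) \<le> c"
proof (rule field_le_epsilon)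
  fix e :: real assume e: "e > 0"
  have xc: "x \<in> carrier A" using x by (simp add: selfadjoint_def)
  note cf = cfc_closed_lim[OF x p]
  have "\<forall>\<^sub>F k in sequentially. \<forall>z\<in>alg_spectrum A x. dist (poly (p k) z) (F z) < e/2"
    using uniform_limitD[OF p, of "e/2"] e by simp
  moreover have "\<forall>\<^sub>F k in sequentially. cnorm A (alg_poly A (p k) x \<ominus> cfc A F x) < e/2"
    using order_tendstoD(2)[OF cf(2), of "e/2"] e by simp
  ultimately have "\<forall>\<^sub>F k in sequentially. cnorm A (cfc A F x \<ominus> alg_poly A q x) \<le> c + e"
  proof eventually_elim
    case (elim k)
    have "cnorm A (alg_poly A (p k - q) x) \<le> c + e/2"
    proof (rule cnorm_alg_poly_le[OF x])
      fix z assume z: "z \<in> alg_spectrum A x"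
      have "cmod (poly (p k) z - F z) < e/2" using elim z by (simp add: dist_norm)
      then show "cmod (poly (p k - q) z) \<le> c + e/2"
        using c(2)[OF z] norm_triangle_ineq[of "poly (p k) z - F z" "F z - poly q z"] by simp
    qed (use e c in auto)
    then have "cnorm A (alg_poly A (p k) x \<ominus> alg_poly A q x) \<le> c + e/2"
      using xc by (simp add: alg_poly_diff)
    then show ?case
      using elim(2) cnorm_dist_triangle[of "cfc A F x" "alg_poly A (p k) x" "alg_poly A q x"]
        cnorm_diff_commute[of "cfc A F x" "alg_poly A (p k) x"] cf xc by simp
  qed
  then show "cnorm A (cfc A F x \<ominus> alg_poly A q x) \<le> c + e" by simp
qed

section \<open>Spectra of almost idempotent elements\<close>

lemma Units_factor:
  assumes a: "a \<in> carrier A" "b \<in> carrier A" and ab: "a \<otimes> b = b \<otimes> a" "a \<otimes> b \<in> Units A"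
  shows "a \<in> Units A"
proof -
  define c where "c = inv (a \<otimes> b)"
  have c: "c \<in> carrier A" using ab by (simp add: c_def)
  have r: "a \<otimes> (b \<otimes> c) = \<one>" using a ab c by (simp add: c_def flip: m_assoc)
  have l: "(c \<otimes> b) \<otimes> a = \<one>" using a ab c by (simp add: c_def m_assoc flip: ab(1))
  have "c \<otimes> b = b \<otimes> c" by (rule inv_unique[OF l r]) (use a c in auto)
  then show ?thesis using a c l r by (auto simp: Units_def intro!: bexI[of _ "b \<otimes> c"])
qed

text \<open>The polynomial p(z) - p vanishes at z, so its value at x has
  \<open>scl A z \<one> \<ominus> x\<close> as a factor that commutes with the cofactor; a commuting
  factor of a unit is a unit.\<close>

lemma poly_in_spectrum:
  assumes x: "x \<in> carrier A" and z: "z \<in> alg_spectrum A x"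
  shows "poly p z \<in> alg_spectrum A (alg_poly A p x)"
proof (rule ccontr)
  assume "\<not> ?thesis"
  then have u: "alg_poly A ([:poly p z:] - p) x \<in> Units A"
    using x by (simp add: alg_spectrum_def alg_poly_diff alg_poly_const)
  have "poly ([:poly p z:] - p) z = 0" by simp
  then obtain r where r: "[:poly p z:] - p = [:- z, 1:] * r" by (metis poly_eq_0_iff_dvd dvdE)
  define q where "q = - r"
  have q: "[:poly p z:] - p = [:z, -1:] * q" unfolding r q_def by (simp add: algebra_simps)
  have lin: "alg_poly A [:z, -1:] x = scl A z \<one> \<ominus> x"
    using x by (simp add: alg_poly_pCons a_minus_def scl_minus_one scl_mult_right)
  have "scl A z \<one> \<ominus> x \<in> Units A"
  proof (rule Units_factor)
    show "(scl A z \<one> \<ominus> x) \<otimes> alg_poly A q x = alg_poly A q x \<otimes> (scl A z \<one> \<ominus> x)"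
      unfolding lin[symmetric] alg_poly_mult[OF x, symmetric] by (simp only: mult.commute)
    show "(scl A z \<one> \<ominus> x) \<otimes> alg_poly A q x \<in> Units A"
      unfolding lin[symmetric] alg_poly_mult[OF x, symmetric] using u q by simp
  qed (use x in auto)
  then show False using z by (simp add: alg_spectrum_def)
qed

lemma selfadjoint_closed: "selfadjoint A x \<Longrightarrow> x \<in> carrier A"
  by (simp add: selfadjoint_def)

text \<open>X^2 - X maps the spectrum of e into that of e^2 - e, whose points are bounded by the
  norm.\<close>

lemma spectrum_near_idempotent:
  assumes e: "selfadjoint A e" and z: "z \<in> alg_spectrum A e"
  shows "\<exists>t. z = of_real t \<and> \<bar>t * t - t\<bar> \<le> cnorm A (e \<otimes> e \<ominus> e)"
proof -
  have ec: "e \<in> carrier A" using e by (rule selfadjoint_closed)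
  have "alg_poly A ([:0, 1:] * [:0, 1:] - [:0, 1:]) e = e \<otimes> e \<ominus> e"
    using ec by (simp only: alg_poly_diff alg_poly_mult alg_poly_X)
  then have "cmod (poly ([:0, 1:] * [:0, 1:] - [:0, 1:]) z) \<le> cnorm A (e \<otimes> e \<ominus> e)"
    using poly_in_spectrum[OF ec z, of "[:0, 1:] * [:0, 1:] - [:0, 1:]"] ec
    by (intro cnorm_spectrum_le) auto
  then have le: "cmod (z * z - z) \<le> cnorm A (e \<otimes> e \<ominus> e)" by (simp add: algebra_simps)
  have z': "z = of_real (Re z)" using spectrum_selfadjoint_real[OF e z] by (simp add: complex_eq_iff)
  have "z * z - z = of_real (Re z * Re z - Re z)" by (subst (1 2 3) z') simp
  then have "cmod (z * z - z) = \<bar>Re z * Re z - Re z\<bar>" by (simp only: norm_of_real)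
  then show ?thesis using le z' by metis
qed

lemma chi_half_approx:
  assumes e: "selfadjoint A e" and c: "cnorm A (e \<otimes> e \<ominus> e) < 1/4"
  shows "\<exists>p. uniform_limit (alg_spectrum A e) (\<lambda>k. poly (p k)) (\<lambda>z. if Re z > 1/2 then 1 else 0) sequentially"
proof -
  \<comment> \<open>Since (t - 1/2)^2 = t^2 - t + 1/4, the bound on |t^2 - t| keeps spectral points
    at distance at least \<open>\<eta>\<close> and at most 1 from 1/2. On each of the two remaining
    intervals the step function is constant.\<close>
  define \<eta> where "\<eta> = sqrt (1/4 - cnorm A (e \<otimes> e \<ominus> e))"
  have \<eta>: "\<eta> > 0" "\<eta>\<^sup>2 = 1/4 - cnorm A (e \<otimes> e \<ominus> e)" using c by (simp_all add: \<eta>_def)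
  define K where "K = {-1/2..1/2 - \<eta>} \<union> {1/2 + \<eta>..3/2}"
  define f :: "real \<Rightarrow> real" where "f t = (if t > 1/2 then 1 else 0)" for t
  have sub: "alg_spectrum A e \<subseteq> complex_of_real ` K"
  proof
    fix z assume "z \<in> alg_spectrum A e"
    then obtain t where t: "z = of_real t" "\<bar>t * t - t\<bar> \<le> cnorm A (e \<otimes> e \<ominus> e)"
      using spectrum_near_idempotent[OF e] by blast
    have sq: "(t - 1/2)\<^sup>2 = t * t - t + 1/4" by (simp add: power2_eq_square algebra_simps)
    have "\<eta>\<^sup>2 \<le> (t - 1/2)\<^sup>2" unfolding sq \<eta> using t(2) by linarith
    then have "\<eta> \<le> \<bar>t - 1/2\<bar>" using \<eta>(1) by (metis abs_le_square_iff abs_of_pos)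
    moreover have "(t - 1/2)\<^sup>2 \<le> 1\<^sup>2" unfolding sq using t(2) c by simp
    then have "\<bar>t - 1/2\<bar> \<le> \<bar>1\<bar>" by (simp only: abs_le_square_iff)
    ultimately have "t \<in> K" by (auto simp: K_def)
    then show "z \<in> complex_of_real ` K" using t(1) by blast
  qed
  have "continuous_on K f"
    unfolding K_def
  proof (rule continuous_on_closed_Un)
    show "continuous_on {- 1 / 2..1 / 2 - \<eta>} f"
      by (rule continuous_on_eq[of _ "\<lambda>_. 0"]) (use \<eta> in \<open>auto simp: f_def\<close>)
    show "continuous_on {1 / 2 + \<eta>..3 / 2} f"
      by (rule continuous_on_eq[of _ "\<lambda>_. 1"]) (use \<eta> in \<open>auto simp: f_def\<close>)
  qed auto
  moreover have "compact K" by (auto simp: K_def)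
  ultimately have "\<exists>p. uniform_limit (complex_of_real ` K) (\<lambda>k. poly (p k)) (\<lambda>z. if Re z > 1/2 then 1 else 0) sequentially"
    by (intro real_poly_approx[of K f]) (simp_all add: f_def)
  then show ?thesis using uniform_limit_on_subset sub by blast
qed

lemma half_notin_spectrum:
  assumes e: "selfadjoint A e" and c: "cnorm A (e \<otimes> e \<ominus> e) < 1/4"
  shows "1/2 \<notin> alg_spectrum A e"
proof
  assume "1/2 \<in> alg_spectrum A e"
  then obtain t where t: "1/2 = complex_of_real t" "\<bar>t * t - t\<bar> \<le> cnorm A (e \<otimes> e \<ominus> e)"
    using spectrum_near_idempotent[OF e] by blast
  have "t = 1/2" using arg_cong[OF t(1), of Re] by simp
  then show False using t(2) c unfolding \<open>t = 1/2\<close> by simp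
qed

lemma chi_half_lim:
  assumes e: "selfadjoint A e"
    and p: "uniform_limit (alg_spectrum A e) (\<lambda>k. poly (p k)) (\<lambda>z. if Re z > 1/2 then 1 else 0) sequentially"
  shows "(\<lambda>k. cnorm A (alg_poly A (p k) e \<ominus> chi_half A e)) \<longlonglongrightarrow> 0"
  using cfc_lim[OF e p] by (simp add: chi_half_def)

text \<open>The step function equals its own square, and on [-1/2, 3/2], where the spectrum lies, it
  differs from the identity by at most 1/2.\<close>

lemma chi_half_projection:
  assumes e: "selfadjoint A e" and c: "cnorm A (e \<otimes> e \<ominus> e) < 1/4"
  shows "is_projection A (chi_half A e)" "cnorm A (chi_half A e \<ominus> e) \<le> 1/2"
proof -
  have ec: "e \<in> carrier A" using e by (rule selfadjoint_closed)
  define F :: "complex \<Rightarrow> complex" where "F = (\<lambda>z. if Re z > 1/2 then 1 else 0)"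
  obtain p where p: "uniform_limit (alg_spectrum A e) (\<lambda>k. poly (p k)) F sequentially"
    using chi_half_approx[OF e c] unfolding F_def by blast
  have "cfc A F e \<otimes> cfc A F e = cfc A (\<lambda>z. F z * F z) e"
    by (rule cfc_mult_self[OF e _ p, of 1]) (simp add: F_def)
  also have "(\<lambda>z. F z * F z) = F" by (simp add: F_def fun_eq_iff)
  finally have "cfc A F e \<otimes> cfc A F e = cfc A F e" .
  moreover have "selfadjoint A (cfc A F e)" by (rule cfc_selfadjoint[OF e _ p]) (simp add: F_def)
  ultimately show "is_projection A (chi_half A e)" by (simp add: is_projection_def chi_half_def F_def)
  have "cnorm A (cfc A F e \<ominus> alg_poly A [:0, 1:] e) \<le> 1/2"
  proof (rule cnorm_cfc_diff_poly[OF e _ _ p])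
    fix z assume "z \<in> alg_spectrum A e"
    then obtain t where t: "z = of_real t" "\<bar>t * t - t\<bar> \<le> cnorm A (e \<otimes> e \<ominus> e)"
      using spectrum_near_idempotent[OF e] by blast
    have sq: "(t - 1/2)\<^sup>2 = t * t - t + 1/4" by (simp add: power2_eq_square algebra_simps)
    have "(t - 1/2)\<^sup>2 \<le> 1\<^sup>2" unfolding sq using t(2) c by simp
    then have "\<bar>t - 1/2\<bar> \<le> \<bar>1\<bar>" by (simp only: abs_le_square_iff)
    then have "t \<le> 3/2" "- 1/2 \<le> t" by linarith+
    then have "\<bar>if t > 1/2 then 1 - t else - t\<bar> \<le> 1/2" by (auto simp: abs_if)
    moreover have "F z - poly [:0, 1:] z = of_real (if t > 1/2 then 1 - t else - t)"
      by (simp add: F_def t(1))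
    ultimately show "cmod (F z - poly [:0, 1:] z) \<le> 1/2" by (simp only: norm_of_real)
  qed simp
  then show "cnorm A (chi_half A e \<ominus> e) \<le> 1/2"
    using ec by (simp add: alg_poly_X chi_half_def F_def)
qed

subsection \<open>Projections and traces\<close>

lemma projection_reflection_unitary:
  assumes q: "is_projection A q" shows "unitary_elem A (scl A 2 q \<ominus> \<one>)"
proof -
  have qc: "q \<in> carrier A" "adj A q = q" "q \<otimes> q = q" using q by (simp_all add: is_projection_def selfadjoint_def)
  have "(scl A 2 q \<ominus> \<one>) \<otimes> (scl A 2 q \<ominus> \<one>) = scl A 4 q \<ominus> scl A 2 q \<ominus> (scl A 2 q \<ominus> \<one>)"
    using qc by (simp add: l_diff r_diff scl_diff_right scl_mult_left scl_mult_right scl_scl)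
  also have "scl A 4 q \<ominus> scl A 2 q = scl A 2 q" using qc scl_diff_left[of q 4 2] by simp
  also have "scl A 2 q \<ominus> (scl A 2 q \<ominus> \<one>) = \<one>"
    using diff_diff_diff_left[of "scl A 2 q" \<zero> \<one>] qc by (simp add: a_minus_def)
  finally show ?thesis using qc by (simp add: unitary_elem_def adj_diff adj_scl)
qed

text \<open>With \<open>x = e - p\<close> and \<open>s = 2 p - 1\<close> one has \<open>e\<^sup>2 - e = x\<^sup>2 + (s x + x s) / 2\<close>; the
  reflection \<open>s\<close> is unitary, which saves a factor \<open>2\<close> over the naive estimate.\<close>

lemma near_projection_idempotent:
  assumes p: "is_projection A p" and e: "e \<in> carrier A"
  shows "cnorm A (e \<otimes> e \<ominus> e) \<le> cnorm A (e \<ominus> p) + (cnorm A (e \<ominus> p))\<^sup>2"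
proof -
  have pc: "p \<in> carrier A" "p \<otimes> p = p" using p by (simp_all add: is_projection_def selfadjoint_def)
  define x s where "x = e \<ominus> p" and "s = scl A 2 p \<ominus> \<one>"
  have xc: "x \<in> carrier A" and sc: "s \<in> carrier A" using pc e by (simp_all add: x_def s_def)
  have ex: "e = p \<oplus> x" using pc e by (simp add: x_def a_minus_def a_lcomm[of p e] r_neg)
  have "e \<otimes> e = p \<oplus> (x \<otimes> p \<oplus> (p \<otimes> x \<oplus> x \<otimes> x))"
    using pc xc by (simp add: ex l_distr r_distr a_assoc)
  then have e1: "e \<otimes> e \<ominus> e = (x \<otimes> p \<oplus> (p \<otimes> x \<oplus> x \<otimes> x)) \<ominus> x"
    using pc xc by (simp add: ex add_diff_add_left)
  have "scl A (1/2) (s \<otimes> x \<oplus> x \<otimes> s) = (p \<otimes> x \<ominus> scl A (1/2) x) \<oplus> (x \<otimes> p \<ominus> scl A (1/2) x)"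
    using pc xc by (simp add: s_def l_diff r_diff scl_diff_right scl_add_right scl_mult_left scl_mult_right scl_scl scl_one)
  also have "\<dots> = (p \<otimes> x \<oplus> x \<otimes> p) \<ominus> (scl A (1/2) x \<oplus> scl A (1/2) x)"
    using pc xc by (simp add: a_minus_def minus_add a_ac)
  also have "scl A (1/2) x \<oplus> scl A (1/2) x = x"
    using xc by (simp add: scl_one flip: scl_add_left)
  finally have "e \<otimes> e \<ominus> e = x \<otimes> x \<oplus> scl A (1/2) (s \<otimes> x \<oplus> x \<otimes> s)"
    unfolding e1 using pc xc by (simp add: a_minus_def a_ac)
  then have "cnorm A (e \<otimes> e \<ominus> e) \<le> cnorm A (x \<otimes> x) + cnorm A (scl A (1/2) (s \<otimes> x \<oplus> x \<otimes> s))"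
    using xc sc by (simp add: cnorm_triangle)
  also have "cnorm A (scl A (1/2) (s \<otimes> x \<oplus> x \<otimes> s)) \<le> (cnorm A (s \<otimes> x) + cnorm A (x \<otimes> s)) / 2"
    using xc sc cnorm_triangle[of "s \<otimes> x" "x \<otimes> s"] by (simp add: cnorm_scl norm_divide)
  also have "\<dots> \<le> (cnorm A x + cnorm A x) / 2"
  proof -
    have s1: "cnorm A s \<le> 1" using cnorm_unitary[OF projection_reflection_unitary[OF p]] by (simp add: s_def)
    have "cnorm A (s \<otimes> x) \<le> 1 * cnorm A x" "cnorm A (x \<otimes> s) \<le> cnorm A x * 1"
      using cnorm_mult[of s x] cnorm_mult[of x s] s1 xc sc
        mult_right_mono[OF s1 cnorm_nonneg[OF xc]] mult_left_mono[OF s1 cnorm_nonneg[OF xc]] by auto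
    then show ?thesis by simp
  qed
  finally show ?thesis using cnorm_mult[OF xc xc] by (simp add: x_def power2_eq_square)
qed

lemma tracial_stateD:
  assumes "tracial_state A \<tau>"
  shows "\<lbrakk>x \<in> carrier A; y \<in> carrier A\<rbrakk> \<Longrightarrow> \<tau> (x \<oplus> y) = \<tau> x + \<tau> y"
    and "x \<in> carrier A \<Longrightarrow> \<tau> (scl A c x) = c * \<tau> x"
    and "x \<in> carrier A \<Longrightarrow> Im (\<tau> (adj A x \<otimes> x)) = 0"
    and "x \<in> carrier A \<Longrightarrow> 0 \<le> Re (\<tau> (adj A x \<otimes> x))"
    and "\<tau> \<one> = 1"
    and "\<lbrakk>x \<in> carrier A; y \<in> carrier A\<rbrakk> \<Longrightarrow> \<tau> (x \<otimes> y) = \<tau> (y \<otimes> x)"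
  using assms by (auto simp: tracial_state_def complex_is_Real_iff)

lemma tracial_state_diff:
  assumes "tracial_state A \<tau>" "x \<in> carrier A" "y \<in> carrier A"
  shows "\<tau> (x \<ominus> y) = \<tau> x - \<tau> y"
  using assms(2,3) tracial_stateD(1)[OF assms(1), of x "scl A (-1) y"] tracial_stateD(2)[OF assms(1), of y "-1"]
  by (simp add: a_minus_def scl_minus_one)

text \<open>Both projections are conjugate under \<open>v = q p + (1 - q) (1 - p)\<close>, which is invertible since
  \<open>v - 1 = (2 q - 1) (p - q)\<close>.\<close>

lemma tracial_state_close_projections:
  assumes \<tau>: "tracial_state A \<tau>" and p: "is_projection A p" and q: "is_projection A q"
    and d: "cnorm A (p \<ominus> q) < 1"
  shows "\<tau> p = \<tau> q"
proof -
  have pc: "p \<in> carrier A" "p \<otimes> p = p" and qc: "q \<in> carrier A" "q \<otimes> q = q"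
    using p q by (simp_all add: is_projection_def selfadjoint_def)
  define s where "s = scl A 2 q \<ominus> \<one>"
  have sc: "s \<in> carrier A" and sn: "cnorm A s \<le> 1"
    using qc cnorm_unitary[OF projection_reflection_unitary[OF q]] by (simp_all add: s_def)
  define v where "v = \<one> \<oplus> s \<otimes> (p \<ominus> q)"
  have vc: "v \<in> carrier A" using pc qc sc by (simp add: v_def)
  have "cnorm A (\<ominus> (s \<otimes> (p \<ominus> q))) < 1"
    using cnorm_mult[of s "p \<ominus> q"] mult_right_mono[OF sn cnorm_nonneg, of "p \<ominus> q"] d pc qc sc by simp
  then have "\<one> \<ominus> \<ominus> (s \<otimes> (p \<ominus> q)) \<in> Units A" using pc qc sc by (intro neumann) auto
  then have vU: "v \<in> Units A" using pc qc sc by (simp add: v_def a_minus_def)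
  have qs: "q \<otimes> s = q" using qc scl_diff_left[of q 2 1]
    by (simp add: s_def r_diff scl_mult_right scl_one)
  \<comment> \<open>Because q s = q, both q v and v p reduce to q p; thus v intertwines p and
    q.\<close>
  have "q \<otimes> v = q \<oplus> (q \<otimes> s) \<otimes> (p \<ominus> q)"
    using pc qc sc by (simp add: v_def r_distr m_assoc)
  also have "\<dots> = q \<oplus> (q \<otimes> p \<ominus> q)" unfolding qs using pc qc by (simp add: r_diff)
  also have "\<dots> = q \<otimes> p" using pc qc by (simp add: a_minus_def a_lcomm[of q "q \<otimes> p"] r_neg)
  finally have qv: "q \<otimes> v = q \<otimes> p" .
  have pqp: "(p \<ominus> q) \<otimes> p = p \<ominus> q \<otimes> p" using pc qc by (simp add: l_diff)
  have "s \<otimes> (p \<ominus> q \<otimes> p) = (scl A 2 (q \<otimes> p) \<ominus> p) \<ominus> (scl A 2 (q \<otimes> p) \<ominus> q \<otimes> p)"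
    using pc qc by (simp add: s_def l_diff r_diff scl_mult_left flip: m_assoc)
  also have "\<dots> = q \<otimes> p \<ominus> p" using pc qc by (simp add: diff_diff_diff_left)
  finally have "v \<otimes> p = p \<oplus> (q \<otimes> p \<ominus> p)"
    using pc qc sc by (simp add: v_def l_distr m_assoc pqp)
  also have "\<dots> = q \<otimes> p" using pc qc by (simp add: a_minus_def a_lcomm[of p "q \<otimes> p"] r_neg)
  finally have vp: "v \<otimes> p = q \<otimes> v" using qv by simp
  \<comment> \<open>Similarity is enough for a trace, so v is not replaced by the unitary of its
    polar decomposition.\<close>
  have "\<tau> q = \<tau> (q \<otimes> v \<otimes> inv v)" using vU vc qc by (simp add: m_assoc)
  also have "\<dots> = \<tau> (v \<otimes> p \<otimes> inv v)" by (simp add: vp)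
  also have "\<dots> = \<tau> (inv v \<otimes> (v \<otimes> p))" using vU vc pc by (intro tracial_stateD(6)[OF \<tau>]) auto
  also have "inv v \<otimes> (v \<otimes> p) = p" using vU vc pc by (simp flip: m_assoc)
  finally show ?thesis by simp
qed

text \<open>\<open>sqrt (1 - t)\<close> is continuous on [-1, 1], which contains the spectrum, and
  its square agrees there with the polynomial 1 - X.\<close>

lemma selfadjoint_unit_ball_sqrt:
  assumes h: "selfadjoint A h" "cnorm A h \<le> 1"
  shows "\<exists>y. selfadjoint A y \<and> y \<otimes> y = \<one> \<ominus> h"
proof -
  have hc: "h \<in> carrier A" using h by (simp add: selfadjoint_closed)
  define F where "F z = complex_of_real (sqrt (1 - Re z))" for z
  have sp: "\<exists>t. z = of_real t \<and> \<bar>t\<bar> \<le> 1" if "z \<in> alg_spectrum A h" for z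
    using spectrum_selfadjoint_real[OF h(1) that] cnorm_spectrum_le[OF hc that] h(2)
    by (intro exI[of _ "Re z"]) (auto simp: complex_eq_iff cmod_def)
  then have sub: "alg_spectrum A h \<subseteq> complex_of_real ` {-1..1}" by fastforce
  have "continuous_on {-1..1} (\<lambda>t. sqrt (1 - t))" by (intro continuous_intros)
  then obtain p where "uniform_limit (complex_of_real ` {-1..1}) (\<lambda>k. poly (p k)) F sequentially"
    using real_poly_approx[of "{-1..1}" "\<lambda>t. sqrt (1 - t)" F] by (auto simp: F_def)
  then have p: "uniform_limit (alg_spectrum A h) (\<lambda>k. poly (p k)) F sequentially"
    using uniform_limit_on_subset sub by blast
  have "cfc A F h \<otimes> cfc A F h = cfc A (\<lambda>z. F z * F z) h"
  proof (rule cfc_mult_self[OF h(1) _ p])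
    fix z assume "z \<in> alg_spectrum A h"
    then obtain t where t: "z = of_real t" "\<bar>t\<bar> \<le> 1" using sp by blast
    then show "cmod (F z) \<le> sqrt 2" by (simp add: F_def)
  qed
  also have "\<dots> = cfc A (poly [:1, -1:]) h"
  proof (rule cfc_cong)
    fix z assume "z \<in> alg_spectrum A h"
    then obtain t where t: "z = of_real t" "\<bar>t\<bar> \<le> 1" using sp by blast
    then show "F z * F z = poly [:1, -1:] z" by (simp add: F_def flip: of_real_mult)
  qed
  also have "\<dots> = \<one> \<ominus> h"
    using hc by (simp add: cfc_poly[OF h(1)] alg_poly_pCons a_minus_def scl_minus_one scl_mult_right scl_one)
  finally show ?thesis using cfc_selfadjoint[OF h(1) _ p] by (auto simp: F_def)
qed

text \<open>\<open>1 - h\<close> and \<open>1 + h\<close> are squares of self-adjoint elements when \<open>\<parallel>h\<parallel> \<le> 1\<close>, so positivity of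
  \<open>\<tau>\<close> bounds \<open>\<tau>(h)\<close>.\<close>

lemma tracial_state_selfadjoint_le:
  assumes \<tau>: "tracial_state A \<tau>" and h: "selfadjoint A h"
  shows "cmod (\<tau> h) \<le> cnorm A h"
proof -
  have unit: "cmod (\<tau> h) \<le> 1" if h: "selfadjoint A h" "cnorm A h \<le> 1" for h
  proof -
    have hc: "h \<in> carrier A" using h by (simp add: selfadjoint_closed)
    have *: "Im (\<tau> g) = 0 \<and> Re (\<tau> g) \<le> 1" if g: "selfadjoint A g" "cnorm A g \<le> 1" for g
    proof -
      obtain y where y: "selfadjoint A y" "y \<otimes> y = \<one> \<ominus> g" using selfadjoint_unit_ball_sqrt[OF g] by blast
      then have "adj A y \<otimes> y = \<one> \<ominus> g" "y \<in> carrier A" by (simp_all add: selfadjoint_def)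
      then show ?thesis
        using tracial_stateD(3,4)[OF \<tau>, of y] selfadjoint_closed[OF g(1)]
        by (simp add: tracial_state_diff[OF \<tau>] tracial_stateD(5)[OF \<tau>])
    qed
    have "selfadjoint A (\<ominus> h)" using h by (simp add: selfadjoint_def adj_minus)
    moreover have "\<tau> (\<ominus> h) = - \<tau> h" using hc tracial_stateD(2)[OF \<tau>, of h "-1"] by (simp add: scl_minus_one)
    ultimately have "Re (\<tau> h) \<le> 1" "- Re (\<tau> h) \<le> 1" "Im (\<tau> h) = 0"
      using *[of h] *[of "\<ominus> h"] h hc by auto
    then show ?thesis by (simp add: cmod_eq_Re)
  qed
  have hc: "h \<in> carrier A" using h by (simp add: selfadjoint_closed)
  show ?thesis
  proof (cases "cnorm A h = 0")
    case True
    then have "h = scl A 0 h" using hc by (simp add: cnorm_eq_zero)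
    then have "\<tau> h = 0" using tracial_stateD(2)[OF \<tau> hc, of 0] by simp
    then show ?thesis by (simp add: True)
  next
    case False
    then have n: "cnorm A h > 0" using cnorm_nonneg[OF hc] by simp
    define g where "g = scl A (of_real (1 / cnorm A h)) h"
    have "selfadjoint A g" using h by (simp add: g_def selfadjoint_def adj_scl)
    moreover have "cnorm A g \<le> 1" using n hc by (simp add: g_def cnorm_scl norm_divide)
    ultimately have "cmod (\<tau> g) \<le> 1" by (rule unit)
    then show ?thesis using n hc by (simp add: g_def tracial_stateD(2)[OF \<tau>] norm_mult norm_divide field_simps)
  qed
qed

text \<open>The Cartesian decomposition x = a + i b reduces to self-adjoint elements. The crude
  constant 2 suffices, as the bound serves only for continuity.\<close>

lemma tracial_state_bounded:
  assumes \<tau>: "tracial_state A \<tau>" and x: "x \<in> carrier A"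
  shows "cmod (\<tau> x) \<le> 2 * cnorm A x"
proof -
  define a b where "a = scl A (1/2) (x \<oplus> adj A x)" and "b = scl A (- \<i>/2) (x \<ominus> adj A x)"
  have ac: "selfadjoint A a" using x by (simp add: selfadjoint_def a_def adj_scl adj_add adj_adj a_comm)
  have "adj A x \<ominus> x = \<ominus> (x \<ominus> adj A x)" using x by (simp add: a_minus_def minus_add a_comm)
  then have bc: "selfadjoint A b"
    using x by (simp add: selfadjoint_def b_def adj_scl adj_diff adj_adj adj_minus scl_minus_right scl_minus_left)
  have n: "cnorm A a \<le> cnorm A x" "cnorm A b \<le> cnorm A x"
    using x cnorm_triangle[of x "adj A x"] cnorm_triangle_diff[of x "adj A x"]
    by (simp_all add: a_def b_def cnorm_scl norm_divide)
  have "a \<oplus> scl A \<i> b = scl A (1/2) ((x \<oplus> adj A x) \<oplus> (x \<ominus> adj A x))"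
    using x by (simp add: a_def b_def scl_scl scl_add_right)
  also have "(x \<oplus> adj A x) \<oplus> (x \<ominus> adj A x) = x \<oplus> x"
    using x by (simp add: a_minus_def a_assoc a_comm[of x "\<ominus> adj A x"] r_neg2)
  also have "scl A (1/2) (x \<oplus> x) = x"
    using x by (simp add: scl_add_right scl_one flip: scl_add_left)
  finally have "\<tau> x = \<tau> a + \<i> * \<tau> b"
    using selfadjoint_closed[OF ac] selfadjoint_closed[OF bc] tracial_stateD(1)[OF \<tau>, of a "scl A \<i> b"]
    by (simp add: tracial_stateD(2)[OF \<tau>])
  then have "cmod (\<tau> x) \<le> cmod (\<tau> a) + cmod (\<tau> b)"
    using norm_triangle_ineq[of "\<tau> a" "\<i> * \<tau> b"] by (simp add: norm_mult)
  then show ?thesis using tracial_state_selfadjoint_le[OF \<tau> ac] tracial_state_selfadjoint_le[OF \<tau> bc] n by linarith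
qed

end

section \<open>Homomorphisms\<close>

lemma (in unital_cstar_algebra) Units_nat_pow_Units: "x \<in> Units A \<Longrightarrow> x [^] (n::nat) \<in> Units A"
  by (induction n) simp_all

locale unital_cstar_hom = A: unital_cstar_algebra A + B: unital_cstar_algebra B
  for A :: "('a, 'm) cstar_algebra_scheme" and B :: "('b, 'k) cstar_algebra_scheme" +
  fixes \<phi> :: "'a \<Rightarrow> 'b"
  assumes hom: "cstar_hom A B \<phi>"
begin

lemma hom_ring: "\<phi> \<in> ring_hom A B"
  using hom by (simp add: cstar_hom_def)

lemma hom_closed [simp, intro]: "x \<in> carrier A \<Longrightarrow> \<phi> x \<in> carrier B"
  using hom_ring by (rule ring_hom_closed)

lemma hom_mult [simp]: "x \<in> carrier A \<Longrightarrow> y \<in> carrier A \<Longrightarrow> \<phi> (x \<otimes>\<^bsub>A\<^esub> y) = \<phi> x \<otimes>\<^bsub>B\<^esub> \<phi> y"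
  using hom_ring by (rule ring_hom_mult)

lemma hom_add [simp]: "x \<in> carrier A \<Longrightarrow> y \<in> carrier A \<Longrightarrow> \<phi> (x \<oplus>\<^bsub>A\<^esub> y) = \<phi> x \<oplus>\<^bsub>B\<^esub> \<phi> y"
  using hom_ring by (rule ring_hom_add)

lemma hom_one [simp]: "\<phi> \<one>\<^bsub>A\<^esub> = \<one>\<^bsub>B\<^esub>"
  using hom_ring by (rule ring_hom_one)

lemma hom_scl [simp]: "x \<in> carrier A \<Longrightarrow> \<phi> (scl A c x) = scl B c (\<phi> x)"
  using hom by (simp add: cstar_hom_def)

lemma hom_adj [simp]: "x \<in> carrier A \<Longrightarrow> \<phi> (adj A x) = adj B (\<phi> x)"
  using hom by (simp add: cstar_hom_def)

lemma hom_zero [simp]: "\<phi> \<zero>\<^bsub>A\<^esub> = \<zero>\<^bsub>B\<^esub>"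
  using hom_scl[of "\<zero>\<^bsub>A\<^esub>" 0] by (simp del: hom_scl)

lemma hom_diff [simp]: "x \<in> carrier A \<Longrightarrow> y \<in> carrier A \<Longrightarrow> \<phi> (x \<ominus>\<^bsub>A\<^esub> y) = \<phi> x \<ominus>\<^bsub>B\<^esub> \<phi> y"
  by (simp add: a_minus_def A.scl_minus_one B.scl_minus_one)

lemma hom_finsum:
  assumes "finite S" "f \<in> S \<rightarrow> carrier A"
  shows "\<phi> (finsum A f S) = finsum B (\<lambda>i. \<phi> (f i)) S"
  using assms
proof (induction S rule: finite_induct)
  case (insert s S)
  then have "f s \<in> carrier A" "f \<in> S \<rightarrow> carrier A" by auto
  moreover from this have "(\<lambda>i. \<phi> (f i)) \<in> S \<rightarrow> carrier B" by auto
  ultimately show ?case using insert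
    by (simp add: A.finsum_insert B.finsum_insert A.finsum_closed)
qed simp

lemma hom_nat_pow [simp]: "x \<in> carrier A \<Longrightarrow> \<phi> (x [^]\<^bsub>A\<^esub> (n::nat)) = \<phi> x [^]\<^bsub>B\<^esub> n"
  by (induction n) simp_all

lemma hom_inv_Units:
  assumes x: "x \<in> Units A"
  shows "\<phi> x \<in> Units B \<and> inv\<^bsub>B\<^esub> (\<phi> x) = \<phi> (inv\<^bsub>A\<^esub> x)"
proof -
  have c: "x \<in> carrier A" "inv\<^bsub>A\<^esub> x \<in> carrier A" using x by auto
  have e: "\<phi> x \<otimes>\<^bsub>B\<^esub> \<phi> (inv\<^bsub>A\<^esub> x) = \<one>\<^bsub>B\<^esub>" "\<phi> (inv\<^bsub>A\<^esub> x) \<otimes>\<^bsub>B\<^esub> \<phi> x = \<one>\<^bsub>B\<^esub>"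
    using c x by (simp_all flip: hom_mult)
  then have u: "\<phi> x \<in> Units B" using c by (auto simp: Units_def)
  then show ?thesis
    using B.inv_unique[OF B.Units_l_inv[OF u] e(1)] c u by simp
qed

lemma hom_int_pow:
  assumes x: "x \<in> Units A" shows "\<phi> (x [^]\<^bsub>A\<^esub> (k::int)) = \<phi> x [^]\<^bsub>B\<^esub> k"
proof -
  have p: "\<phi> (x [^]\<^bsub>A\<^esub> n) = \<phi> x [^]\<^bsub>B\<^esub> n" for n :: nat using x by (intro hom_nat_pow) auto
  have i: "\<phi> (inv\<^bsub>A\<^esub> (x [^]\<^bsub>A\<^esub> n)) = inv\<^bsub>B\<^esub> (\<phi> x [^]\<^bsub>B\<^esub> n)" for n :: nat
    using hom_inv_Units[OF A.Units_nat_pow_Units[OF x, of n]] unfolding p by (elim conjE) (rule sym)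
  show ?thesis by (cases "k < 0") (simp_all only: int_pow_def2 p i if_True if_False)
qed

lemma hom_selfadjoint: "selfadjoint A x \<Longrightarrow> selfadjoint B (\<phi> x)"
  unfolding selfadjoint_def using hom_adj[of x] by simp

lemma hom_projection: "is_projection A p \<Longrightarrow> is_projection B (\<phi> p)"
  unfolding is_projection_def using hom_selfadjoint[of p] A.selfadjoint_closed[of p] hom_mult[of p p] by simp

lemma hom_alg_poly: "x \<in> carrier A \<Longrightarrow> \<phi> (alg_poly A p x) = alg_poly B p (\<phi> x)"
  by (induction p) (simp_all add: A.alg_poly_pCons B.alg_poly_pCons)

lemma hom_spectrum: "x \<in> carrier A \<Longrightarrow> alg_spectrum B (\<phi> x) \<subseteq> alg_spectrum A x"
  using hom_inv_Units[of "scl A z \<one>\<^bsub>A\<^esub> \<ominus>\<^bsub>A\<^esub> x" for z] by (auto simp: alg_spectrum_def)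

text \<open>A homomorphism can only shrink the spectrum, and the norm of a self-adjoint element is
  attained on its spectrum. The C*-identity reduces the general case to this one.\<close>

lemma hom_contractive:
  assumes x: "x \<in> carrier A" shows "cnorm B (\<phi> x) \<le> cnorm A x"
proof -
  have sa: "cnorm B (\<phi> y) \<le> cnorm A y" if y: "selfadjoint A y" for y
  proof (cases "\<phi> y = \<zero>\<^bsub>B\<^esub>")
    case True
    then show ?thesis using y by (simp add: A.cnorm_nonneg selfadjoint_def)
  next
    case False
    then obtain z where "z \<in> alg_spectrum B (\<phi> y)" "cmod z = cnorm B (\<phi> y)"
      using B.spectrum_attains_norm[OF hom_selfadjoint[OF y]] by blast
    then show ?thesis using A.cnorm_spectrum_le hom_spectrum A.selfadjoint_closed[OF y] by fastforce
  qed
  have "selfadjoint A (adj A x \<otimes>\<^bsub>A\<^esub> x)" using x by (simp add: selfadjoint_def A.adj_mult A.adj_adj)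
  from sa[OF this] have "(cnorm B (\<phi> x))\<^sup>2 \<le> (cnorm A x)\<^sup>2"
    using x by (simp add: A.cnorm_cstar B.cnorm_cstar)
  then show ?thesis using A.cnorm_nonneg[OF x] by (rule power2_le_imp_le)
qed

lemma hom_tracial_state:
  assumes \<tau>: "tracial_state B \<tau>" shows "tracial_state A (\<lambda>x. \<tau> (\<phi> x))"
  unfolding tracial_state_def complex_is_Real_iff
  by (auto simp: B.tracial_stateD(1-5)[OF \<tau>] intro: B.tracial_stateD(6)[OF \<tau>])

text \<open>Polynomials approximating the step function on the spectrum of e do so on the smaller
  spectrum of its image, and the homomorphism carries their values over by contractivity.\<close>

lemma hom_chi_half:
  assumes e: "selfadjoint A e" and c: "cnorm A (e \<otimes>\<^bsub>A\<^esub> e \<ominus>\<^bsub>A\<^esub> e) < 1/4"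
  shows "chi_half B (\<phi> e) = \<phi> (chi_half A e)"
proof -
  have ec: "e \<in> carrier A" using e by (rule A.selfadjoint_closed)
  obtain p where p: "uniform_limit (alg_spectrum A e) (\<lambda>k. poly (p k)) (\<lambda>z. if Re z > 1/2 then 1 else 0) sequentially"
    using A.chi_half_approx[OF e c] by blast
  then have p': "uniform_limit (alg_spectrum B (\<phi> e)) (\<lambda>k. poly (p k)) (\<lambda>z. if Re z > 1/2 then 1 else 0) sequentially"
    using hom_spectrum[OF ec] by (rule uniform_limit_on_subset)
  have cc: "chi_half A e \<in> carrier A"
    using A.chi_half_projection[OF e c] by (simp add: is_projection_def selfadjoint_def)
  have "(\<lambda>k. cnorm B (alg_poly B (p k) (\<phi> e) \<ominus>\<^bsub>B\<^esub> \<phi> (chi_half A e))) \<longlonglongrightarrow> 0"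
  proof (rule B.lim_comparison)
    show "cnorm B (alg_poly B (p k) (\<phi> e) \<ominus>\<^bsub>B\<^esub> \<phi> (chi_half A e)) \<le> cnorm A (alg_poly A (p k) e \<ominus>\<^bsub>A\<^esub> chi_half A e)" for k
      using hom_contractive[of "alg_poly A (p k) e \<ominus>\<^bsub>A\<^esub> chi_half A e"] ec cc by (simp add: hom_alg_poly)
  qed (use A.chi_half_lim[OF e p] ec cc in auto)
  then show ?thesis
    unfolding chi_half_def[of B] using cc
    by (intro B.cfc_eqI[OF hom_selfadjoint[OF e] _ p']) auto
qed

end

section \<open>Monomials and the elements e_I under homomorphisms\<close>

context unital_cstar_algebra
begin

lemma unitary_Units: "unitary_elem A u \<Longrightarrow> u \<in> Units A"
  by (auto simp: unitary_elem_def Units_def)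

lemma Units_int_pow_Units: "x \<in> Units A \<Longrightarrow> x [^] (k::int) \<in> Units A"
  by (cases "k < 0") (simp_all only: int_pow_def2 if_True if_False Units_nat_pow_Units Units_inv_Units)

lemma monomial_Nil [simp]: "monomial A u [] [] = \<one>"
  by (simp add: monomial_def)

lemma monomial_Cons [simp]: "monomial A u (i # I) (k # ks) = u i [^] k \<otimes> monomial A u I ks"
  by (simp add: monomial_def)

text \<open>Exponents may be negative and then refer to ring inverses, so the letters are required
  to be units.\<close>

lemma monomial_Units:
  "length ks = length I \<Longrightarrow> (\<And>i. i \<in> set I \<Longrightarrow> u i \<in> Units A) \<Longrightarrow> monomial A u I ks \<in> Units A"
  by (induction ks I rule: list_induct2) (simp_all add: Units_int_pow_Units)

lemma monomial_closed:
  "length ks = length I \<Longrightarrow> (\<And>i. i \<in> set I \<Longrightarrow> u i \<in> Units A) \<Longrightarrow> monomial A u I ks \<in> carrier A"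
  using monomial_Units by blast

lemma finite_exponents: "finite {ks. length ks = l \<and> set ks \<subseteq> {- int N..int N}}"
  using finite_lists_length_eq[of "{- int N..int N}" l] by (simp add: conj_commute)

lemma S_elem_closed:
  "(\<And>i. i \<in> set I \<Longrightarrow> u i \<in> Units A) \<Longrightarrow> S_elem A a N I u \<in> carrier A"
  unfolding S_elem_def by (intro finsum_closed) (auto intro!: scl_closed monomial_closed)

lemma e_elem_selfadjoint:
  "(\<And>i. i \<in> set I \<Longrightarrow> u i \<in> Units A) \<Longrightarrow> selfadjoint A (e_elem A a N I u)"
  using S_elem_closed[of I u a N]
  by (simp add: e_elem_def selfadjoint_def adj_scl adj_add adj_adj a_comm)

lemma e_elem_closed:
  "(\<And>i. i \<in> set I \<Longrightarrow> u i \<in> Units A) \<Longrightarrow> e_elem A a N I u \<in> carrier A"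
  using e_elem_selfadjoint selfadjoint_closed by blast

end

context unital_cstar_hom
begin

lemma hom_monomial:
  "length ks = length I \<Longrightarrow> (\<And>i. i \<in> set I \<Longrightarrow> u i \<in> Units A) \<Longrightarrow>
    \<phi> (monomial A u I ks) = monomial B (\<lambda>i. \<phi> (u i)) I ks"
  by (induction ks I rule: list_induct2)
    (simp_all add: hom_int_pow A.Units_int_pow_Units A.Units_closed A.monomial_closed)

lemma hom_S_elem:
  assumes "\<And>i. i \<in> set I \<Longrightarrow> u i \<in> Units A"
  shows "\<phi> (S_elem A a N I u) = S_elem B a N I (\<lambda>i. \<phi> (u i))"
proof -
  let ?S = "{ks. length ks = length I \<and> set ks \<subseteq> {- int N..int N}}"
  have "\<phi> (S_elem A a N I u) = finsum B (\<lambda>ks. \<phi> (scl A (a I ks) (monomial A u I ks))) ?S"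
    unfolding S_elem_def using assms
    by (intro hom_finsum A.finite_exponents) (auto intro!: A.scl_closed A.monomial_closed)
  also have "\<dots> = S_elem B a N I (\<lambda>i. \<phi> (u i))"
    unfolding S_elem_def using assms hom_inv_Units
    by (intro B.finsum_cong') (auto simp: hom_monomial A.monomial_closed intro!: B.scl_closed B.monomial_closed)
  finally show ?thesis .
qed

lemma hom_e_elem:
  assumes "\<And>i. i \<in> set I \<Longrightarrow> u i \<in> Units A"
  shows "\<phi> (e_elem A a N I u) = e_elem B a N I (\<lambda>i. \<phi> (u i))"
  using A.S_elem_closed[OF assms, of I] hom_S_elem[OF assms, of I] by (simp add: e_elem_def)

end

section \<open>Traces on the noncommutative torus\<close>

text \<open>The two permutations contribute \<open>B $$ (0, 1)\<close> and
  \<open>- B $$ (1, 0)\<close>, which agree by skewness; their sum is divided by 2.\<close>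

lemma pf_2:
  fixes B :: "real mat"
  assumes "dim_row B = 2" and skew: "B $$ (1, 0) = - B $$ (0, 1)"
  shows "pf B = B $$ (0, 1)"
proof -
  have "{..<2::nat} = {0, 1}" by auto
  then have perms: "{\<sigma>. \<sigma> permutes {..<2::nat}} = {id, Transposition.transpose 0 1}"
    by (auto simp: permutes_doubleton_iff)
  have "id \<noteq> Transposition.transpose (0::nat) 1"
    by (metis id_apply transpose_apply_first zero_neq_one)
  then show ?thesis
    unfolding pf_def Let_def assms(1) using skew by (simp add: perms sign_swap_id)
qed

lemma pf_minor_pair:
  assumes "\<Theta> $$ (j, i) = - \<Theta> $$ (i, j)" shows "pf (minor_mat \<Theta> [i, j]) = \<Theta> $$ (i, j)"
  by (subst pf_2) (use assms in \<open>auto simp: minor_mat_def\<close>)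

lemma finite_even_tuples: "finite (even_tuples n)"
proof (rule finite_subset)
  show "even_tuples n \<subseteq> {I. set I \<subseteq> {..<n} \<and> length I \<le> n}"
  proof
    fix I assume "I \<in> even_tuples n"
    then have "distinct I" "set I \<subseteq> {..<n}"
      by (auto simp: even_tuples_def strict_sorted_iff)
    then show "I \<in> {I. set I \<subseteq> {..<n} \<and> length I \<le> n}"
      using card_mono[of "{..<n}" "set I"] by (simp add: distinct_card)
  qed
qed (intro finite_lists_length_le, simp)

lemma skew_entry:
  assumes "\<Theta> \<in> carrier_mat n n" "transpose_mat \<Theta> = - \<Theta>" "i < n" "j < n"
  shows "\<Theta> $$ (j, i) = - (\<Theta> $$ (i, j) :: real)"
proof -
  have "transpose_mat \<Theta> $$ (i, j) = (- \<Theta>) $$ (i, j)" by (simp only: assms(2))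
  then show ?thesis using assms(1,3,4) by simp
qed

text \<open>Only the Pfaffians of the index pairs containing \<open>j\<close> enter, and these are the entries \<open>\<plusminus>\<theta>\<^sub>i\<^sub>j\<close>.\<close>

lemma totally_irrational_nondegenerate:
  fixes \<kappa> :: "nat \<Rightarrow> int"
  assumes irr: "totally_irrational n \<Theta>"
    and skew: "\<And>i j. i < n \<Longrightarrow> j < n \<Longrightarrow> \<Theta> $$ (j, i) = - \<Theta> $$ (i, j)"
    and S: "S \<subseteq> {..<n}" and ij: "i0 \<in> S" "j \<in> S" "i0 \<noteq> j" and \<kappa>: "\<kappa> i0 \<noteq> 0"
  shows "(\<Sum>i\<in>S. of_int (\<kappa> i) * \<Theta> $$ (i, j)) \<noteq> of_int m"
proof
  assume eq: "(\<Sum>i\<in>S. of_int (\<kappa> i) * \<Theta> $$ (i, j)) = of_int m"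
  have fS: "finite S" using S finite_subset by blast
  define g where "g i = (if i < j then [i, j] else [j, i])" for i
  define S' where "S' = S - {j}"
  have inj: "inj_on g S'" by (auto simp: inj_on_def g_def split: if_splits)
  \<comment> \<open>The pair is listed in increasing order, so for i > j its Pfaffian is the entry
    (j, i), which is minus the entry (i, j); the coefficient changes sign accordingly.\<close>
  define c :: "nat list \<Rightarrow> rat" where "c L = (if L \<in> g ` S' then
     (let i = inv_into S' g L in if i < j then of_int (\<kappa> i) else - of_int (\<kappa> i)) else 0)" for L
  have cg: "c (g i) = (if i < j then of_int (\<kappa> i) else - of_int (\<kappa> i))" if "i \<in> S'" for i
    using that inj by (simp add: c_def)
  have sub: "g ` S' \<subseteq> even_tuples n"
    using S ij by (auto simp: g_def S'_def even_tuples_def)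
  have "(\<Sum>I\<in>even_tuples n. of_rat (c I) * pf (minor_mat \<Theta> I)) = (\<Sum>I\<in>g ` S'. of_rat (c I) * pf (minor_mat \<Theta> I))"
    by (rule sum.mono_neutral_right) (use sub in \<open>auto simp: finite_even_tuples c_def\<close>)
  also have "\<dots> = (\<Sum>i\<in>S'. of_rat (c (g i)) * pf (minor_mat \<Theta> (g i)))"
    by (simp add: sum.reindex[OF inj])
  also have "\<dots> = (\<Sum>i\<in>S'. of_int (\<kappa> i) * \<Theta> $$ (i, j))"
  proof (rule sum.cong)
    fix i assume i: "i \<in> S'"
    then have l: "i < n" "j < n" using S ij by (auto simp: S'_def)
    show "of_rat (c (g i)) * pf (minor_mat \<Theta> (g i)) = of_int (\<kappa> i) * \<Theta> $$ (i, j)"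
      using pf_minor_pair[OF skew[OF l(1) l(2)]] pf_minor_pair[OF skew[OF l(2) l(1)]] skew[OF l(1) l(2)]
      unfolding cg[OF i] unfolding g_def by (simp add: of_rat_minus)
  qed simp
  \<comment> \<open>The diagonal entry (j, j) is 0 by skewness, so the index j may be put back
    whatever \<open>\<kappa> j\<close> is.\<close>
  also have "\<dots> = (\<Sum>i\<in>S. of_int (\<kappa> i) * \<Theta> $$ (i, j))"
    using skew[of j j] S ij fS by (simp add: S'_def sum.remove[of S j] subset_iff)
  finally have "of_rat (of_int (- m)) + (\<Sum>I\<in>even_tuples n. of_rat (c I) * pf (minor_mat \<Theta> I)) = 0"
    using eq by (simp add: of_rat_minus)
  then have "\<forall>I\<in>even_tuples n. c I = 0"
    using irr unfolding totally_irrational_def by blast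
  moreover have "i0 \<in> S'" using ij by (simp add: S'_def)
  ultimately have "c (g i0) = 0" using sub by blast
  then show False using cg[OF \<open>i0 \<in> S'\<close>] \<kappa> by (auto split: if_splits)
qed

section \<open>Commutation up to a phase and tracial states on monomials\<close>

context unital_cstar_algebra
begin

lemma twisted_nat_pow:
  assumes "y \<in> carrier A" "w \<in> carrier A" "y \<otimes> w = scl A c (w \<otimes> y)"
  shows "y \<otimes> w [^] (n::nat) = scl A (c ^ n) (w [^] n \<otimes> y)"
proof (induction n)
  case (Suc n)
  have "y \<otimes> w [^] Suc n = (y \<otimes> w [^] n) \<otimes> w" using assms by (simp add: m_assoc)
  also have "\<dots> = scl A (c ^ n) (w [^] n \<otimes> (y \<otimes> w))"
    using assms(1,2) by (simp add: Suc scl_mult_left m_assoc)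
  also have "\<dots> = scl A (c ^ Suc n) (w [^] Suc n \<otimes> y)"
    using assms by (simp add: scl_mult_right scl_scl m_assoc mult.commute)
  finally show ?case .
qed (use assms in \<open>simp add: scl_one\<close>)

lemma twisted_inv:
  assumes y: "y \<in> carrier A" and w: "w \<in> Units A" and c: "c \<noteq> 0" and e: "y \<otimes> w = scl A c (w \<otimes> y)"
  shows "y \<otimes> inv w = scl A (1 / c) (inv w \<otimes> y)"
proof -
  have wc: "w \<in> carrier A" "inv w \<in> carrier A" using w by auto
  have "inv w \<otimes> y = inv w \<otimes> (y \<otimes> w) \<otimes> inv w"
    using y w wc by (simp add: m_assoc)
  also have "\<dots> = scl A c (inv w \<otimes> w \<otimes> y \<otimes> inv w)"
    unfolding e using y wc by (simp only: scl_mult_left scl_mult_right m_closed m_assoc)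
  also have "\<dots> = scl A c (y \<otimes> inv w)" using y w wc by simp
  finally show ?thesis using y wc c by (simp add: scl_scl scl_one)
qed

lemma twisted_int_pow:
  assumes y: "y \<in> carrier A" and w: "w \<in> Units A" and c: "c \<noteq> 0" and e: "y \<otimes> w = scl A c (w \<otimes> y)"
  shows "y \<otimes> w [^] (k::int) = scl A (c powi k) (w [^] k \<otimes> y)"
proof (cases "k < 0")
  case True
  have "y \<otimes> inv (w [^] (nat (- k))) = scl A (1 / c ^ nat (- k)) (inv (w [^] (nat (- k))) \<otimes> y)"
    using y w c e by (intro twisted_inv twisted_nat_pow Units_nat_pow_Units) auto
  moreover have "1 / c ^ nat (- k) = c powi k" using True by (simp add: power_int_def field_simps)
  ultimately show ?thesis using True by (simp only: int_pow_def2 if_True)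
next
  case False
  then have "c ^ nat k = c powi k" by (simp add: power_int_def)
  then show ?thesis
    using twisted_nat_pow[OF y Units_closed[OF w] e, of "nat k"] False by (simp only: int_pow_def2 if_False)
qed

lemma twisted_monomial:
  assumes "length ks = length I" and y: "y \<in> carrier A"
    and "\<And>i. i \<in> set I \<Longrightarrow> u i \<in> Units A" "\<And>i. i \<in> set I \<Longrightarrow> c i \<noteq> 0"
    "\<And>i. i \<in> set I \<Longrightarrow> y \<otimes> u i = scl A (c i) (u i \<otimes> y)"
  shows "y \<otimes> monomial A u I ks = scl A (prod_list (map2 (\<lambda>i k. c i powi k) I ks)) (monomial A u I ks \<otimes> y)"
  using assms
proof (induction ks I rule: list_induct2)
  case (Cons k ks i I)
  let ?p = "prod_list (map2 (\<lambda>i k. c i powi k) I ks)"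
  let ?w = "u i [^] k" and ?m = "monomial A u I ks"
  have IH: "y \<otimes> ?m = scl A ?p (?m \<otimes> y)" using Cons by simp
  have c: "?w \<in> carrier A" "?m \<in> carrier A"
    using Cons monomial_closed[of ks I u] Units_int_pow_Units[of "u i" k] by (auto simp: Units_closed)
  have "y \<otimes> (?w \<otimes> ?m) = (y \<otimes> ?w) \<otimes> ?m" using y c by (simp add: m_assoc)
  also have "y \<otimes> ?w = scl A (c i powi k) (?w \<otimes> y)" using Cons by (intro twisted_int_pow) auto
  also have "\<dots> \<otimes> ?m = scl A (c i powi k) (?w \<otimes> (y \<otimes> ?m))" using y c by (simp add: scl_mult_left m_assoc)
  also have "\<dots> = scl A (c i powi k * ?p) ((?w \<otimes> ?m) \<otimes> y)"
    unfolding IH using y c by (simp add: scl_mult_right scl_scl m_assoc)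
  finally show ?case by simp
qed (simp add: scl_one)

text \<open>A trace does not change under conjugation by the unitary y, whereas the relation
  multiplies m by c.\<close>

lemma tracial_state_twisted:
  assumes \<tau>: "tracial_state A \<tau>" and y: "unitary_elem A y" and m: "m \<in> carrier A"
    and e: "y \<otimes> m = scl A c (m \<otimes> y)" and c: "c \<noteq> 1"
  shows "\<tau> m = 0"
proof -
  have yc: "y \<in> carrier A" "adj A y \<in> carrier A" "adj A y \<otimes> y = \<one>" "y \<otimes> adj A y = \<one>"
    using y by (auto simp: unitary_elem_def)
  have "\<tau> m = \<tau> (adj A y \<otimes> (y \<otimes> m))" using yc m by (simp flip: m_assoc)
  also have "\<dots> = c * \<tau> (adj A y \<otimes> (m \<otimes> y))"
    unfolding e using yc m by (simp add: scl_mult_right tracial_stateD(2)[OF \<tau>])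
  also have "\<tau> (adj A y \<otimes> (m \<otimes> y)) = \<tau> ((m \<otimes> y) \<otimes> adj A y)"
    using yc m by (intro tracial_stateD(6)[OF \<tau>]) auto
  also have "(m \<otimes> y) \<otimes> adj A y = m" using yc m by (simp add: m_assoc)
  finally show ?thesis using c by simp
qed

lemma tracial_state_finsum:
  assumes \<tau>: "tracial_state A \<tau>" and "finite S" "f \<in> S \<rightarrow> carrier A"
  shows "\<tau> (finsum A f S) = (\<Sum>i\<in>S. \<tau> (f i))"
  using assms(2,3)
proof (induction S rule: finite_induct)
  case empty
  show ?case using tracial_stateD(2)[OF \<tau>, of \<zero> 0] by simp
next
  case (insert s S)
  then have "f s \<in> carrier A" "f \<in> S \<rightarrow> carrier A" by auto
  then show ?case using insert by (simp add: finsum_insert finsum_closed tracial_stateD(1)[OF \<tau>])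
qed

text \<open>The generator with index j commutes with the monomial up to exp(2 pi i s), where s is
  the sum of the exponents weighted by column j of \<Theta>. An integer s is excluded once some
  index other than j has a nonzero exponent.\<close>

lemma torus_monomial_trace:
  assumes \<tau>: "tracial_state A \<tau>" and irr: "totally_irrational n \<Theta>"
    and skew: "\<And>i j. i < n \<Longrightarrow> j < n \<Longrightarrow> \<Theta> $$ (j, i) = - \<Theta> $$ (i, j)"
    and rel: "nc_torus_relations n \<Theta> A u" and I: "I \<in> even_tuples n"
    and len: "length ks = length I" and nz: "\<exists>k\<in>set ks. k \<noteq> 0"
  shows "\<tau> (monomial A u I ks) = 0"
proof -
  have "even (length I)" "0 < length I" using I by (simp_all add: even_tuples_def)
  then have "length I > 1" by presburger
  then have dI: "distinct I" "set I \<subseteq> {..<n}" "length I > 1"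
    using I by (simp_all add: even_tuples_def strict_sorted_iff)
  have U: "unitary_elem A (u i)" if "i \<in> set I" for i
    using rel that dI by (auto simp: nc_torus_relations_def)
  define \<kappa> where "\<kappa> i = the (map_of (zip I ks) i)" for i
  have \<kappa>: "\<kappa> (I ! r) = ks ! r" if "r < length I" for r
    using that dI len by (simp add: \<kappa>_def map_of_zip_nth)
  have ks: "ks = map \<kappa> I" using len \<kappa> by (intro nth_equalityI) auto
  then obtain i0 where i0: "i0 \<in> set I" "\<kappa> i0 \<noteq> 0" using nz by auto
  \<comment> \<open>A positive even length is at least 2, so I contains an index besides
    \<open>i0\<close>. The generator \<open>u i0\<close> itself would not detect its own
    powers.\<close>
  have "card (set I) > 1" using dI by (simp add: distinct_card)
  then have "\<not> set I \<subseteq> {i0}" using card_mono[of "{i0}" "set I"] by auto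
  then obtain j where j: "j \<in> set I" "i0 \<noteq> j" by blast
  define s where "s = (\<Sum>i\<in>set I. of_int (\<kappa> i) * \<Theta> $$ (i, j))"
  have tw: "twist \<Theta> i j \<noteq> 0" for i by (simp add: twist_def)
  have pow: "twist \<Theta> i j powi k = exp (2 * of_real pi * \<i> * of_real (of_int k * \<Theta> $$ (i, j)))" for i k
    by (simp add: twist_def exp_power_int mult_ac)
  have "prod_list (map2 (\<lambda>i k. twist \<Theta> i j powi k) I ks) = (\<Prod>i\<in>set I. twist \<Theta> i j powi \<kappa> i)"
    using dI(1) by (simp add: ks zip_map2 zip_same_conv_map comp_def prod.distinct_set_conv_list)
  also have "\<dots> = exp (2 * of_real pi * \<i> * of_real s)"
    by (simp add: pow s_def exp_sum sum_distrib_left)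
  finally have prod: "prod_list (map2 (\<lambda>i k. twist \<Theta> i j powi k) I ks) = exp (2 * of_real pi * \<i> * of_real s)" .
  have "exp (2 * of_real pi * \<i> * of_real s) \<noteq> 1"
  proof
    assume "exp (2 * of_real pi * \<i> * of_real s) = 1"
    then obtain m :: int where "2 * pi * s = of_int (2 * m) * pi" by (auto simp: exp_eq_1)
    then have "s = of_int m" by simp
    then show False
      using totally_irrational_nondegenerate[OF irr skew dI(2) i0(1) j(1) j(2), of \<kappa> m] i0 by (simp add: s_def)
  qed
  moreover have "u j \<otimes> monomial A u I ks =
      scl A (exp (2 * of_real pi * \<i> * of_real s)) (monomial A u I ks \<otimes> u j)"
    unfolding prod[symmetric]
  proof (rule twisted_monomial[OF len])
    fix i assume "i \<in> set I"
    then show "u j \<otimes> u i = scl A (twist \<Theta> i j) (u i \<otimes> u j)"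
      using rel dI j by (auto simp: nc_torus_relations_def)
  qed (use U j tw unitary_Units unitary_closed in auto)
  ultimately show ?thesis
    using U j len unitary_Units by (intro tracial_state_twisted[OF \<tau> U[OF j(1)]] monomial_closed) auto
qed

lemma monomial_zero: "monomial A u I (replicate (length I) 0) = \<one>"
  by (induction I) (simp_all add: int_pow_def)

text \<open>The zero exponent lies in the box of every size N, so the value does not depend on
  N.\<close>

lemma torus_S_elem_trace:
  assumes \<tau>: "tracial_state A \<tau>" and irr: "totally_irrational n \<Theta>"
    and skew: "\<And>i j. i < n \<Longrightarrow> j < n \<Longrightarrow> \<Theta> $$ (j, i) = - \<Theta> $$ (i, j)"
    and rel: "nc_torus_relations n \<Theta> A u" and I: "I \<in> even_tuples n"
  shows "\<tau> (S_elem A a N I u) = a I (replicate (length I) 0)"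
proof -
  let ?S = "{ks. length ks = length I \<and> set ks \<subseteq> {- int N..int N}}"
  let ?z = "replicate (length I) (0::int)"
  have U: "u i \<in> Units A" if "i \<in> set I" for i
    using rel that I unitary_Units by (auto simp: nc_torus_relations_def even_tuples_def)
  have mc: "monomial A u I ks \<in> carrier A" if "ks \<in> ?S" for ks
    using that U by (intro monomial_closed) auto
  have "\<tau> (S_elem A a N I u) = (\<Sum>ks\<in>?S. \<tau> (scl A (a I ks) (monomial A u I ks)))"
    unfolding S_elem_def using mc by (intro tracial_state_finsum[OF \<tau>] finite_exponents) auto
  also have "\<dots> = (\<Sum>ks\<in>{?z}. \<tau> (scl A (a I ks) (monomial A u I ks)))"
  proof (rule sum.mono_neutral_right[OF finite_exponents])
    show "\<forall>ks\<in>?S - {?z}. \<tau> (scl A (a I ks) (monomial A u I ks)) = 0"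
    proof
      fix ks assume ks: "ks \<in> ?S - {?z}"
      then have "\<exists>k\<in>set ks. k \<noteq> 0" using replicate_length_same[of ks 0] by auto
      then have "\<tau> (monomial A u I ks) = 0"
        using ks by (intro torus_monomial_trace[OF \<tau> irr skew rel I]) auto
      then show "\<tau> (scl A (a I ks) (monomial A u I ks)) = 0"
        using mc ks by (simp add: tracial_stateD(2)[OF \<tau>])
    qed
  qed auto
  also have "\<dots> = a I ?z"
    by (simp add: monomial_zero tracial_stateD(2)[OF \<tau>] tracial_stateD(5)[OF \<tau>])
  finally show ?thesis .
qed

lemma tracial_state_lim:
  assumes \<tau>: "tracial_state A \<tau>" and X: "\<And>i. X i \<in> carrier A" "x \<in> carrier A"
    and l: "(\<lambda>i. cnorm A (x \<ominus> X i)) \<longlonglongrightarrow> 0"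
  shows "(\<lambda>i. \<tau> (X i)) \<longlonglongrightarrow> \<tau> x"
proof (rule LIM_zero_cancel, rule Lim_null_comparison)
  show "\<forall>\<^sub>F i in sequentially. norm (\<tau> (X i) - \<tau> x) \<le> 2 * cnorm A (x \<ominus> X i)"
    using tracial_state_bounded[OF \<tau>, of "x \<ominus> X i" for i] X
    by (intro always_eventually allI) (simp add: tracial_state_diff[OF \<tau>] norm_minus_commute)
  show "(\<lambda>i. 2 * cnorm A (x \<ominus> X i)) \<longlonglongrightarrow> 0" using tendsto_mult_right_zero[OF l] .
qed

text \<open>The traces of the truncations are constant, and tracial states are continuous. The value
  depends only on the coefficients, which makes all tracial states agree at P.\<close>

lemma torus_expansion_trace:
  assumes \<tau>: "tracial_state A \<tau>" and irr: "totally_irrational n \<Theta>"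
    and skew: "\<And>i j. i < n \<Longrightarrow> j < n \<Longrightarrow> \<Theta> $$ (j, i) = - \<Theta> $$ (i, j)"
    and rel: "nc_torus_relations n \<Theta> A u" and I: "I \<in> even_tuples n"
    and P: "P \<in> carrier A" "(\<lambda>M. cnorm A (P \<ominus> S_elem A a M I u)) \<longlonglongrightarrow> 0"
  shows "\<tau> P = a I (replicate (length I) 0)"
proof -
  have "u i \<in> Units A" if "i \<in> set I" for i
    using rel that I unitary_Units by (auto simp: nc_torus_relations_def even_tuples_def)
  then have "S_elem A a M I u \<in> carrier A" for M by (rule S_elem_closed)
  from tracial_state_lim[OF \<tau> this P] show ?thesis
    by (simp add: torus_S_elem_trace[OF \<tau> irr skew rel I] LIMSEQ_const_iff)
qed

subsection \<open>Perturbation of the generators\<close>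

lemma unitary_one: "unitary_elem A \<one>"
  by (simp add: unitary_elem_def)

lemma unitary_mult:
  assumes "unitary_elem A u" "unitary_elem A v" shows "unitary_elem A (u \<otimes> v)"
proof -
  have c: "u \<in> carrier A" "v \<in> carrier A" "adj A u \<otimes> u = \<one>" "u \<otimes> adj A u = \<one>"
    "adj A v \<otimes> v = \<one>" "v \<otimes> adj A v = \<one>"
    using assms by (auto simp: unitary_elem_def)
  have "adj A v \<otimes> adj A u \<otimes> (u \<otimes> v) = adj A v \<otimes> (adj A u \<otimes> u) \<otimes> v"
    using c(1,2) by (simp add: m_assoc)
  moreover have "u \<otimes> v \<otimes> (adj A v \<otimes> adj A u) = u \<otimes> (v \<otimes> adj A v) \<otimes> adj A u"
    using c(1,2) by (simp add: m_assoc)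
  ultimately show ?thesis using c by (simp add: unitary_elem_def adj_mult)
qed

lemma unitary_inv:
  assumes "unitary_elem A u" shows "inv u = adj A u"
  by (rule inv_unique[OF Units_l_inv[OF unitary_Units[OF assms]]])
    (use assms unitary_Units[OF assms] in \<open>auto simp: unitary_elem_def\<close>)

lemma unitary_adj: "unitary_elem A u \<Longrightarrow> unitary_elem A (adj A u)"
  by (simp add: unitary_elem_def adj_adj)

lemma unitary_nat_pow: "unitary_elem A u \<Longrightarrow> unitary_elem A (u [^] (n::nat))"
  by (induction n) (simp_all add: unitary_one unitary_mult)

lemma unitary_int_pow: "unitary_elem A u \<Longrightarrow> unitary_elem A (u [^] (k::int))"
  using unitary_nat_pow[of u "nat k"] unitary_nat_pow[of u "nat (- k)"] unitary_inv unitary_adj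
  by (cases "k < 0") (simp_all only: int_pow_def2 if_True if_False)

lemma unitary_monomial:
  "length ks = length I \<Longrightarrow> (\<And>i. i \<in> set I \<Longrightarrow> unitary_elem A (u i)) \<Longrightarrow> unitary_elem A (monomial A u I ks)"
  by (induction ks I rule: list_induct2) (simp_all add: unitary_one unitary_mult unitary_int_pow)

lemma unitary_nat_pow_diff:
  assumes u: "unitary_elem A u" and v: "unitary_elem A v"
  shows "cnorm A (u [^] (n::nat) \<ominus> v [^] n) \<le> n * cnorm A (u \<ominus> v)"
proof (induction n)
  case (Suc n)
  have c: "u \<in> carrier A" "v \<in> carrier A" using u v by (simp_all add: unitary_closed)
  have "cnorm A (u [^] Suc n \<ominus> v [^] Suc n)
      \<le> cnorm A (u [^] n \<ominus> v [^] n) * cnorm A u + cnorm A (v [^] n) * cnorm A (u \<ominus> v)"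
    using c by (simp add: cnorm_mult_diff)
  also have "\<dots> \<le> (n * cnorm A (u \<ominus> v)) * 1 + 1 * cnorm A (u \<ominus> v)"
    using Suc c cnorm_unitary[OF u] cnorm_unitary[OF unitary_nat_pow[OF v, of n]]
    by (intro add_mono mult_mono mult_nonneg_nonneg) (auto simp: cnorm_nonneg)
  finally show ?case by (simp add: algebra_simps)
qed (simp add: a_minus_def r_neg)

text \<open>For negative exponents the inverse of a unitary is its adjoint, and taking adjoints is
  isometric.\<close>

lemma unitary_int_pow_diff:
  assumes u: "unitary_elem A u" and v: "unitary_elem A v"
  shows "cnorm A (u [^] (k::int) \<ominus> v [^] k) \<le> \<bar>of_int k\<bar> * cnorm A (u \<ominus> v)"
proof (cases "k < 0")
  case True
  define n where "n = nat (- k)"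
  have c: "u [^] n \<in> carrier A" "v [^] n \<in> carrier A" using u v by (simp_all add: unitary_closed)
  have "u [^] k \<ominus> v [^] k = adj A (u [^] n) \<ominus> adj A (v [^] n)"
    using True unitary_inv[OF unitary_nat_pow[OF u, of n]] unitary_inv[OF unitary_nat_pow[OF v, of n]]
    by (simp only: int_pow_def2 if_True n_def)
  also have "\<dots> = adj A (u [^] n \<ominus> v [^] n)" using c by (simp add: adj_diff)
  finally show ?thesis
    using unitary_nat_pow_diff[OF u v, of n] c True by (simp add: n_def)
next
  case False
  then have "u [^] k \<ominus> v [^] k = u [^] nat k \<ominus> v [^] nat k" by (simp only: int_pow_def2 if_False)
  then show ?thesis using unitary_nat_pow_diff[OF u v, of "nat k"] False by simp
qed

text \<open>Letters are exchanged one at a time; all remaining factors are unitary and have norm at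
  most 1.\<close>

lemma unitary_monomial_diff:
  assumes "length ks = length I"
    and "\<And>i. i \<in> set I \<Longrightarrow> unitary_elem A (u i)" "\<And>i. i \<in> set I \<Longrightarrow> unitary_elem A (v i)"
    and "\<And>i. i \<in> set I \<Longrightarrow> cnorm A (u i \<ominus> v i) \<le> d"
  shows "cnorm A (monomial A u I ks \<ominus> monomial A v I ks) \<le> sum_list (map (\<lambda>k. \<bar>of_int k\<bar>) ks) * d"
  using assms
proof (induction ks I rule: list_induct2)
  case (Cons k ks i I)
  let ?mu = "monomial A u I ks" and ?mv = "monomial A v I ks"
  have U: "unitary_elem A (u i)" "unitary_elem A (v i)" "unitary_elem A (u i [^] k)" "unitary_elem A (v i [^] k)"
    "unitary_elem A ?mu" "unitary_elem A ?mv"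
    using Cons by (auto intro: unitary_monomial unitary_int_pow)
  have c: "u i [^] k \<in> carrier A" "v i [^] k \<in> carrier A" "?mu \<in> carrier A" "?mv \<in> carrier A"
    using U by (simp_all add: unitary_closed)
  have IH: "cnorm A (?mu \<ominus> ?mv) \<le> sum_list (map (\<lambda>k. \<bar>of_int k\<bar>) ks) * d" using Cons by simp
  have "cnorm A (u i [^] k \<ominus> v i [^] k) \<le> \<bar>of_int k\<bar> * cnorm A (u i \<ominus> v i)"
    using U by (intro unitary_int_pow_diff)
  also have "\<dots> \<le> \<bar>of_int k\<bar> * d" using Cons by (intro mult_left_mono) auto
  finally have k: "cnorm A (u i [^] k \<ominus> v i [^] k) \<le> \<bar>of_int k\<bar> * d" .
  have "cnorm A (u i [^] k \<otimes> ?mu \<ominus> v i [^] k \<otimes> ?mv)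
      \<le> cnorm A (u i [^] k \<ominus> v i [^] k) * cnorm A ?mu + cnorm A (v i [^] k) * cnorm A (?mu \<ominus> ?mv)"
    using c by (intro cnorm_mult_diff)
  also have "\<dots> \<le> cnorm A (u i [^] k \<ominus> v i [^] k) * 1 + 1 * cnorm A (?mu \<ominus> ?mv)"
    using c U by (intro add_mono mult_mono) (auto simp: cnorm_nonneg cnorm_unitary)
  finally show ?case using k IH by (simp add: algebra_simps)
qed (simp add: a_minus_def r_neg)

lemma cnorm_finsum_diff:
  assumes "finite S" "f \<in> S \<rightarrow> carrier A" "g \<in> S \<rightarrow> carrier A"
  shows "cnorm A (finsum A f S \<ominus> finsum A g S) \<le> (\<Sum>i\<in>S. cnorm A (f i \<ominus> g i))"
  using assms
proof (induction S rule: finite_induct)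
  case (insert s S)
  then have c: "f s \<in> carrier A" "g s \<in> carrier A" "f \<in> S \<rightarrow> carrier A" "g \<in> S \<rightarrow> carrier A" by auto
  then have c': "finsum A f S \<in> carrier A" "finsum A g S \<in> carrier A" by (simp_all add: finsum_closed)
  have "(f s \<oplus> finsum A f S) \<ominus> (g s \<oplus> finsum A g S) = (f s \<ominus> g s) \<oplus> (finsum A f S \<ominus> finsum A g S)"
    using c c' by (simp add: a_minus_def minus_add a_ac)
  then show ?case
    using insert c c' cnorm_triangle[of "f s \<ominus> g s" "finsum A f S \<ominus> finsum A g S"]
    by (simp add: finsum_insert)
qed (simp add: a_minus_def r_neg)

end

text \<open>A monomial in unitaries is Lipschitz with constant the sum of the absolute values of its
  exponents; here these constants are weighted by the coefficients.\<close>

definition S_lipschitz :: "(nat list \<Rightarrow> int list \<Rightarrow> complex) \<Rightarrow> nat \<Rightarrow> nat list \<Rightarrow> real" where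
  "S_lipschitz a N I = (\<Sum>ks\<in>{ks. length ks = length I \<and> set ks \<subseteq> {- int N..int N}}.
     cmod (a I ks) * sum_list (map (\<lambda>k. \<bar>of_int k\<bar>) ks))"

lemma S_lipschitz_nonneg: "0 \<le> S_lipschitz a N I"
  unfolding S_lipschitz_def by (intro sum_nonneg mult_nonneg_nonneg sum_list_nonneg) auto

context unital_cstar_algebra
begin

text \<open>Averaging with the adjoint does not increase the constant found for the truncated
  series.\<close>

lemma e_elem_lipschitz:
  assumes "\<And>i. i \<in> set I \<Longrightarrow> unitary_elem A (u i)" "\<And>i. i \<in> set I \<Longrightarrow> unitary_elem A (v i)"
    and "\<And>i. i \<in> set I \<Longrightarrow> cnorm A (u i \<ominus> v i) \<le> d"
  shows "cnorm A (e_elem A a N I u \<ominus> e_elem A a N I v) \<le> S_lipschitz a N I * d"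
proof -
  let ?S = "{ks. length ks = length I \<and> set ks \<subseteq> {- int N..int N}}"
  have U: "u i \<in> Units A" "v i \<in> Units A" if "i \<in> set I" for i
    using assms that by (auto intro: unitary_Units)
  have mc: "monomial A u I ks \<in> carrier A" "monomial A v I ks \<in> carrier A" if "length ks = length I" for ks
    using that U by (auto intro: monomial_closed)
  define X Y where "X = S_elem A a N I u" and "Y = S_elem A a N I v"
  have c: "X \<in> carrier A" "Y \<in> carrier A" using U by (auto simp: X_def Y_def intro: S_elem_closed)
  have "cnorm A (X \<ominus> Y) \<le> (\<Sum>ks\<in>?S. cnorm A (scl A (a I ks) (monomial A u I ks) \<ominus> scl A (a I ks) (monomial A v I ks)))"
    unfolding X_def Y_def S_elem_def using mc by (intro cnorm_finsum_diff finite_exponents) auto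
  also have "\<dots> \<le> (\<Sum>ks\<in>?S. cmod (a I ks) * sum_list (map (\<lambda>k. \<bar>of_int k\<bar>) ks) * d)"
  proof (rule sum_mono)
    fix ks assume "ks \<in> ?S"
    then have l: "length ks = length I" by simp
    have "cnorm A (scl A (a I ks) (monomial A u I ks) \<ominus> scl A (a I ks) (monomial A v I ks))
        = cmod (a I ks) * cnorm A (monomial A u I ks \<ominus> monomial A v I ks)"
      using mc[OF l] by (simp add: cnorm_scl flip: scl_diff_right)
    also have "\<dots> \<le> cmod (a I ks) * (sum_list (map (\<lambda>k. \<bar>of_int k\<bar>) ks) * d)"
      by (intro mult_left_mono unitary_monomial_diff[OF l] assms) auto
    finally show "cnorm A (scl A (a I ks) (monomial A u I ks) \<ominus> scl A (a I ks) (monomial A v I ks))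
        \<le> cmod (a I ks) * sum_list (map (\<lambda>k. \<bar>of_int k\<bar>) ks) * d" by (simp only: mult.assoc)
  qed
  also have "\<dots> = S_lipschitz a N I * d" by (simp add: S_lipschitz_def sum_distrib_right)
  finally have XY: "cnorm A (X \<ominus> Y) \<le> S_lipschitz a N I * d" .
  have "scl A (1/2) (X \<oplus> adj A X) \<ominus> scl A (1/2) (Y \<oplus> adj A Y) = scl A (1/2) ((X \<oplus> adj A X) \<ominus> (Y \<oplus> adj A Y))"
    using c by (simp add: scl_diff_right)
  also have "(X \<oplus> adj A X) \<ominus> (Y \<oplus> adj A Y) = (X \<ominus> Y) \<oplus> adj A (X \<ominus> Y)"
    using c by (simp add: adj_diff a_minus_def adj_add adj_minus minus_add a_ac)
  finally have "cnorm A (e_elem A a N I u \<ominus> e_elem A a N I v) = cnorm A ((X \<ominus> Y) \<oplus> adj A (X \<ominus> Y)) / 2"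
    using c by (simp add: e_elem_def X_def Y_def cnorm_scl norm_divide)
  also have "\<dots> \<le> cnorm A (X \<ominus> Y)"
    using cnorm_triangle[of "X \<ominus> Y" "adj A (X \<ominus> Y)"] c by simp
  finally show ?thesis using XY by simp
qed

text \<open>With r < 1/8 one has r + r^2 < 1/8 + 1/64 < 1/4, so the cut at 1/2 is defined. It moves
  e by at most 1/2, hence stays at distance below 1/2 + 1/8 < 1 from p.\<close>

lemma R_elem_near_projection:
  assumes \<tau>: "tracial_state A \<tau>" and p: "is_projection A p"
    and u: "\<And>i. i \<in> set I \<Longrightarrow> u i \<in> Units A"
    and d: "cnorm A (e_elem A a N I u \<ominus> p) < 1/8"
  shows "R_defined A a N I u" "\<tau> (R_elem A a N I u) = \<tau> p"
proof -
  define e where "e = e_elem A a N I u"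
  have e: "selfadjoint A e" unfolding e_def using u by (rule e_elem_selfadjoint)
  then have ec: "e \<in> carrier A" by (rule selfadjoint_closed)
  have pc: "p \<in> carrier A" using p by (simp add: is_projection_def selfadjoint_def)
  have n: "0 \<le> cnorm A (e \<ominus> p)" "cnorm A (e \<ominus> p) < 1/8" using d ec pc by (simp_all add: e_def cnorm_nonneg)
  have "(cnorm A (e \<ominus> p))\<^sup>2 \<le> (1/8)\<^sup>2" using n by (intro power_mono) auto
  then have c: "cnorm A (e \<otimes> e \<ominus> e) < 1/4"
    using near_projection_idempotent[OF p ec] n by (simp add: power2_eq_square)
  then show "R_defined A a N I u"
    using half_notin_spectrum[OF e] by (simp add: R_defined_def Let_def e_def)
  note q = chi_half_projection[OF e c]
  have "cnorm A (chi_half A e \<ominus> p) \<le> cnorm A (chi_half A e \<ominus> e) + cnorm A (e \<ominus> p)"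
    using q(1) ec pc by (intro cnorm_dist_triangle) (auto simp: is_projection_def selfadjoint_def)
  then have "cnorm A (chi_half A e \<ominus> p) < 1" using q(2) n by simp
  from tracial_state_close_projections[OF \<tau> q(1) p this]
  show "\<tau> (R_elem A a N I u) = \<tau> p" by (simp add: R_elem_def e_def)
qed

end

lemma monomial_cong: "(\<And>i. i \<in> set I \<Longrightarrow> u i = v i) \<Longrightarrow> monomial A u I ks = monomial A v I ks"
  unfolding monomial_def
  by (rule arg_cong[where f = "\<lambda>xs. foldr _ xs _"]) (auto dest: set_zip_leftD)

text \<open>Homomorphisms are prescribed on the generators with index below n only, so families have
  to be compared on the entries of I alone.\<close>

lemma e_elem_cong: "(\<And>i. i \<in> set I \<Longrightarrow> u i = v i) \<Longrightarrow> e_elem A a N I u = e_elem A a N I v"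
  using monomial_cong[of I u v A] by (simp add: e_elem_def S_elem_def)

text \<open>Carriers consist of reals because the universal property supplies homomorphisms there.
  The target algebra enters the estimate only through contractivity and norm bounds for unitaries,
  so one \<delta> serves all of them.\<close>

lemma delta_works_real:
  fixes T :: "'t cstar_algebra"
  assumes torus: "is_nc_torus n \<Theta> T U"
    and skew: "\<And>i j. i < n \<Longrightarrow> j < n \<Longrightarrow> \<Theta> $$ (j, i) = - \<Theta> $$ (i, j)"
    and irr: "totally_irrational n \<Theta>"
    and \<tau>0: "tracial_state T \<tau>0"
    and P: "\<And>I. I \<in> even_tuples n \<Longrightarrow> is_projection T (P I)"
    and tr: "\<And>I. I \<in> even_tuples n \<Longrightarrow> \<tau>0 (P I) = of_real (trace_value \<Theta> k k0 I)"
    and expn: "\<And>I. I \<in> even_tuples n \<Longrightarrow> (\<lambda>M. cnorm T (P I \<ominus>\<^bsub>T\<^esub> S_elem T a M I U)) \<longlonglongrightarrow> 0"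
    and near: "\<And>I. I \<in> even_tuples n \<Longrightarrow> cnorm T (P I \<ominus>\<^bsub>T\<^esub> e_elem T a N I U) < 1/8"
  shows "\<exists>\<delta>>0. delta_works TYPE(real) n \<Theta> a N k k0 \<delta>"
proof -
  \<comment> \<open>The margin left below 1/8, divided by the Lipschitz constant. The added 1 keeps
    the denominator positive and makes the final estimate strict.\<close>
  define \<delta>I where "\<delta>I I = (1/8 - cnorm T (P I \<ominus>\<^bsub>T\<^esub> e_elem T a N I U)) / (S_lipschitz a N I + 1)" for I
  \<comment> \<open>The inserted 1 guarantees a nonempty set for \<open>Min\<close>.\<close>
  define \<delta> where "\<delta> = Min (insert 1 (\<delta>I ` even_tuples n))"
  have pos: "\<delta>I I > 0" if "I \<in> even_tuples n" for I
    using near[OF that] S_lipschitz_nonneg[of a N I] by (simp add: \<delta>I_def)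
  have \<delta>: "\<delta> > 0" unfolding \<delta>_def using pos by (subst Min_gr_iff) (auto simp: finite_even_tuples)
  have \<delta>_le: "\<delta> \<le> \<delta>I I" if "I \<in> even_tuples n" for I
    unfolding \<delta>_def using that by (intro Min_le) (auto simp: finite_even_tuples)
  interpret T: unital_cstar_algebra T using torus by (simp add: is_nc_torus_def)
  have relT: "nc_torus_relations n \<Theta> T U" using torus by (simp add: is_nc_torus_def)
  have "delta_works TYPE(real) n \<Theta> a N k k0 \<delta>"
    unfolding delta_works_def
  proof (intro allI impI ballI)
    fix A :: "real cstar_algebra" and u v I
    assume H: "unital_cstar_algebra A \<and> (\<exists>\<tau>. tracial_state A \<tau>) \<and>
        (\<forall>j<n. unitary_elem A (u j)) \<and> (\<forall>j<n. unitary_elem A (v j)) \<and>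
        (\<forall>j<n. \<forall>k<n. commutation_defect A \<Theta> u j k < 2) \<and>
        (\<forall>j<n. \<forall>k<n. v k \<otimes>\<^bsub>A\<^esub> v j = scl A (twist \<Theta> j k) (v j \<otimes>\<^bsub>A\<^esub> v k)) \<and>
        (\<forall>j<n. cnorm A (v j \<ominus>\<^bsub>A\<^esub> u j) < \<delta>)"
    assume I: "I \<in> even_tuples n"
    interpret A: unital_cstar_algebra A using H by blast
    have relA: "nc_torus_relations n \<Theta> A v" using H unfolding nc_torus_relations_def by blast
    have uA: "unitary_elem A (u j)" and vA: "unitary_elem A (v j)" and uv: "cnorm A (v j \<ominus>\<^bsub>A\<^esub> u j) < \<delta>"
      if "j < n" for j using H that by blast+
    have UT: "unitary_elem T (U j)" if "j < n" for j
      using relT that unfolding nc_torus_relations_def by blast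
    obtain \<phi> where \<phi>: "cstar_hom T A \<phi>" "\<forall>j<n. \<phi> (U j) = v j"
      using torus relA A.unital_cstar_algebra_axioms unfolding is_nc_torus_def by blast
    interpret unital_cstar_hom T A \<phi> by unfold_locales (rule \<phi>)
    have In: "i < n" if "i \<in> set I" for i using I that by (auto simp: even_tuples_def)
    have UT: "U i \<in> Units T" and UA: "u i \<in> Units A" "v i \<in> Units A" if "i \<in> set I" for i
      using UT uA vA In[OF that] by (simp_all add: T.unitary_Units A.unitary_Units)
    have PT: "P I \<in> carrier T" using P[OF I] by (simp add: is_projection_def selfadjoint_def)
    have ec: "e_elem T a N I U \<in> carrier T" "e_elem A a N I u \<in> carrier A" "e_elem A a N I v \<in> carrier A"
      using UT UA by (auto intro: T.e_elem_closed A.e_elem_closed)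
    have ev: "\<phi> (e_elem T a N I U) = e_elem A a N I v"
      using hom_e_elem[of I U a N] UT \<phi>(2) In e_elem_cong[of I "\<lambda>i. \<phi> (U i)" v] by simp
    have "cnorm A (\<phi> (P I) \<ominus>\<^bsub>A\<^esub> e_elem A a N I v) \<le> cnorm T (P I \<ominus>\<^bsub>T\<^esub> e_elem T a N I U)"
      using hom_contractive[of "P I \<ominus>\<^bsub>T\<^esub> e_elem T a N I U"] PT ec by (simp add: ev)
    moreover have "cnorm A (e_elem A a N I v \<ominus>\<^bsub>A\<^esub> e_elem A a N I u) \<le> S_lipschitz a N I * \<delta>"
      using uA vA uv In by (intro A.e_elem_lipschitz) (auto intro: less_imp_le)
    moreover have "S_lipschitz a N I * \<delta> < (S_lipschitz a N I + 1) * \<delta>I I"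
      using S_lipschitz_nonneg[of a N I] \<delta>_le[OF I] \<delta> pos[OF I]
      by (intro le_less_trans[OF mult_left_mono[OF \<delta>_le[OF I]]]) (auto simp: algebra_simps)
    moreover have "(S_lipschitz a N I + 1) * \<delta>I I = 1/8 - cnorm T (P I \<ominus>\<^bsub>T\<^esub> e_elem T a N I U)"
      using S_lipschitz_nonneg[of a N I] by (simp add: \<delta>I_def)
    ultimately have d: "cnorm A (e_elem A a N I u \<ominus>\<^bsub>A\<^esub> \<phi> (P I)) < 1/8"
      using A.cnorm_dist_triangle[of "\<phi> (P I)" "e_elem A a N I v" "e_elem A a N I u"]
        A.cnorm_diff_commute[of "\<phi> (P I)" "e_elem A a N I u"] PT ec by simp
    note R = A.R_elem_near_projection[OF _ hom_projection[OF P[OF I]] UA(1) d]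
    show "R_defined A a N I u \<and> (\<forall>\<tau>. tracial_state A \<tau> \<longrightarrow> \<tau> (R_elem A a N I u) = complex_of_real (trace_value \<Theta> k k0 I))"
    proof (intro conjI allI impI)
      show "R_defined A a N I u" using R(1) H by blast
      fix \<tau> assume \<tau>: "tracial_state A \<tau>"
      have "\<tau> (R_elem A a N I u) = \<tau> (\<phi> (P I))" using R(2)[OF \<tau>] .
      also have "\<dots> = a I (replicate (length I) 0)"
        by (rule T.torus_expansion_trace[OF hom_tracial_state[OF \<tau>] irr skew relT I PT expn[OF I]])
      also have "\<dots> = \<tau>0 (P I)"
        by (rule T.torus_expansion_trace[OF \<tau>0 irr skew relT I PT expn[OF I], symmetric])
      finally show "\<tau> (R_elem A a N I u) = complex_of_real (trace_value \<Theta> k k0 I)" by (simp add: tr[OF I])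
    qed
  qed
  then show ?thesis using \<delta> by blast
qed

section \<open>Transfer to arbitrary carrier types\<close>

lemma dense_sequence_complex:
  assumes "\<And>X :: complex set. open X \<Longrightarrow> X \<noteq> {} \<Longrightarrow> \<exists>d\<in>Q. d \<in> X"
  shows "\<exists>q. (\<forall>i. q i \<in> Q) \<and> q \<longlonglongrightarrow> c"
proof -
  have "\<exists>d\<in>Q. d \<in> ball c (inverse (Suc i))" for i
    using assms[of "ball c (inverse (Suc i))"] by simp
  then obtain q where q: "\<And>i. q i \<in> Q" "\<And>i. dist c (q i) < inverse (Suc i)" by (metis mem_ball)
  have "(\<lambda>i. dist (q i) c) \<longlonglongrightarrow> 0"
    by (rule tendsto_sandwich[OF _ _ tendsto_const LIMSEQ_inverse_real_of_nat])
      (use q in \<open>auto simp: dist_commute less_imp_le\<close>)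
  then show ?thesis using q tendsto_dist_iff by blast
qed

context unital_cstar_algebra
begin

text \<open>The second clause is what makes the cardinality argument work: the subalgebra is the set of
  limits of sequences in the countable set \<open>D\<close>.\<close>

lemma separable_subalgebra:
  assumes G: "countable G" "G \<subseteq> carrier A"
  shows "\<exists>C D. cstar_subalgebra A C \<and> \<one> \<in> C \<and> G \<subseteq> C \<and> countable D \<and> D \<subseteq> carrier A \<and>
    (\<forall>x\<in>C. \<exists>X. (\<forall>i::nat. X i \<in> D) \<and> (\<lambda>i. cnorm A (X i \<ominus> x)) \<longlonglongrightarrow> 0)"
proof -
  obtain Q :: "complex set" where Q: "countable Q" "\<And>X. open X \<Longrightarrow> X \<noteq> {} \<Longrightarrow> \<exists>d\<in>Q. d \<in> X"
    using countable_dense_exists by blast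
  \<comment> \<open>One round of the algebra operations with scalars from a countable dense set
    only, so that the iterates stay countable. Arbitrary scalars are recovered in the limit.\<close>
  define st where "st S = S \<union> (\<lambda>(x, y). x \<oplus> y) ` (S \<times> S) \<union> (\<lambda>(x, y). x \<otimes> y) ` (S \<times> S)
    \<union> adj A ` S \<union> (\<lambda>(c, x). scl A c x) ` (Q \<times> S)" for S
  define Dn where "Dn n = (st ^^ n) (insert \<zero> (insert \<one> G))" for n
  define D where "D = (\<Union>n. Dn n)"
  have Dn0: "Dn 0 = insert \<zero> (insert \<one> G)" and DnS: "Dn (Suc n) = st (Dn n)" for n by (simp_all add: Dn_def)
  have cDn: "countable (Dn n)" and sDn: "Dn n \<subseteq> carrier A" for n
    by (induction n) (use G Q(1) in \<open>auto simp: Dn0 DnS st_def\<close>)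
  have D: "countable D" "D \<subseteq> carrier A" using cDn sDn by (auto simp: D_def)
  have "Dn n \<subseteq> Dn (Suc n)" for n by (auto simp: DnS st_def)
  then have mono: "Dn m \<subseteq> Dn n" if "m \<le> n" for m n using that by (rule lift_Suc_mono_le)
  have D1: "\<zero> \<in> D" "\<one> \<in> D" "G \<subseteq> D" using Dn0 by (auto simp: D_def)
  have Dst: "\<exists>n. x \<in> Dn n \<and> y \<in> Dn n" if "x \<in> D" "y \<in> D" for x y
  proof -
    from that obtain m n where "x \<in> Dn m" "y \<in> Dn n" by (auto simp: D_def)
    then have "x \<in> Dn (max m n)" "y \<in> Dn (max m n)" using mono[of m "max m n"] mono[of n "max m n"] by auto
    then show ?thesis by blast
  qed
  have Dadd: "x \<oplus> y \<in> D" and Dmult: "x \<otimes> y \<in> D" if xy: "x \<in> D" "y \<in> D" for x y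
  proof -
    obtain n where "x \<in> Dn n" "y \<in> Dn n" using Dst[OF xy] by blast
    then have "x \<oplus> y \<in> Dn (Suc n)" "x \<otimes> y \<in> Dn (Suc n)" by (auto simp: DnS st_def)
    then show "x \<oplus> y \<in> D" "x \<otimes> y \<in> D" by (auto simp: D_def simp del: funpow.simps)
  qed
  have Dadj: "adj A x \<in> D" and Dscl: "c \<in> Q \<Longrightarrow> scl A c x \<in> D" if x: "x \<in> D" for x c
  proof -
    obtain n where n: "x \<in> Dn n" using Dst[OF x x] by blast
    then have "adj A x \<in> Dn (Suc n)" by (auto simp: DnS st_def)
    then show "adj A x \<in> D" by (auto simp: D_def)
    assume "c \<in> Q"
    then have "scl A c x \<in> Dn (Suc n)" using n by (auto simp: DnS st_def)
    then show "scl A c x \<in> D" by (auto simp: D_def)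
  qed
  define lm where "lm X x \<longleftrightarrow> (\<forall>i::nat. X i \<in> D) \<and> (\<lambda>i. cnorm A (X i \<ominus> x)) \<longlonglongrightarrow> 0" for X x
  define C where "C = {x \<in> carrier A. \<exists>X. lm X x}"
  have lmc: "X i \<in> carrier A" if "lm X x" for X x i using that D(2) by (auto simp: lm_def)
  have DC: "x \<in> C" if "x \<in> D" for x
  proof -
    have "lm (\<lambda>_. x) x" using that D(2) lim_const[of x] by (auto simp: lm_def)
    then show ?thesis using that D(2) by (auto simp: C_def)
  qed
  have Cadd: "x \<oplus> y \<in> C" and Cmult: "x \<otimes> y \<in> C" if xy: "x \<in> C" "y \<in> C" for x y
  proof -
    obtain X Y where XY: "lm X x" "lm Y y" "x \<in> carrier A" "y \<in> carrier A" using xy by (auto simp: C_def)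
    note c = lmc[OF XY(1)] lmc[OF XY(2)] XY(3,4)
    have l: "(\<lambda>i. cnorm A (X i \<ominus> x)) \<longlonglongrightarrow> 0" "(\<lambda>i. cnorm A (Y i \<ominus> y)) \<longlonglongrightarrow> 0"
      using XY by (simp_all add: lm_def)
    have "lm (\<lambda>i. X i \<oplus> Y i) (x \<oplus> y)" using lim_add[OF c l] XY Dadd by (simp add: lm_def)
    then show "x \<oplus> y \<in> C" using c by (auto simp: C_def)
    have "lm (\<lambda>i. X i \<otimes> Y i) (x \<otimes> y)" using lim_mult[OF c l] XY Dmult by (simp add: lm_def)
    then show "x \<otimes> y \<in> C" using c by (auto simp: C_def)
  qed
  have Cadj: "adj A x \<in> C" and Cscl: "scl A c x \<in> C" if x: "x \<in> C" for x c
  proof -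
    obtain X where X: "lm X x" "x \<in> carrier A" using x by (auto simp: C_def)
    have l: "(\<lambda>i. cnorm A (X i \<ominus> x)) \<longlonglongrightarrow> 0" using X by (simp add: lm_def)
    have "lm (\<lambda>i. adj A (X i)) (adj A x)" using lim_adj[OF lmc[OF X(1)] X(2) l] X Dadj by (simp add: lm_def)
    then show "adj A x \<in> C" using X by (auto simp: C_def)
    obtain q where q: "\<And>i. q i \<in> Q" "q \<longlonglongrightarrow> c" using dense_sequence_complex[OF Q(2)] by blast
    have "lm (\<lambda>i. scl A (q i) (X i)) (scl A c x)"
      using lim_scl[OF lmc[OF X(1)] X(2) q(2) l] X Dscl q(1) by (simp add: lm_def)
    then show "scl A c x \<in> C" using X by (auto simp: C_def)
  qed
  have Clim: "x \<in> C" if Y: "\<And>i::nat. Y i \<in> C" and x: "x \<in> carrier A"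
    and l: "(\<lambda>i. cnorm A (Y i \<ominus> x)) \<longlonglongrightarrow> 0" for Y x
  proof -
    have Yc: "Y i \<in> carrier A" for i using Y[of i] by (simp add: C_def)
    \<comment> \<open>Limits of limits: choosing a point of D within 1/(i + 1) of \<open>Y i\<close>
      gives one sequence in D with the same limit as Y.\<close>
    have "\<exists>d\<in>D. cnorm A (d \<ominus> Y i) < inverse (Suc i)" for i
    proof -
      obtain X where X: "lm X (Y i)" using Y[of i] by (auto simp: C_def)
      then have "(\<lambda>j. cnorm A (X j \<ominus> Y i)) \<longlonglongrightarrow> 0" by (simp add: lm_def)
      then have "eventually (\<lambda>j. cnorm A (X j \<ominus> Y i) < inverse (Suc i)) sequentially"
        by (rule order_tendstoD) simp
      then obtain j where "cnorm A (X j \<ominus> Y i) < inverse (Suc i)" by (auto simp: eventually_sequentially)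
      moreover have "X j \<in> D" using X by (simp add: lm_def)
      ultimately show ?thesis by blast
    qed
    then obtain Z where Z: "\<And>i. Z i \<in> D" "\<And>i. cnorm A (Z i \<ominus> Y i) < inverse (Suc i)" by metis
    have Zc: "Z i \<in> carrier A" for i using Z(1) D(2) by blast
    have "(\<lambda>i. cnorm A (Z i \<ominus> x)) \<longlonglongrightarrow> 0"
    proof (rule lim_comparison[OF Zc x])
      show "cnorm A (Z i \<ominus> x) \<le> inverse (Suc i) + cnorm A (Y i \<ominus> x)" for i
        using cnorm_dist_triangle[OF Zc[of i] Yc[of i] x] Z(2)[of i] by simp
      show "(\<lambda>i. inverse (Suc i) + cnorm A (Y i \<ominus> x)) \<longlonglongrightarrow> 0"
        using tendsto_add[OF LIMSEQ_inverse_real_of_nat l] by simp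
    qed
    then have "lm Z x" using Z(1) by (simp add: lm_def)
    then show ?thesis using x by (auto simp: C_def)
  qed
  have "cstar_subalgebra A C"
    unfolding cstar_subalgebra_def
  proof (intro conjI ballI allI impI)
    show "x \<in> C" if "(\<forall>i. X i \<in> C) \<and> x \<in> carrier A \<and> (\<lambda>i. cnorm A (X i \<ominus> x)) \<longlonglongrightarrow> 0" for X x
      by (rule Clim[of X]) (use that in blast)+
    show "C \<subseteq> carrier A" by (auto simp: C_def)
  qed (fact DC[OF D1(1)] Cadd Cmult Cadj Cscl)+
  moreover have "\<forall>x\<in>C. \<exists>X. (\<forall>i. X i \<in> D) \<and> (\<lambda>i. cnorm A (X i \<ominus> x)) \<longlonglongrightarrow> 0"
    by (auto simp: C_def lm_def)
  moreover have "\<one> \<in> C" "G \<subseteq> C" using D1 DC by auto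
  ultimately show ?thesis using D by (intro exI[of _ C] exI[of _ D] conjI)
qed

lemma separable_subalgebra_real:
  assumes G: "countable G" "G \<subseteq> carrier A"
  shows "\<exists>C (g :: 'a \<Rightarrow> real). cstar_subalgebra A C \<and> \<one> \<in> C \<and> G \<subseteq> C \<and> inj_on g C"
proof -
  obtain C D where C: "cstar_subalgebra A C" "\<one> \<in> C" "G \<subseteq> C" and D: "countable D" "D \<subseteq> carrier A"
    and ex: "\<forall>x\<in>C. \<exists>X. (\<forall>i::nat. X i \<in> D) \<and> (\<lambda>i. cnorm A (X i \<ominus> x)) \<longlonglongrightarrow> 0"
    using separable_subalgebra[OF G] by blast
  have Cc: "C \<subseteq> carrier A" using C(1) by (simp add: cstar_subalgebra_def)
  obtain X where X: "\<And>x i. x \<in> C \<Longrightarrow> X x i \<in> D" "\<And>x. x \<in> C \<Longrightarrow> (\<lambda>i. cnorm A (X x i \<ominus> x)) \<longlonglongrightarrow> 0"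
    using ex by metis
  \<comment> \<open>The graph of the approximating sequence, coded as a set of naturals. Since the
    position i is part of the code, the sequence and hence its limit can be recovered from the
    set.\<close>
  define f where "f x = range (\<lambda>i. prod_encode (i, to_nat_on D (X x i)))" for x
  have "inj_on f C"
  proof (rule inj_onI)
    fix x y assume xy: "x \<in> C" "y \<in> C" "f x = f y"
    have "X x i = X y i" for i
    proof -
      have "prod_encode (i, to_nat_on D (X x i)) \<in> f y" using xy(3) by (auto simp: f_def)
      then have "to_nat_on D (X x i) = to_nat_on D (X y i)" by (auto simp: f_def)
      then show ?thesis using X(1) xy(1,2) D(1) by (simp add: to_nat_on_inj)
    qed
    then have "X x = X y" by (rule ext)
    then show "x = y"
      using X(1)[OF xy(1)] X(2)[OF xy(1)] X(2)[OF xy(2)] xy(1,2) D(2) Cc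
      by (intro lim_unique[of "X x"]) auto
  qed
  moreover obtain h :: "nat set \<Rightarrow> real" where "bij h"
    using nat_sets_eqpoll_reals by (auto simp: eqpoll_def)
  ultimately have "inj_on (h \<circ> f) C" using inj_on_subset[OF bij_is_inj] by (intro comp_inj_on) auto
  then show ?thesis using C by blast
qed

end

section \<open>Transport of structure along an injection\<close>

definition copy_algebra :: "('a, 'm) cstar_algebra_scheme \<Rightarrow> 'a set \<Rightarrow> ('a \<Rightarrow> 'b) \<Rightarrow> 'b cstar_algebra" where
  "copy_algebra A C g = (let h = inv_into C g in
    \<lparr>carrier = g ` C, mult = \<lambda>x y. g (h x \<otimes>\<^bsub>A\<^esub> h y), one = g \<one>\<^bsub>A\<^esub>,
     zero = g \<zero>\<^bsub>A\<^esub>, add = \<lambda>x y. g (h x \<oplus>\<^bsub>A\<^esub> h y),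
     scl = \<lambda>c x. g (scl A c (h x)), adj = \<lambda>x. g (adj A (h x)), cnorm = \<lambda>x. cnorm A (h x)\<rparr>)"

text \<open>Identities carry over along the bijection. Completeness is where closedness of C enters:
  the limit found in A has to lie in C.\<close>

lemma (in unital_cstar_algebra) copy_algebra:
  fixes g :: "'a \<Rightarrow> 'b"
  assumes C: "cstar_subalgebra A C" "\<one> \<in> C" and g: "inj_on g C"
  shows "unital_cstar_algebra (copy_algebra A C g)"
    and "cstar_hom (copy_algebra A C g) A (inv_into C g)"
proof -
  define h where "h = inv_into C g"
  define B where "B = copy_algebra A C g"
  have B: "carrier B = g ` C" "x \<otimes>\<^bsub>B\<^esub> y = g (h x \<otimes> h y)" "\<one>\<^bsub>B\<^esub> = g \<one>" "\<zero>\<^bsub>B\<^esub> = g \<zero>"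
    "x \<oplus>\<^bsub>B\<^esub> y = g (h x \<oplus> h y)" "scl B c x = g (scl A c (h x))" "adj B x = g (adj A (h x))"
    "cnorm B x = cnorm A (h x)" for x y c
    by (simp_all add: B_def copy_algebra_def Let_def h_def)
  have hg: "h (g x) = x" if "x \<in> C" for x using g that by (simp add: h_def)
  have Cc: "x \<in> carrier A" if "x \<in> C" for x using C(1) that by (auto simp: cstar_subalgebra_def)
  have C0: "\<zero> \<in> C" and Ca: "x \<in> C \<Longrightarrow> y \<in> C \<Longrightarrow> x \<oplus> y \<in> C" and Cm: "x \<in> C \<Longrightarrow> y \<in> C \<Longrightarrow> x \<otimes> y \<in> C"
    and Cs: "x \<in> C \<Longrightarrow> scl A c x \<in> C" and Cj: "x \<in> C \<Longrightarrow> adj A x \<in> C" for x y c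
    using C(1) by (auto simp: cstar_subalgebra_def)
  have Cl: "x \<in> C" if "\<And>i. X i \<in> C" "x \<in> carrier A" "(\<lambda>i::nat. cnorm A (X i \<ominus> x)) \<longlonglongrightarrow> 0" for X x
    using C(1) that unfolding cstar_subalgebra_def by blast
  have Cn: "\<ominus> x \<in> C" if "x \<in> C" for x using Cs[OF that, of "-1"] Cc[OF that] by (simp add: scl_minus_one)
  note cl = C(2) C0 Ca Cm Cs Cj Cc
  have rB: "ring B"
  proof (rule ringI)
    show "abelian_group B"
    proof (rule abelian_groupI)
      fix x assume "x \<in> carrier B"
      then obtain x' where "x = g x'" "x' \<in> C" by (auto simp: B)
      then show "\<exists>y\<in>carrier B. y \<oplus>\<^bsub>B\<^esub> x = \<zero>\<^bsub>B\<^esub>"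
        by (intro bexI[of _ "g (\<ominus> x')"]) (simp_all add: B hg Cn cl l_neg)
    qed (auto simp: B hg cl a_ac)
    show "monoid B" by (rule monoidI) (auto simp: B hg cl m_assoc)
  qed (auto simp: B hg cl l_distr r_distr)
  interpret B: ring B by (rule rB)
  have neg: "\<ominus>\<^bsub>B\<^esub> (g x) = g (\<ominus> x)" if "x \<in> C" for x
    by (rule B.minus_equality) (use that in \<open>simp_all add: B hg Cn cl l_neg\<close>)
  have diff: "g x \<ominus>\<^bsub>B\<^esub> g y = g (x \<ominus> y)" if "x \<in> C" "y \<in> C" for x y
    using that by (simp add: a_minus_def neg B hg Cn)
  have Cd: "x \<ominus> y \<in> C" if "x \<in> C" "y \<in> C" for x y using that by (simp add: a_minus_def Ca Cn)
  show "unital_cstar_algebra (copy_algebra A C g)"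
    unfolding B_def[symmetric]
  proof (intro unital_cstar_algebra.intro rB unital_cstar_algebra_axioms.intro)
    fix x assume "x \<in> carrier B"
    then show "(cnorm B x = 0) = (x = \<zero>\<^bsub>B\<^esub>)"
      using inj_on_eq_iff[OF g _ C0] by (auto simp: B hg cl cnorm_eq_zero)
  next
    fix X :: "nat \<Rightarrow> 'b"
    assume X: "\<And>i. X i \<in> carrier B"
      and cau: "\<And>e. e > 0 \<Longrightarrow> \<exists>M. \<forall>i\<ge>M. \<forall>j\<ge>M. cnorm B (X i \<ominus>\<^bsub>B\<^esub> X j) < e"
    have "\<exists>y\<in>C. X i = g y" for i using X[of i] by (auto simp: B)
    then obtain Y where Y: "\<And>i. Y i \<in> C" "\<And>i. X i = g (Y i)" by metis
    have n: "cnorm B (X i \<ominus>\<^bsub>B\<^esub> g y) = cnorm A (Y i \<ominus> y)" if "y \<in> C" for i y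
      using Y that by (simp add: diff B(8) hg Cd)
    have n2: "cnorm B (X i \<ominus>\<^bsub>B\<^esub> X j) = cnorm A (Y i \<ominus> Y j)" for i j
      using n[OF Y(1)[of j], of i] by (simp add: Y(2))
    obtain y where y: "y \<in> carrier A" "(\<lambda>i. cnorm A (Y i \<ominus> y)) \<longlonglongrightarrow> 0"
      using cnorm_complete[of Y] cau Y(1) Cc unfolding n2 by blast
    have yC: "y \<in> C" using Cl[OF Y(1) y] .
    show "\<exists>x\<in>carrier B. (\<lambda>i. cnorm B (X i \<ominus>\<^bsub>B\<^esub> x)) \<longlonglongrightarrow> 0"
      using y(2) yC n[OF yC] by (intro bexI[of _ "g y"]) (simp_all add: B(1))
  qed (auto simp: B hg cl scl_add_right scl_add_left scl_scl scl_one scl_mult_left scl_mult_right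
      adj_adj adj_add adj_scl adj_mult cnorm_nonneg cnorm_triangle cnorm_scl cnorm_mult cnorm_cstar)
  show "cstar_hom (copy_algebra A C g) A (inv_into C g)"
    unfolding B_def[symmetric] h_def[symmetric] cstar_hom_def
    by (auto simp: B hg cl ring_hom_def)
qed

text \<open>The norm clause holds even off the carrier, because the norm of the copy is defined as
  the norm of A after the inverse map.\<close>

lemma (in unital_cstar_algebra) real_copy:
  assumes G: "countable G" "G \<subseteq> carrier A"
  shows "\<exists>(B :: real cstar_algebra) \<psi>. unital_cstar_algebra B \<and> cstar_hom B A \<psi> \<and>
    (\<forall>x. cnorm A (\<psi> x) = cnorm B x) \<and> G \<subseteq> \<psi> ` carrier B"
proof -
  obtain C and g :: "'a \<Rightarrow> real" where C: "cstar_subalgebra A C" "\<one> \<in> C" "G \<subseteq> C" "inj_on g C"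
    using separable_subalgebra_real[OF G] by blast
  have "G \<subseteq> inv_into C g ` carrier (copy_algebra A C g)"
    using C(3,4) by (force simp: copy_algebra_def Let_def image_image)
  moreover have "cnorm A (inv_into C g x) = cnorm (copy_algebra A C g) x" for x
    by (simp add: copy_algebra_def Let_def)
  ultimately show ?thesis using copy_algebra[OF C(1,2,4)] by blast
qed

text \<open>The data are pulled back along an isometric embedding of an algebra B carried by reals.
  Tracial states are only pulled back, never extended, and R_I commutes with the embedding because
  both calculi are limits of the same polynomials.\<close>

lemma delta_works_transfer:
  assumes real: "delta_works TYPE(real) n \<Theta> a N k k0 \<delta>"
  shows "delta_works TYPE('a) n \<Theta> a N k k0 \<delta>"
  unfolding delta_works_def
proof (intro allI impI ballI)
  fix A :: "'a cstar_algebra" and u v I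
  assume H: "unital_cstar_algebra A \<and> (\<exists>\<tau>. tracial_state A \<tau>) \<and>
        (\<forall>j<n. unitary_elem A (u j)) \<and> (\<forall>j<n. unitary_elem A (v j)) \<and>
        (\<forall>j<n. \<forall>k<n. commutation_defect A \<Theta> u j k < 2) \<and>
        (\<forall>j<n. \<forall>k<n. v k \<otimes>\<^bsub>A\<^esub> v j = scl A (twist \<Theta> j k) (v j \<otimes>\<^bsub>A\<^esub> v k)) \<and>
        (\<forall>j<n. cnorm A (v j \<ominus>\<^bsub>A\<^esub> u j) < \<delta>)"
  assume I: "I \<in> even_tuples n"
  interpret A: unital_cstar_algebra A using H by blast
  have uv: "unitary_elem A (u j)" "unitary_elem A (v j)" "cnorm A (v j \<ominus>\<^bsub>A\<^esub> u j) < \<delta>"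
    and cd: "l < n \<Longrightarrow> commutation_defect A \<Theta> u j l < 2"
    and rel: "l < n \<Longrightarrow> v l \<otimes>\<^bsub>A\<^esub> v j = scl A (twist \<Theta> j l) (v j \<otimes>\<^bsub>A\<^esub> v l)" if "j < n" for j l
    using H that by blast+
  have uvc: "u j \<in> carrier A" "v j \<in> carrier A" if "j < n" for j
    using uv[OF that] by (simp_all add: A.unitary_closed)
  have "countable (u ` {..<n} \<union> v ` {..<n})" "u ` {..<n} \<union> v ` {..<n} \<subseteq> carrier A"
    using uvc by (auto simp: countable_finite)
  from A.real_copy[OF this]
  obtain B :: "real cstar_algebra" and \<psi> where B: "unital_cstar_algebra B" "cstar_hom B A \<psi>"
    and iso: "\<And>x. cnorm A (\<psi> x) = cnorm B x" and G: "u ` {..<n} \<union> v ` {..<n} \<subseteq> \<psi> ` carrier B"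
    by blast
  interpret B: unital_cstar_algebra B by (rule B)
  interpret unital_cstar_hom B A \<psi> by unfold_locales (rule B)
  \<comment> \<open>Isometry makes \<open>\<psi>\<close> injective, so unitarity and the commutation
    relations, known after applying \<open>\<psi>\<close>, already hold in B.\<close>
  have inj: "x = y" if "\<psi> x = \<psi> y" "x \<in> carrier B" "y \<in> carrier B" for x y
  proof -
    have "\<psi> (x \<ominus>\<^bsub>B\<^esub> y) = \<zero>\<^bsub>A\<^esub>" using that by (simp add: A.r_neg a_minus_def[of A])
    then have "cnorm B (x \<ominus>\<^bsub>B\<^esub> y) = 0" using iso[of "x \<ominus>\<^bsub>B\<^esub> y"] by simp
    then show ?thesis using that by (simp add: B.cnorm_dist_eq_zero)
  qed
  have "\<exists>x\<in>carrier B. \<psi> x = u j" "\<exists>x\<in>carrier B. \<psi> x = v j" if "j < n" for j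
    using G that by (force simp: image_iff subset_iff)+
  then obtain u' v' where u': "\<And>j. j < n \<Longrightarrow> u' j \<in> carrier B" "\<And>j. j < n \<Longrightarrow> \<psi> (u' j) = u j"
    and v': "\<And>j. j < n \<Longrightarrow> v' j \<in> carrier B" "\<And>j. j < n \<Longrightarrow> \<psi> (v' j) = v j" by metis
  have unit: "unitary_elem B x" if "x \<in> carrier B" "unitary_elem A (\<psi> x)" for x
    using that inj[of "adj B x \<otimes>\<^bsub>B\<^esub> x" "\<one>\<^bsub>B\<^esub>"] inj[of "x \<otimes>\<^bsub>B\<^esub> adj B x" "\<one>\<^bsub>B\<^esub>"]
    by (simp add: unitary_elem_def)
  have tr: "tracial_state B (\<lambda>x. \<tau> (\<psi> x))" if "tracial_state A \<tau>" for \<tau>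
    using that by (rule hom_tracial_state)
  have "unital_cstar_algebra B \<and> (\<exists>\<tau>. tracial_state B \<tau>) \<and>
        (\<forall>j<n. unitary_elem B (u' j)) \<and> (\<forall>j<n. unitary_elem B (v' j)) \<and>
        (\<forall>j<n. \<forall>k<n. commutation_defect B \<Theta> u' j k < 2) \<and>
        (\<forall>j<n. \<forall>k<n. v' k \<otimes>\<^bsub>B\<^esub> v' j = scl B (twist \<Theta> j k) (v' j \<otimes>\<^bsub>B\<^esub> v' k)) \<and>
        (\<forall>j<n. cnorm B (v' j \<ominus>\<^bsub>B\<^esub> u' j) < \<delta>)"
  proof (intro conjI allI impI)
    show "\<exists>\<tau>. tracial_state B \<tau>" using H tr by blast
    show "unitary_elem B (u' j)" "unitary_elem B (v' j)" if "j < n" for j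
      using that u' v' uv by (simp_all add: unit)
    show "cnorm B (v' j \<ominus>\<^bsub>B\<^esub> u' j) < \<delta>" if "j < n" for j
      using that u' v' uv(3)[OF that] by (simp flip: iso)
    show "commutation_defect B \<Theta> u' j l < 2" if "j < n" "l < n" for j l
      using that u' cd[OF that] by (simp add: commutation_defect_def flip: iso)
    show "v' l \<otimes>\<^bsub>B\<^esub> v' j = scl B (twist \<Theta> j l) (v' j \<otimes>\<^bsub>B\<^esub> v' l)" if "j < n" "l < n" for j l
      using rel[OF that] by (intro inj) (simp_all add: v' that)
  qed (rule B)
  then have res: "R_defined B a N I u'" "tracial_state B \<tau> \<Longrightarrow> \<tau> (R_elem B a N I u') = of_real (trace_value \<Theta> k k0 I)" for \<tau>
    using real I unfolding delta_works_def by blast+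
  have In: "i < n" if "i \<in> set I" for i using I that by (auto simp: even_tuples_def)
  have UB: "u' i \<in> Units B" if "i \<in> set I" for i
    using In[OF that] u' uv unit B.unitary_Units by simp
  define e where "e = e_elem B a N I u'"
  have e: "selfadjoint B e" unfolding e_def using UB by (rule B.e_elem_selfadjoint)
  have ec: "e \<in> carrier B" using e by (rule B.selfadjoint_closed)
  have c: "cnorm B (e \<otimes>\<^bsub>B\<^esub> e \<ominus>\<^bsub>B\<^esub> e) < 1/4" using res(1) by (simp add: R_defined_def Let_def e_def)
  have "\<psi> e = e_elem A a N I (\<lambda>i. \<psi> (u' i))" unfolding e_def using UB by (rule hom_e_elem)
  also have "\<dots> = e_elem A a N I u" by (rule e_elem_cong) (simp add: u' In)
  finally have ee: "e_elem A a N I u = \<psi> e" ..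
  have cA: "cnorm A (\<psi> e \<otimes>\<^bsub>A\<^esub> \<psi> e \<ominus>\<^bsub>A\<^esub> \<psi> e) < 1/4"
    using c iso[of "e \<otimes>\<^bsub>B\<^esub> e \<ominus>\<^bsub>B\<^esub> e"] ec by simp
  have "R_elem A a N I u = \<psi> (R_elem B a N I u')"
    unfolding R_elem_def ee using hom_chi_half[OF e c] by (simp add: e_def)
  then show "R_defined A a N I u \<and> (\<forall>\<tau>. tracial_state A \<tau> \<longrightarrow> \<tau> (R_elem A a N I u) = complex_of_real (trace_value \<Theta> k k0 I))"
    using res(2)[OF tr] cA A.half_notin_spectrum[OF hom_selfadjoint[OF e] cA]
    by (simp add: R_defined_def Let_def ee)
qed

text \<open>One number has to serve carriers of every type, and a formula cannot quantify over
  types. Hence the two halves: the number is chosen for carriers of reals, with no reference to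
  \<open>'a\<close>, and the second half shows that any such choice remains good for
  \<open>'a\<close>.\<close>

theorem proposition4p23:
  fixes n :: nat
    and \<Theta> :: "real mat"
    and T :: "'t cstar_algebra"
    and U :: "nat \<Rightarrow> 't"
    and \<tau>\<^sub>0 :: "'t \<Rightarrow> complex"
    and P :: "nat list \<Rightarrow> 't"
    and k :: "nat list \<Rightarrow> nat list \<Rightarrow> int"
    and k0 :: "nat list \<Rightarrow> int"
    and a :: "nat list \<Rightarrow> int list \<Rightarrow> complex"
    and \<delta>' :: real
    and N :: nat
  assumes "n \<ge> 2"
    and "\<Theta> \<in> carrier_mat n n"
    and "transpose_mat \<Theta> = - \<Theta>"
    and "strongly_totally_irrational n \<Theta>"
    and "is_nc_torus n \<Theta> T U"
    and "canonical_trace n T U \<tau>\<^sub>0"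
    and "\<And>I. I \<in> even_tuples n \<Longrightarrow> is_projection T (P I)"
    and "\<And>I. I \<in> even_tuples n \<Longrightarrow> \<tau>\<^sub>0 (P I) = of_real (trace_value \<Theta> k k0 I)"
    and "\<And>I. I \<in> even_tuples n \<Longrightarrow> P I \<in> cstar_generated T (U ` set I)"
    and "\<And>I. I \<in> even_tuples n \<Longrightarrow>
           (\<lambda>M. cnorm T (P I \<ominus>\<^bsub>T\<^esub> S_elem T a M I U)) \<longlonglongrightarrow> 0"
    and "0 < \<delta>'" and "\<delta>' < 1/8" and "chi_close \<delta>'"
    and "0 < N"
    and "\<And>I. I \<in> even_tuples n \<Longrightarrow> cnorm T (P I \<ominus>\<^bsub>T\<^esub> e_elem T a N I U) < \<delta>'"
  shows "(\<exists>\<delta>>0. delta_works TYPE(real) n \<Theta> a N k k0 \<delta>) \<and>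
         (\<forall>\<delta>>0. delta_works TYPE(real) n \<Theta> a N k k0 \<delta> \<longrightarrow> delta_works TYPE('a) n \<Theta> a N k k0 \<delta>)"
proof (intro conjI allI impI)
  have skew: "\<Theta> $$ (j, i) = - \<Theta> $$ (i, j)" if "i < n" "j < n" for i j
    using skew_entry[OF assms(2,3) that] .
  have near: "cnorm T (P I \<ominus>\<^bsub>T\<^esub> e_elem T a N I U) < 1/8" if "I \<in> even_tuples n" for I
    using assms(15)[OF that] assms(12) by simp
  show "\<exists>\<delta>>0. delta_works TYPE(real) n \<Theta> a N k k0 \<delta>"
    using assms(4,6)
    by (intro delta_works_real[OF assms(5) skew _ _ assms(7,8,10) near])
      (simp_all add: strongly_totally_irrational_def canonical_trace_def)
next
  fix \<delta> :: real
  assume "delta_works TYPE(real) n \<Theta> a N k k0 \<delta>"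
  then show "delta_works TYPE('a) n \<Theta> a N k k0 \<delta>" by (rule delta_works_transfer)
qed

end
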